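(* For each $\Omega'\Subset\Omega$ there exist constants $C>0$ and $\rho_0>0$, depending only on $\Omega'$ and the data, such that for every $X\in\Omega'\cap\overline{\{u_0>0\}}$ with $d_0(X)<\frac12\mathrm{dist}(X,\partial\Omega')$ and every $0<\rho\le\rho_0$, $$C^{-1}\rho^\alpha\le\sup_{B_\rho(X)}u_0\le u_0(X)+C\,u_0(X)^{\gamma/2}\rho+C\rho^\alpha.$$
   Context: Standing setting. $N\ge2$; $\Omega\subset\mathbb{R}^N$ is a bounded Lipschitz domain; $f\in C(\partial\Omega)$, $f\ge0$; $0<\gamma<1$ is fixed and $\alpha:=1+\frac{\gamma}{2-\gamma}$. $F:\mathrm{Sym}(N)\to\mathbb{R}$, $F\in C^1(\mathrm{Sym}(N)\setminus\{0\})$, $F(0)=0$, is uniformly elliptic: there are $0<\lambda\le\Lambda$ with $F(M+P)\le F(M)+\Lambda\|P^+\|-\lambda\|P^-\|$ for all $M,P\in\mathrm{Sym}(N)$. Moreover $F$ is assumed to have a priori interior $C^{2,\tau}$ estimates for some $\tau\in(0,1)$. Fix $\rho\in C_0^\infty$ with $\rho\ge0$, $\operatorname{supp}\rho\subset[0,1]$, $\int_0^1\rho=1$, and fix $\sigma_0\in(0,\tfrac12)$. For $\varepsilon>0$ set $B_\varepsilon(t)=\int_0^{(t-\sigma_0\varepsilon^\alpha)/\varepsilon^\alpha}\rho(s)\,ds$ and $\beta_\varepsilon(t)=\gamma t^{\gamma-1}B_\varepsilon(t)$ for $t>0$, $\beta_\varepsilon(t)=0$ for $t\le0$. Problem $(E_\varepsilon)$: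 $F(D^2u)=\beta_\varepsilon(u)$ in $\Omega$ in the viscosity sense, $u=f$ on $\partial\Omega$. Minimal solution: let $\zeta_\varepsilon=\sup\beta_\varepsilon$, let $u_\star$ be the viscosity solution of $F(D^2u)=\zeta_\varepsilon$ in $\Omega$, $u=f$ on $\partial\Omega$, and $u^\star$ the viscosity solution of $F(D^2u)=0$ in $\Omega$, $u=f$ on $\partial\Omega$; define $u_\varepsilon(x)=\inf\{w(x): w\in C(\overline\Omega),\ u_\star\le w\le u^\star,\ w \text{ a viscosity supersolution of } F(D^2w)=\beta_\varepsilon(w)\}$. Limiting function: $u_0$ denotes a limit $u_0=\lim_{k\to\infty}u_{\varepsilon_k}$, locally uniformly in $C^1$ on $\Omega$, along some sequence $\varepsilon_k\to0$ of minimal solutions. $\mathfrak F(u_0)=\partial\{u_0>0\}\cap\Omega$ and $d_0(X)=\mathrm{dist}(X,\mathfrak F(u_0))$. *)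

theory Defs
  imports "HOL-Analysis.Analysis"
begin

definition sym_mat :: "real^'n^'n \<Rightarrow> bool" where
  "sym_mat M \<longleftrightarrow> transpose M = M"

text \<open>Operator norms of the positive and negative parts of a symmetric matrix:
  norm of P^+ = max(0, largest eigenvalue), norm of P^- = max(0, - smallest eigenvalue).\<close>
definition pos_part_norm :: "real^'n^'n \<Rightarrow> real" where
  "pos_part_norm P = max 0 (Sup {v \<bullet> (P *v v) | v. norm v = 1})"

definition neg_part_norm :: "real^'n^'n \<Rightarrow> real" where
  "neg_part_norm P = max 0 (Sup {- (v \<bullet> (P *v v)) | v. norm v = 1})"

definition unif_elliptic :: "(real^'n^'n \<Rightarrow> real) \<Rightarrow> real \<Rightarrow> real \<Rightarrow> bool" where
  "unif_elliptic F lam Lam \<longleftrightarrow> 0 < lam \<and> lam \<le> Lam \<and>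
     (\<forall>M P. sym_mat M \<longrightarrow> sym_mat P \<longrightarrow>
        F (M + P) \<le> F M + Lam * pos_part_norm P - lam * neg_part_norm P)"

definition C1_sym_off0 :: "(real^'n^'n \<Rightarrow> real) \<Rightarrow> bool" where
  "C1_sym_off0 F \<longleftrightarrow> (\<exists>DF :: real^'n^'n \<Rightarrow> real^'n^'n \<Rightarrow> real.
     (\<forall>M. sym_mat M \<and> M \<noteq> 0 \<longrightarrow> (F has_derivative DF M) (at M within {A. sym_mat A})) \<and>
     (\<forall>M. sym_mat M \<and> M \<noteq> 0 \<longrightarrow>
        (\<forall>e>0. \<exists>d>0. \<forall>M'. sym_mat M' \<and> M' \<noteq> 0 \<and> dist M' M < d \<longrightarrow>
           onorm (\<lambda>H. DF M' H - DF M H) < e)))"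

definition C2_near :: "(real^'n \<Rightarrow> real) \<Rightarrow> real^'n \<Rightarrow> real^'n^'n \<Rightarrow> bool" where
  "C2_near phi x0 H \<longleftrightarrow> (\<exists>r>0. \<exists>Dphi D2phi.
     (\<forall>y\<in>ball x0 r. (phi has_derivative (\<lambda>h. Dphi y \<bullet> h)) (at y)
                  \<and> (Dphi has_derivative (\<lambda>h. D2phi y *v h)) (at y)) \<and>
     continuous_on (ball x0 r) D2phi \<and> H = D2phi x0)"

definition visc_sub :: "(real^'n^'n \<Rightarrow> real) \<Rightarrow> (real^'n \<Rightarrow> real) \<Rightarrow> (real^'n) set
     \<Rightarrow> (real^'n \<Rightarrow> real) \<Rightarrow> bool" where
  "visc_sub F h U u \<longleftrightarrow> continuous_on U u \<and>
     (\<forall>x0\<in>U. \<forall>phi H. C2_near phi x0 H \<and>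
        (\<exists>r>0. \<forall>y\<in>ball x0 r \<inter> U. u y - phi y \<le> u x0 - phi x0)
        \<longrightarrow> h x0 \<le> F H)"

definition visc_super :: "(real^'n^'n \<Rightarrow> real) \<Rightarrow> (real^'n \<Rightarrow> real) \<Rightarrow> (real^'n) set
     \<Rightarrow> (real^'n \<Rightarrow> real) \<Rightarrow> bool" where
  "visc_super F h U u \<longleftrightarrow> continuous_on U u \<and>
     (\<forall>x0\<in>U. \<forall>phi H. C2_near phi x0 H \<and>
        (\<exists>r>0. \<forall>y\<in>ball x0 r \<inter> U. u y - phi y \<ge> u x0 - phi x0)
        \<longrightarrow> F H \<le> h x0)"

definition visc_sol :: "(real^'n^'n \<Rightarrow> real) \<Rightarrow> (real^'n \<Rightarrow> real) \<Rightarrow> (real^'n) set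
     \<Rightarrow> (real^'n \<Rightarrow> real) \<Rightarrow> bool" where
  "visc_sol F h U u \<longleftrightarrow> visc_sub F h U u \<and> visc_super F h U u"

definition interior_C2tau_estimates :: "(real^'n^'n \<Rightarrow> real) \<Rightarrow> real \<Rightarrow> bool" where
  "interior_C2tau_estimates F tau \<longleftrightarrow> (\<exists>C>0. \<forall>w.
     continuous_on (cball 0 1) w \<and> visc_sol F (\<lambda>x. 0) (ball 0 1) w \<longrightarrow>
     (let Mw = Sup ((\<lambda>x. \<bar>w x\<bar>) ` ball 0 1) in
      \<exists>Dw D2w. \<forall>x\<in>ball 0 (1/2).
        (w has_derivative (\<lambda>h. Dw x \<bullet> h)) (at x) \<and>
        (Dw has_derivative (\<lambda>h. D2w x *v h)) (at x) \<and>
        \<bar>w x\<bar> \<le> C * Mw \<and> norm (Dw x) \<le> C * Mw \<and> norm (D2w x) \<le> C * Mw \<and>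
        (\<forall>y\<in>ball 0 (1/2). norm (D2w x - D2w y) \<le> C * Mw * dist x y powr tau)))"

definition lipschitz_domain :: "(real^'n) set \<Rightarrow> bool" where
  "lipschitz_domain U \<longleftrightarrow> bounded U \<and> open U \<and> connected U \<and> U \<noteq> {} \<and>
     (\<forall>p\<in>frontier U. \<exists>r>0. \<exists>e L g. norm e = 1 \<and>
        L-lipschitz_on {y. y \<bullet> e = 0} g \<and>
        U \<inter> ball p r = {x \<in> ball p r. x \<bullet> e > g (x - (x \<bullet> e) *\<^sub>R e)})"

definition compactly_contained :: "(real^'n) set \<Rightarrow> (real^'n) set \<Rightarrow> bool" where
  "compactly_contained V U \<longleftrightarrow> open V \<and> compact (closure V) \<and> closure V \<subseteq> U"

definition smooth_fun :: "(real \<Rightarrow> real) \<Rightarrow> bool" where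
  "smooth_fun r \<longleftrightarrow> (\<forall>k x. ((deriv ^^ k) r) differentiable (at x))"

definition alpha_of :: "real \<Rightarrow> real" where
  "alpha_of gam = 1 + gam / (2 - gam)"

definition B_eps :: "(real \<Rightarrow> real) \<Rightarrow> real \<Rightarrow> real \<Rightarrow> real \<Rightarrow> real \<Rightarrow> real" where
  "B_eps rho sig0 gam eps t =
     integral {0 .. (t - sig0 * eps powr alpha_of gam) / eps powr alpha_of gam} rho"

definition beta_eps :: "(real \<Rightarrow> real) \<Rightarrow> real \<Rightarrow> real \<Rightarrow> real \<Rightarrow> real \<Rightarrow> real" where
  "beta_eps rho sig0 gam eps t =
     (if t > 0 then gam * t powr (gam - 1) * B_eps rho sig0 gam eps t else 0)"

definition dirichlet_sol :: "(real^'n^'n \<Rightarrow> real) \<Rightarrow> (real \<Rightarrow> real) \<Rightarrow> (real^'n) set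
     \<Rightarrow> (real^'n \<Rightarrow> real) \<Rightarrow> (real^'n \<Rightarrow> real) \<Rightarrow> bool" where
  "dirichlet_sol F h U f u \<longleftrightarrow> continuous_on (closure U) u \<and> (\<forall>x\<in>frontier U. u x = f x) \<and>
     visc_sol F (\<lambda>x. h (u x)) U u"

definition minimal_sol :: "(real^'n^'n \<Rightarrow> real) \<Rightarrow> (real \<Rightarrow> real) \<Rightarrow> (real^'n) set
     \<Rightarrow> (real^'n \<Rightarrow> real) \<Rightarrow> (real^'n \<Rightarrow> real) \<Rightarrow> bool" where
  "minimal_sol F beta U f u \<longleftrightarrow> (\<exists>ulo uhi.
     dirichlet_sol F (\<lambda>_. Sup (range beta)) U f ulo \<and>
     dirichlet_sol F (\<lambda>_. 0) U f uhi \<and>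
     (\<forall>x\<in>closure U. u x = Inf {w x | w. continuous_on (closure U) w \<and>
         (\<forall>y\<in>closure U. ulo y \<le> w y \<and> w y \<le> uhi y) \<and>
         visc_super F (\<lambda>y. beta (w y)) U w}))"

end

theory Submission
  imports Defs
begin

text \<open>
  Upper bound. In \<open>{u\<^sub>0 > 0}\<close> the limit satisfies \<open>F(D\<^sup>2u\<^sub>0) \<ge> 0\<close> and
  \<open>F(D\<^sup>2u\<^sub>0) \<le> \<gamma> u\<^sub>0\<^sup>\<gamma>\<^sup>-\<^sup>1\<close>. A solution of \<open>F(D\<^sup>2W) = 0\<close> squeezed next to such a
  function inherits the assumed interior estimates, which after iteration over geometric scales gives
  interior Lipschitz bounds when the right-hand side is bounded. Combined with a radial strict
  subsolution of the singular equation, slid from below, this yields a one-sided Harnack inequality: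
  if \<open>u\<^sub>0(y)\<close> is large compared with \<open>d\<^sup>\<alpha>\<close>, \<open>d\<close> the distance to the zero set, then \<open>u\<^sub>0\<close>
  leaves its zero set with positive slope, which is impossible for a differentiable nonnegative
  function. Hence \<open>u\<^sub>0 \<le> C d\<^sup>\<alpha>\<close>, and rescaling the Lipschitz bound at the scale
  \<open>u\<^sub>0(X)\<^sup>1\<^sup>/\<^sup>\<alpha>\<close> gives the term \<open>u\<^sub>0(X)\<^sup>\<gamma>\<^sup>/\<^sup>2\<rho>\<close>.

  Lower bound. If \<open>u\<^sub>\<epsilon>\<close> were below \<open>c \<rho>\<^sup>\<alpha>\<close> on a ball, cutting it off by an explicit
  supersolution whose value at the centre is of order \<open>\<epsilon>\<^sup>\<alpha>\<close> would contradict minimality.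
\<close>

section \<open>Elliptic operators and second order test functions\<close>

text \<open>The exponent \<open>alpha_of gam\<close> equals \<open>2 / (2 - gam)\<close>, so in the
  natural scaling of the singular equation \<open>u X powr (2 - gam)\<close> compares with a squared
  length; hence the recurring smallness condition
  \<open>R\<^sup>2 \<le> \<kappa> * u X powr (2 - gam)\<close>. Two obstacles shape the argument.
  The right-hand side \<open>gam * u powr (gam - 1)\<close> decreases in \<open>u\<close> and blows
  up at zero, so estimates with bounded right-hand side apply only where \<open>u\<close> exceeds a
  fixed multiple of its value at some centre, and barriers have to be slid until they touch.
  Moreover \<open>F\<close> is not assumed homogeneous and regularity is assumed only for
  \<open>F = 0\<close>; a Harnack inequality has to be extracted from it, and a weighted maximum
  supplies the local upper bound that the Lipschitz estimate asks for. Minimality is used twice: for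
  \<open>F(D\<^sup>2u) \<ge> 0\<close>, by bumping the solution down, and for the lower bound. All
  competitors are local modifications, equal to the solution off a compact set, so boundary values
  are never disturbed.\<close>

lemma norm_matrix_vector_mult_le:
  fixes A :: "real^'n^'m"
  shows "norm (A *v x) \<le> norm A * norm x"
proof -
  have "norm (A *v x) = L2_set (\<lambda>i. (A *v x) $ i) UNIV"
    by (simp add: norm_vec_def L2_set_def)
  also have "\<dots> \<le> L2_set (\<lambda>i. norm (A $ i) * norm x) UNIV"
    unfolding L2_set_def
    by (intro real_sqrt_le_mono sum_mono)
       (simp add: matrix_vector_mul_component flip: power_mult_distrib,
        metis Cauchy_Schwarz_ineq2 abs_ge_zero power2_abs power_mono power_mult_distrib)
  also have "\<dots> = norm A * norm x"
    by (simp add: norm_vec_def L2_set_left_distrib)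
  finally show ?thesis .
qed

lemma bounded_linear_matrix_vector_left: "bounded_linear (\<lambda>A :: real^'n^'m. A *v x)"
proof (rule bounded_linear_intro[where K = "norm x"])
  fix A B :: "real^'n^'m" and r :: real
  show "(A + B) *v x = A *v x + B *v x" by (simp add: matrix_vector_mult_add_rdistrib)
  show "(r *\<^sub>R A) *v x = r *\<^sub>R (A *v x)" by (simp add: scaleR_matrix_vector_assoc)
  show "norm (A *v x) \<le> norm A * norm x" by (rule norm_matrix_vector_mult_le)
qed

lemma abs_quadratic_form_le:
  fixes A :: "real^'n^'n"
  shows "\<bar>v \<bullet> (A *v w)\<bar> \<le> norm A * norm v * norm w"
proof -
  have "\<bar>v \<bullet> (A *v w)\<bar> \<le> norm v * norm (A *v w)" by (rule Cauchy_Schwarz_ineq2)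
  also have "\<dots> \<le> norm v * (norm A * norm w)"
    by (intro mult_left_mono norm_matrix_vector_mult_le) auto
  finally show ?thesis by (simp add: mult_ac)
qed

lemma sym_mat_add: "sym_mat A \<Longrightarrow> sym_mat B \<Longrightarrow> sym_mat (A + B)"
  by (simp add: sym_mat_def transpose_def vec_eq_iff)

lemma sym_mat_diff: "sym_mat A \<Longrightarrow> sym_mat B \<Longrightarrow> sym_mat (A - B)"
  by (simp add: sym_mat_def transpose_def vec_eq_iff)

lemma sym_mat_scaleR: "sym_mat A \<Longrightarrow> sym_mat (c *\<^sub>R A)"
  by (simp add: sym_mat_def transpose_def vec_eq_iff)

lemma sym_mat_uminus: "sym_mat A \<Longrightarrow> sym_mat (- A)"
  by (simp add: sym_mat_def transpose_def vec_eq_iff)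

lemma sym_mat_id: "sym_mat (mat 1)"
  by (simp add: sym_mat_def)

lemma sym_mat_zero: "sym_mat 0"
  by (simp add: sym_mat_def transpose_def vec_eq_iff)

lemmas sym_mat_intros =
  sym_mat_add sym_mat_diff sym_mat_scaleR sym_mat_uminus sym_mat_id sym_mat_zero

lemma ex_unit_vector: "\<exists>v :: real^'n. norm v = 1"
  by (rule exI[of _ "axis undefined 1"]) simp

lemma pos_part_norm_le:
  fixes P :: "real^'n^'n"
  assumes "0 \<le> b" "\<And>v. v \<bullet> (P *v v) \<le> b * (v \<bullet> v)"
  shows "pos_part_norm P \<le> b"
proof -
  have "Sup {v \<bullet> (P *v v) | v. norm v = 1} \<le> b"
  proof (rule cSup_least)
    show "{v \<bullet> (P *v v) | v. norm v = 1} \<noteq> {}" using ex_unit_vector by auto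
    fix x assume "x \<in> {v \<bullet> (P *v v) | v. norm v = 1}"
    then obtain v where "x = v \<bullet> (P *v v)" "norm v = 1" by auto
    then show "x \<le> b" using assms(2)[of v] by (simp add: dot_square_norm)
  qed
  then show ?thesis using assms(1) by (simp add: pos_part_norm_def)
qed

lemma neg_part_norm_nonneg: "0 \<le> neg_part_norm P"
  by (simp add: neg_part_norm_def)

lemma neg_part_norm_ge:
  fixes P :: "real^'n^'n"
  assumes "norm v = 1"
  shows "- (v \<bullet> (P *v v)) \<le> neg_part_norm P"
proof -
  have "- (v \<bullet> (P *v v)) \<le> Sup {- (v \<bullet> (P *v v)) | v. norm v = 1}"
  proof (rule cSup_upper)
    show "- (v \<bullet> (P *v v)) \<in> {- (v \<bullet> (P *v v)) | v. norm v = 1}" using assms by auto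
    show "bdd_above {- (v \<bullet> (P *v v)) | v. norm v = 1}"
    proof (rule bdd_aboveI[where M = "norm P"])
      fix x assume "x \<in> {- (v \<bullet> (P *v v)) | v. norm v = 1}"
      then obtain v where "x = - (v \<bullet> (P *v v))" "norm v = 1" by auto
      then show "x \<le> norm P" using abs_quadratic_form_le[of v P v] by simp
    qed
  qed
  then show ?thesis by (simp add: neg_part_norm_def)
qed

lemma unif_elliptic_upper:
  assumes "unif_elliptic F lam Lam" "sym_mat M" "sym_mat P" "0 \<le> b"
    and "\<And>v. v \<bullet> (P *v v) \<le> b * (v \<bullet> v)"
  shows "F (M + P) \<le> F M + Lam * b"
proof -
  have "F (M + P) \<le> F M + Lam * pos_part_norm P - lam * neg_part_norm P" "0 < lam" "lam \<le> Lam"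
    using assms unfolding unif_elliptic_def by auto
  moreover have "Lam * pos_part_norm P \<le> Lam * b"
    using pos_part_norm_le[of b P] assms calculation by (intro mult_left_mono) auto
  moreover have "0 \<le> lam * neg_part_norm P" using neg_part_norm_nonneg[of P] calculation by simp
  ultimately show ?thesis by linarith
qed

text \<open>Ellipticity is applied at \<open>M + P\<close> with increment \<open>- P\<close>: the
  positive part of \<open>- P\<close> vanishes, and its negative part dominates the quadratic form
  in any single unit direction. Keeping only the direction \<open>e\<close> is enough, and it can be
  chosen radial for radial functions.\<close>

lemma unif_elliptic_strict:
  assumes "unif_elliptic F lam Lam" "sym_mat M" "sym_mat P"
    and "\<And>v. 0 \<le> v \<bullet> (P *v v)" and "norm e = 1"
  shows "F M + lam * (e \<bullet> (P *v e)) \<le> F (M + P)"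
proof -
  have neg: "(- P) *v v = - (P *v v)" for v
    by (simp add: vec_eq_iff matrix_vector_mul_component inner_minus_left)
  have "F ((M + P) + - P) \<le> F (M + P) + Lam * pos_part_norm (- P) - lam * neg_part_norm (- P)"
    and l: "0 < lam" "lam \<le> Lam"
    using assms(1) sym_mat_add[OF assms(2,3)] sym_mat_uminus[OF assms(3)]
    unfolding unif_elliptic_def by blast+
  moreover have "Lam * pos_part_norm (- P) \<le> Lam * 0"
    using assms(4) l by (intro mult_left_mono pos_part_norm_le) (auto simp: neg)
  moreover have "lam * (e \<bullet> (P *v e)) \<le> lam * neg_part_norm (- P)"
    using neg_part_norm_ge[OF assms(5), of "- P"] l by (intro mult_left_mono) (auto simp: neg)
  ultimately show ?thesis by (simp only: add_diff_cancel_right' mult_zero_right diff_conv_add_uminus add.assoc right_minus add_0_right)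
qed

lemma unif_elliptic_mono:
  assumes "unif_elliptic F lam Lam" "sym_mat M" "sym_mat N"
    and "\<And>v. v \<bullet> (M *v v) \<le> v \<bullet> (N *v v)"
  shows "F M \<le> F N"
proof -
  obtain e :: "real^'a" where e: "norm e = 1" using ex_unit_vector by blast
  have nn: "0 \<le> v \<bullet> ((N - M) *v v)" for v
    using assms(4)[of v] by (simp add: matrix_vector_mult_diff_rdistrib inner_diff_right)
  have "F M + lam * (e \<bullet> ((N - M) *v e)) \<le> F (M + (N - M))"
    by (rule unif_elliptic_strict[OF assms(1,2) sym_mat_diff[OF assms(3,2)] nn e])
  moreover have "0 \<le> lam * (e \<bullet> ((N - M) *v e))"
    using nn[of e] assms(1) by (simp add: unif_elliptic_def)
  ultimately show ?thesis by simp
qed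

text \<open>Negating argument and value exchanges subsolutions and supersolutions and keeps the
  ellipticity constants, so gluing, bumps and limits need to be treated for subsolutions
  only.\<close>

lemma unif_elliptic_dual:
  assumes "unif_elliptic F lam Lam"
  shows "unif_elliptic (\<lambda>M. - F (- M)) lam Lam"
  unfolding unif_elliptic_def
proof (intro conjI allI impI)
  show "0 < lam" "lam \<le> Lam" using assms by (auto simp: unif_elliptic_def)
  fix M P :: "real^'a^'a" assume "sym_mat M" "sym_mat P"
  then have "F (- (M + P) + P) \<le> F (- (M + P)) + Lam * pos_part_norm P - lam * neg_part_norm P"
    using assms sym_mat_uminus[OF sym_mat_add[of M P]] unfolding unif_elliptic_def by blast
  then show "- F (- (M + P)) \<le> - F (- M) + Lam * pos_part_norm P - lam * neg_part_norm P"
    by simp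
qed

lemma scaled_id_vector: "(c *\<^sub>R mat 1) *v v = c *\<^sub>R v" for v :: "real^'n"
  by (simp flip: scaleR_matrix_vector_assoc)

lemma uminus_matrix_vector: "(- A) *v v = - (A *v v)" for A :: "real^'n^'m"
  by (simp add: vec_eq_iff matrix_vector_mul_component inner_minus_left)

lemma unif_elliptic_add_id:
  assumes "unif_elliptic F lam Lam" "sym_mat M" "0 \<le> c"
  shows "F M + lam * c \<le> F (M + c *\<^sub>R mat 1)"
proof -
  obtain e :: "real^'a" where e: "norm e = 1" using ex_unit_vector by blast
  have "F M + lam * (e \<bullet> ((c *\<^sub>R mat 1) *v e)) \<le> F (M + c *\<^sub>R mat 1)"
    by (rule unif_elliptic_strict[OF assms(1,2) _ _ e])
       (auto intro: sym_mat_intros simp: scaled_id_vector assms(3))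
  then show ?thesis using e by (simp add: scaled_id_vector dot_square_norm)
qed

lemma unif_elliptic_diff_id:
  assumes "unif_elliptic F lam Lam" "sym_mat M" "0 \<le> c"
  shows "F (M - c *\<^sub>R mat 1) \<le> F M - lam * c"
  using unif_elliptic_add_id[OF assms(1) sym_mat_diff[OF assms(2) sym_mat_scaleR[OF sym_mat_id]] assms(3), of c]
  by simp

lemma unif_elliptic_lipschitz:
  assumes "unif_elliptic F lam Lam" "sym_mat M" "sym_mat N"
  shows "F N \<le> F M + Lam * norm (N - M)"
proof -
  have "F (M + (N - M)) \<le> F M + Lam * norm (N - M)"
  proof (rule unif_elliptic_upper[OF assms(1,2) sym_mat_diff[OF assms(3,2)]])
    fix v :: "real^'a"
    show "v \<bullet> ((N - M) *v v) \<le> norm (N - M) * (v \<bullet> v)"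
      using abs_quadratic_form_le[of v "N - M" v] by (simp add: dot_square_norm power2_eq_square mult_ac)
  qed simp
  then show ?thesis by simp
qed

section \<open>Second differences, symmetry of Hessians and closure rules for
  \<open>C2_near\<close>\<close>

lemma DERIV_along_line:
  fixes g :: "'a::real_inner \<Rightarrow> real"
  assumes "(g has_derivative (\<lambda>h. D \<bullet> h)) (at (c + s *\<^sub>R a))"
  shows "((\<lambda>s. g (c + s *\<^sub>R a)) has_real_derivative D \<bullet> a) (at s)"
proof -
  have l: "((\<lambda>s. c + s *\<^sub>R a) has_derivative (\<lambda>h. h *\<^sub>R a)) (at s)"
    by (auto intro!: derivative_eq_intros)
  show ?thesis
    using has_derivative_compose[OF l assms]
    by (simp add: has_field_derivative_def mult.commute[of _ "D \<bullet> a"])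
qed

lemma DERIV_along_line2:
  fixes Dg :: "real^'n \<Rightarrow> real^'n"
  assumes "(Dg has_derivative (\<lambda>h. A *v h)) (at (c + s *\<^sub>R a))"
  shows "((\<lambda>s. Dg (c + s *\<^sub>R a) \<bullet> b) has_real_derivative b \<bullet> (A *v a)) (at s)"
proof -
  have l: "((\<lambda>s. c + s *\<^sub>R a) has_derivative (\<lambda>h. h *\<^sub>R a)) (at s)"
    by (auto intro!: derivative_eq_intros)
  have "((\<lambda>s. Dg (c + s *\<^sub>R a) \<bullet> b) has_derivative (\<lambda>h. (A *v (h *\<^sub>R a)) \<bullet> b)) (at s)"
    by (rule has_derivative_inner_left[OF has_derivative_compose[OF l assms]])
  then show ?thesis
    by (simp add: has_field_derivative_def matrix_vector_mult_scaleR inner_commute mult.commute[of _ "b \<bullet> _"])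
qed

text \<open>The mean value theorem is applied along \<open>a\<close> to the difference in direction
  \<open>b\<close>, and then along \<open>b\<close> to the gradient. The second difference is
  symmetric in \<open>a\<close> and \<open>b\<close>, which is the source of symmetric
  Hessians.\<close>

lemma mixed_difference_mvt:
  fixes g :: "real^'n \<Rightarrow> real"
  assumes der: "\<And>y. y \<in> ball x r \<Longrightarrow> (g has_derivative (\<lambda>h. Dg y \<bullet> h)) (at y)"
      "\<And>y. y \<in> ball x r \<Longrightarrow> (Dg has_derivative (\<lambda>h. D2g y *v h)) (at y)"
    and t: "0 < t" "t * (norm a + norm b) < r"
  shows "\<exists>y\<in>cball x (t * (norm a + norm b)).
    g (x + t *\<^sub>R a + t *\<^sub>R b) - g (x + t *\<^sub>R a) - g (x + t *\<^sub>R b) + g x = t\<^sup>2 * (a \<bullet> (D2g y *v b))"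
proof -
  have inb: "dist x (x + s *\<^sub>R a + s' *\<^sub>R b) \<le> t * (norm a + norm b)"
    if "0 \<le> s" "s \<le> t" "0 \<le> s'" "s' \<le> t" for s s'
  proof -
    have "dist x (x + s *\<^sub>R a + s' *\<^sub>R b) = norm (s *\<^sub>R a + s' *\<^sub>R b)"
      by (metis add.assoc add_diff_cancel_left' dist_norm dist_commute)
    also have "\<dots> \<le> s * norm a + s' * norm b"
      using norm_triangle_ineq[of "s *\<^sub>R a" "s' *\<^sub>R b"] that by simp
    also have "\<dots> \<le> t * norm a + t * norm b"
      using that by (intro add_mono mult_right_mono) auto
    finally show ?thesis by (simp add: algebra_simps)
  qed
  have "\<exists>s>0. s < t \<and> (g (x + t *\<^sub>R b + t *\<^sub>R a) - g (x + t *\<^sub>R a)) - (g (x + t *\<^sub>R b + 0 *\<^sub>R a) - g (x + 0 *\<^sub>R a))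
      = (t - 0) * (Dg (x + t *\<^sub>R b + s *\<^sub>R a) \<bullet> a - Dg (x + s *\<^sub>R a) \<bullet> a)"
  proof (rule MVT2)
    show "0 < t" by (rule t)
    fix s assume s: "0 \<le> s" "s \<le> t"
    have "x + t *\<^sub>R b + s *\<^sub>R a \<in> ball x r" "x + s *\<^sub>R a \<in> ball x r"
      using inb[of s t] inb[of s 0] s t by (auto simp: add.assoc add.commute[of "s *\<^sub>R a"])
    then show "((\<lambda>s. g (x + t *\<^sub>R b + s *\<^sub>R a) - g (x + s *\<^sub>R a)) has_real_derivative
        Dg (x + t *\<^sub>R b + s *\<^sub>R a) \<bullet> a - Dg (x + s *\<^sub>R a) \<bullet> a) (at s)"
      by (intro DERIV_diff DERIV_along_line der)
  qed
  then obtain s where s: "0 < s" "s < t" and e1: "g (x + t *\<^sub>R a + t *\<^sub>R b) - g (x + t *\<^sub>R a) - g (x + t *\<^sub>R b) + g x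
      = t * (Dg (x + s *\<^sub>R a + t *\<^sub>R b) \<bullet> a - Dg (x + s *\<^sub>R a) \<bullet> a)"
    by (auto simp: algebra_simps)
  have "\<exists>s'>0. s' < t \<and> Dg (x + s *\<^sub>R a + t *\<^sub>R b) \<bullet> a - Dg (x + s *\<^sub>R a + 0 *\<^sub>R b) \<bullet> a
      = (t - 0) * (a \<bullet> (D2g (x + s *\<^sub>R a + s' *\<^sub>R b) *v b))"
  proof (rule MVT2)
    show "0 < t" by (rule t)
    fix s' assume s': "0 \<le> s'" "s' \<le> t"
    have "x + s *\<^sub>R a + s' *\<^sub>R b \<in> ball x r" using inb[of s s'] s s' t by auto
    then show "((\<lambda>s'. Dg (x + s *\<^sub>R a + s' *\<^sub>R b) \<bullet> a) has_real_derivative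
        a \<bullet> (D2g (x + s *\<^sub>R a + s' *\<^sub>R b) *v b)) (at s')"
      by (intro DERIV_along_line2 der)
  qed
  then obtain s' where s': "0 < s'" "s' < t" and e2: "Dg (x + s *\<^sub>R a + t *\<^sub>R b) \<bullet> a - Dg (x + s *\<^sub>R a) \<bullet> a
      = t * (a \<bullet> (D2g (x + s *\<^sub>R a + s' *\<^sub>R b) *v b))" by auto
  show ?thesis
    using inb[of s s'] s s' e1 e2
    by (intro bexI[of _ "x + s *\<^sub>R a + s' *\<^sub>R b"]) (auto simp: power2_eq_square)
qed

lemma C2_nearE:
  assumes "C2_near phi x0 H"
  obtains r D D2 where "0 < r" "\<And>y. y \<in> ball x0 r \<Longrightarrow> (phi has_derivative (\<lambda>h. D y \<bullet> h)) (at y)"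
    "\<And>y. y \<in> ball x0 r \<Longrightarrow> (D has_derivative (\<lambda>h. D2 y *v h)) (at y)"
    "continuous_on (ball x0 r) D2" "D2 x0 = H"
  using assms unfolding C2_near_def by metis

text \<open>\<open>C2_near\<close> does not impose symmetry, while ellipticity speaks of symmetric
  matrices only. One and the same mixed difference equals \<open>t\<^sup>2\<close> times either
  bilinear form at points near \<open>x0\<close>, and continuity of the Hessian at \<open>x0\<close>
  identifies the two.\<close>

lemma C2_near_sym:
  assumes "C2_near phi x0 H"
  shows "sym_mat H"
proof -
  obtain r D D2 where r: "0 < r"
    and d1: "\<And>y. y \<in> ball x0 r \<Longrightarrow> (phi has_derivative (\<lambda>h. D y \<bullet> h)) (at y)"
    and d2: "\<And>y. y \<in> ball x0 r \<Longrightarrow> (D has_derivative (\<lambda>h. D2 y *v h)) (at y)"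
    and c: "continuous_on (ball x0 r) D2" and H: "D2 x0 = H"
    using assms by (metis C2_nearE)
  have eq: "a \<bullet> (H *v b) = b \<bullet> (H *v a)" for a b
  proof (rule ccontr)
    assume ne: "a \<bullet> (H *v b) \<noteq> b \<bullet> (H *v a)"
    define e where "e = \<bar>a \<bullet> (H *v b) - b \<bullet> (H *v a)\<bar> / 2"
    have e: "e > 0" using ne by (simp add: e_def)
    have cont: "isCont (\<lambda>y. v \<bullet> (D2 y *v w)) x0" for v w
    proof -
      have "isCont D2 x0" using c r by (simp add: continuous_on_eq_continuous_at)
      then have "isCont (\<lambda>y. D2 y *v w) x0"
        by (rule bounded_linear.isCont[OF bounded_linear_matrix_vector_left])
      then show ?thesis by (intro continuous_intros)
    qed
    obtain d1' where "d1' > 0" and c1: "\<And>y. dist y x0 < d1' \<Longrightarrow> \<bar>a \<bullet> (D2 y *v b) - a \<bullet> (H *v b)\<bar> < e"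
      using cont[of a b] e H unfolding continuous_at_eps_delta dist_real_def by metis
    obtain d2' where "d2' > 0" and c2: "\<And>y. dist y x0 < d2' \<Longrightarrow> \<bar>b \<bullet> (D2 y *v a) - b \<bullet> (H *v a)\<bar> < e"
      using cont[of b a] e H unfolding continuous_at_eps_delta dist_real_def by metis
    define q where "q = min r (min d1' d2')"
    define t where "t = q / (2 * (norm a + norm b + 1))"
    have q: "q > 0" using r \<open>d1' > 0\<close> \<open>d2' > 0\<close> by (simp add: q_def)
    have t: "t > 0" using q by (simp add: t_def add_nonneg_pos)
    have "t * (norm a + norm b) \<le> t * (norm a + norm b + 1)" using t by (intro mult_left_mono) auto
    also have "\<dots> = q / 2"
      using add_nonneg_pos[of "norm a + norm b" 1] unfolding t_def by (simp only: times_divide_eq_left mult.commute[of q] mult_divide_mult_cancel_left_if mult.commute[of 2], simp)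
    also have "\<dots> < q" using q by simp
    finally have tq: "t * (norm a + norm b) < q" .
    then have tr: "t * (norm a + norm b) < r" by (simp add: q_def)
    obtain y where y: "y \<in> cball x0 (t * (norm a + norm b))"
      and ye: "phi (x0 + t *\<^sub>R a + t *\<^sub>R b) - phi (x0 + t *\<^sub>R a) - phi (x0 + t *\<^sub>R b) + phi x0 = t\<^sup>2 * (a \<bullet> (D2 y *v b))"
      using mixed_difference_mvt[OF d1 d2 t tr] by blast
    have tr': "t * (norm b + norm a) < r" using tr by (simp add: add.commute)
    obtain z where z: "z \<in> cball x0 (t * (norm b + norm a))"
      and ze: "phi (x0 + t *\<^sub>R b + t *\<^sub>R a) - phi (x0 + t *\<^sub>R b) - phi (x0 + t *\<^sub>R a) + phi x0 = t\<^sup>2 * (b \<bullet> (D2 z *v a))"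
      using mixed_difference_mvt[OF d1 d2 t tr'] by blast
    have "x0 + t *\<^sub>R b + t *\<^sub>R a = x0 + t *\<^sub>R a + t *\<^sub>R b" by simp
    then have sw: "phi (x0 + t *\<^sub>R b + t *\<^sub>R a) = phi (x0 + t *\<^sub>R a + t *\<^sub>R b)" by (rule arg_cong)
    have "t\<^sup>2 * (a \<bullet> (D2 y *v b)) = t\<^sup>2 * (b \<bullet> (D2 z *v a))"
      using ye ze sw by linarith
    then have "a \<bullet> (D2 y *v b) = b \<bullet> (D2 z *v a)" using t by simp
    moreover have "\<bar>a \<bullet> (D2 y *v b) - a \<bullet> (H *v b)\<bar> < e"
      using y tq by (intro c1) (auto simp: q_def dist_commute)
    moreover have "\<bar>b \<bullet> (D2 z *v a) - b \<bullet> (H *v a)\<bar> < e"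
      using z tq by (intro c2) (auto simp: q_def dist_commute add.commute)
    ultimately show False unfolding e_def by (simp add: abs_if split: if_splits)
  qed
  have "H $ i $ j = H $ j $ i" for i j
    using eq[of "axis i 1" "axis j 1"]
    by (simp add: matrix_vector_mul_component inner_axis inner_axis')
  then show ?thesis by (simp add: sym_mat_def transpose_def vec_eq_iff)
qed

text \<open>On a line through the maximum the derivative vanishes at 0. Were the second derivative
  positive, the derivative would be positive just to the right, and the mean value theorem would
  produce a larger value.\<close>

lemma C2_near_max_second_order:
  assumes "C2_near g x0 H" "0 < r" "\<And>y. y \<in> ball x0 r \<Longrightarrow> g y \<le> g x0"
  shows "v \<bullet> (H *v v) \<le> 0"
proof (rule ccontr)
  assume "\<not> v \<bullet> (H *v v) \<le> 0"
  then have pos: "v \<bullet> (H *v v) > 0" by simp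
  then have vn: "norm v > 0" by auto
  obtain q D D2 where q: "0 < q"
    and d1: "\<And>y. y \<in> ball x0 q \<Longrightarrow> (g has_derivative (\<lambda>h. D y \<bullet> h)) (at y)"
    and d2: "\<And>y. y \<in> ball x0 q \<Longrightarrow> (D has_derivative (\<lambda>h. D2 y *v h)) (at y)"
    and H: "D2 x0 = H"
    using assms(1) by (metis C2_nearE)
  define s where "s = min r q / norm v"
  have s: "s > 0" using q assms(2) vn by (simp add: s_def)
  have inb: "x0 + t *\<^sub>R v \<in> ball x0 (min r q)" if "\<bar>t\<bar> < s" for t
    using that vn by (simp add: s_def dist_norm pos_less_divide_eq)
  have k1: "((\<lambda>t. g (x0 + t *\<^sub>R v)) has_real_derivative D (x0 + t *\<^sub>R v) \<bullet> v) (at t)" if "\<bar>t\<bar> < s" for t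
    using inb[OF that] by (intro DERIV_along_line d1) auto
  have z: "D (x0 + 0 *\<^sub>R v) \<bullet> v = 0"
    by (rule DERIV_local_max[OF k1 s]) (use s inb assms(3) in \<open>auto\<close>)
  have k2: "((\<lambda>t. D (x0 + t *\<^sub>R v) \<bullet> v) has_real_derivative v \<bullet> (H *v v)) (at 0)"
    using q H by (intro DERIV_along_line2) (auto intro: d2)
  obtain d where d: "d > 0" "\<And>h. 0 < h \<Longrightarrow> h < d \<Longrightarrow> D (x0 + 0 *\<^sub>R v) \<bullet> v < D (x0 + (0 + h) *\<^sub>R v) \<bullet> v"
    using DERIV_pos_inc_right[OF k2 pos] by auto
  define T where "T = min d s / 2"
  have T: "0 < T" "T < d" "T < s" using d s by (auto simp: T_def)
  have "\<exists>z>0. z < T \<and> g (x0 + T *\<^sub>R v) - g (x0 + 0 *\<^sub>R v) = (T - 0) * (D (x0 + z *\<^sub>R v) \<bullet> v)"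
    by (rule MVT2) (use T k1 in auto)
  then obtain w where w: "0 < w" "w < T" "g (x0 + T *\<^sub>R v) - g x0 = T * (D (x0 + w *\<^sub>R v) \<bullet> v)" by auto
  have "D (x0 + w *\<^sub>R v) \<bullet> v > 0" using d(2)[of w] w T z by simp
  then have "g (x0 + T *\<^sub>R v) - g x0 > 0" using w T by simp
  moreover have "g (x0 + T *\<^sub>R v) \<le> g x0" using inb[of T] T by (intro assms(3)) auto
  ultimately show False by simp
qed

lemma C2_near_uminus:
  assumes "C2_near g x0 H"
  shows "C2_near (\<lambda>x. - g x) x0 (- H)"
proof -
  obtain r D D2 where r: "0 < r"
    and d1: "\<And>y. y \<in> ball x0 r \<Longrightarrow> (g has_derivative (\<lambda>h. D y \<bullet> h)) (at y)"
    and d2: "\<And>y. y \<in> ball x0 r \<Longrightarrow> (D has_derivative (\<lambda>h. D2 y *v h)) (at y)"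
    and c: "continuous_on (ball x0 r) D2" and H: "D2 x0 = H"
    using assms by (metis C2_nearE)
  show ?thesis unfolding C2_near_def
    by (rule exI[of _ r], intro conjI r exI[of _ "\<lambda>y. - D y"] exI[of _ "\<lambda>y. - D2 y"])
       (use d1 d2 c H in \<open>auto intro!: derivative_eq_intros continuous_intros simp: uminus_matrix_vector\<close>)
qed

lemma C2_near_add:
  assumes "C2_near g x0 H" "C2_near g' x0 H'"
  shows "C2_near (\<lambda>x. g x + g' x) x0 (H + H')"
proof -
  obtain r D D2 where r: "0 < r"
    and d1: "\<And>y. y \<in> ball x0 r \<Longrightarrow> (g has_derivative (\<lambda>h. D y \<bullet> h)) (at y)"
    and d2: "\<And>y. y \<in> ball x0 r \<Longrightarrow> (D has_derivative (\<lambda>h. D2 y *v h)) (at y)"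
    and c: "continuous_on (ball x0 r) D2" and H: "D2 x0 = H"
    using assms(1) by (metis C2_nearE)
  obtain r' D' D2' where r': "0 < r'"
    and d1': "\<And>y. y \<in> ball x0 r' \<Longrightarrow> (g' has_derivative (\<lambda>h. D' y \<bullet> h)) (at y)"
    and d2': "\<And>y. y \<in> ball x0 r' \<Longrightarrow> (D' has_derivative (\<lambda>h. D2' y *v h)) (at y)"
    and c': "continuous_on (ball x0 r') D2'" and H': "D2' x0 = H'"
    using assms(2) by (metis C2_nearE)
  show ?thesis unfolding C2_near_def
  proof (rule exI[of _ "min r r'"], intro conjI exI[of _ "\<lambda>y. D y + D' y"] exI[of _ "\<lambda>y. D2 y + D2' y"] ballI)
    show "0 < min r r'" using r r' by simp
    fix y assume "y \<in> ball x0 (min r r')"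
    then have y: "y \<in> ball x0 r" "y \<in> ball x0 r'" by auto
    show "((\<lambda>x. g x + g' x) has_derivative (\<lambda>h. (D y + D' y) \<bullet> h)) (at y)"
      using has_derivative_add[OF d1[OF y(1)] d1'[OF y(2)]] by (simp add: inner_add_left)
    show "((\<lambda>y. D y + D' y) has_derivative (\<lambda>h. (D2 y + D2' y) *v h)) (at y)"
      using has_derivative_add[OF d2[OF y(1)] d2'[OF y(2)]] by (simp add: matrix_vector_mult_add_rdistrib)
  next
    show "continuous_on (ball x0 (min r r')) (\<lambda>y. D2 y + D2' y)"
      by (intro continuous_intros continuous_on_subset[OF c] continuous_on_subset[OF c']) auto
    show "H + H' = D2 x0 + D2' x0" using H H' by simp
  qed
qed

lemma C2_near_diff:
  assumes "C2_near g x0 H" "C2_near g' x0 H'"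
  shows "C2_near (\<lambda>x. g x - g' x) x0 (H - H')"
  using C2_near_add[OF assms(1) C2_near_uminus[OF assms(2)]] by simp

lemma C2_near_affine: "C2_near (\<lambda>x. c + p \<bullet> x) x0 0"
  unfolding C2_near_def
  by (rule exI[of _ 1], intro conjI exI[of _ "\<lambda>y. p"] exI[of _ "\<lambda>y. 0"])
     (auto intro!: derivative_eq_intros simp: matrix_vector_mult_def zero_vec_def)

lemma C2_near_const: "C2_near (\<lambda>x. c) x0 0"
  using C2_near_affine[of c 0] by simp

lemma C2_near_rescale:
  assumes "C2_near g (a + r *\<^sub>R x0) H"
  shows "C2_near (\<lambda>x. c * g (a + r *\<^sub>R x)) x0 ((c * r\<^sup>2) *\<^sub>R H)"
proof -
  obtain q D D2 where q: "0 < q"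
    and d1: "\<And>y. y \<in> ball (a + r *\<^sub>R x0) q \<Longrightarrow> (g has_derivative (\<lambda>h. D y \<bullet> h)) (at y)"
    and d2: "\<And>y. y \<in> ball (a + r *\<^sub>R x0) q \<Longrightarrow> (D has_derivative (\<lambda>h. D2 y *v h)) (at y)"
    and c: "continuous_on (ball (a + r *\<^sub>R x0) q) D2" and H: "D2 (a + r *\<^sub>R x0) = H"
    using assms by (metis C2_nearE)
  define q' where "q' = q / (\<bar>r\<bar> + 1)"
  have q': "q' > 0" using q by (simp add: q'_def add_nonneg_pos)
  have inb: "a + r *\<^sub>R y \<in> ball (a + r *\<^sub>R x0) q" if "y \<in> ball x0 q'" for y
  proof -
    have "dist (a + r *\<^sub>R x0) (a + r *\<^sub>R y) = \<bar>r\<bar> * dist x0 y"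
      by (simp add: dist_norm flip: scaleR_diff_right)
    also have "\<dots> \<le> (\<bar>r\<bar> + 1) * dist x0 y" by (intro mult_right_mono) auto
    also have "\<dots> < (\<bar>r\<bar> + 1) * q'" using that by (intro mult_strict_left_mono) (auto simp: add_nonneg_pos)
    also have "\<dots> = q" using q by (simp add: q'_def add_nonneg_pos)
    finally show ?thesis by simp
  qed
  have l: "((\<lambda>y. a + r *\<^sub>R y) has_derivative (\<lambda>h. r *\<^sub>R h)) (at y)" for y :: "real^'a"
    by (auto intro!: derivative_eq_intros)
  show ?thesis unfolding C2_near_def
  proof (rule exI[of _ q'], intro conjI q' ballI exI[of _ "\<lambda>y. (c * r) *\<^sub>R D (a + r *\<^sub>R y)"]
      exI[of _ "\<lambda>y. (c * r\<^sup>2) *\<^sub>R D2 (a + r *\<^sub>R y)"])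
    fix y assume y: "y \<in> ball x0 q'"
    show "((\<lambda>x. c * g (a + r *\<^sub>R x)) has_derivative (\<lambda>h. (c * r) *\<^sub>R D (a + r *\<^sub>R y) \<bullet> h)) (at y)"
      using has_derivative_mult_right[OF has_derivative_compose[OF l d1[OF inb[OF y]]], of c]
      by (simp add: mult.assoc)
    show "((\<lambda>y. (c * r) *\<^sub>R D (a + r *\<^sub>R y)) has_derivative (\<lambda>h. ((c * r\<^sup>2) *\<^sub>R D2 (a + r *\<^sub>R y)) *v h)) (at y)"
      using has_derivative_scaleR_right[OF has_derivative_compose[OF l d2[OF inb[OF y]]], of "c * r"]
      by (simp add: matrix_vector_mult_scaleR power2_eq_square mult.assoc flip: scaleR_matrix_vector_assoc)
  next
    show "continuous_on (ball x0 q') (\<lambda>y. (c * r\<^sup>2) *\<^sub>R D2 (a + r *\<^sub>R y))"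
      by (intro continuous_intros continuous_on_compose2[OF c]) (use inb in auto)
    show "(c * r\<^sup>2) *\<^sub>R H = (c * r\<^sup>2) *\<^sub>R D2 (a + r *\<^sub>R x0)" using H by simp
  qed
qed

definition outer :: "real^'n \<Rightarrow> real^'n^'n" where
  "outer z = (\<chi> i j. z $ i * z $ j)"

lemma outer_vector: "outer z *v v = (z \<bullet> v) *\<^sub>R z"
  by (simp add: vec_eq_iff outer_def matrix_vector_mult_def inner_vec_def sum_distrib_left mult_ac)

lemma sym_mat_outer: "sym_mat (outer z)"
  by (simp add: sym_mat_def transpose_def outer_def vec_eq_iff mult.commute)

text \<open>The squared distance serves as radial variable because it is smooth at the centre too.
  Tangential directions see only the multiple of the identity; the rank-one term with \<Phi>'' acts
  in the radial direction.\<close>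

lemma C2_near_radial:
  fixes c x0 :: "real^'n"
  assumes S: "open S" "(x0 - c) \<bullet> (x0 - c) \<in> S"
    and p1: "\<And>s. s \<in> S \<Longrightarrow> (\<Phi> has_real_derivative \<Phi>' s) (at s)"
    and p2: "\<And>s. s \<in> S \<Longrightarrow> (\<Phi>' has_real_derivative \<Phi>'' s) (at s)"
    and cont: "continuous_on S \<Phi>''"
  defines "s0 \<equiv> (x0 - c) \<bullet> (x0 - c)"
  shows "C2_near (\<lambda>x. \<Phi> ((x - c) \<bullet> (x - c))) x0
    ((2 * \<Phi>' s0) *\<^sub>R mat 1 + (4 * \<Phi>'' s0) *\<^sub>R outer (x0 - c))"
proof -
  have "continuous_on UNIV (\<lambda>x. (x - c) \<bullet> (x - c))" by (intro continuous_intros)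
  then have "open ((\<lambda>x. (x - c) \<bullet> (x - c)) -` S)" using S(1) by (simp add: open_vimage)
  moreover have "x0 \<in> (\<lambda>x. (x - c) \<bullet> (x - c)) -` S" using S(2) by simp
  ultimately obtain r where r: "0 < r" and "ball x0 r \<subseteq> (\<lambda>x. (x - c) \<bullet> (x - c)) -` S"
    by (rule openE)
  then have rS: "\<And>y. y \<in> ball x0 r \<Longrightarrow> (y - c) \<bullet> (y - c) \<in> S" by blast
  have l: "((\<lambda>x. (x - c) \<bullet> (x - c)) has_derivative (\<lambda>h. 2 * ((y - c) \<bullet> h))) (at y)" for y :: "real^'n"
    by (auto intro!: derivative_eq_intros simp: inner_commute)
  have dc: "((\<lambda>x. f ((x - c) \<bullet> (x - c))) has_derivative (\<lambda>h. 2 * f' * ((y - c) \<bullet> h))) (at y)"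
    if "(f has_real_derivative f') (at ((y - c) \<bullet> (y - c)))" for f f' y
    using has_derivative_compose[OF l that[unfolded has_field_derivative_def]] by (simp add: mult_ac)
  show ?thesis unfolding C2_near_def
  proof (rule exI[of _ r], intro conjI r ballI exI[of _ "\<lambda>y. (2 * \<Phi>' ((y - c) \<bullet> (y - c))) *\<^sub>R (y - c)"]
     exI[of _ "\<lambda>y. (2 * \<Phi>' ((y - c) \<bullet> (y - c))) *\<^sub>R mat 1 + (4 * \<Phi>'' ((y - c) \<bullet> (y - c))) *\<^sub>R outer (y - c)"])
    fix y assume y: "y \<in> ball x0 r"
    show "((\<lambda>x. \<Phi> ((x - c) \<bullet> (x - c))) has_derivative (\<lambda>h. (2 * \<Phi>' ((y - c) \<bullet> (y - c))) *\<^sub>R (y - c) \<bullet> h)) (at y)"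
      using dc[OF p1[OF rS[OF y]]] by simp
    show "((\<lambda>y. (2 * \<Phi>' ((y - c) \<bullet> (y - c))) *\<^sub>R (y - c)) has_derivative
      (\<lambda>h. ((2 * \<Phi>' ((y - c) \<bullet> (y - c))) *\<^sub>R mat 1 + (4 * \<Phi>'' ((y - c) \<bullet> (y - c))) *\<^sub>R outer (y - c)) *v h)) (at y)"
      by (rule derivative_eq_intros dc[OF p2[OF rS[OF y]]] refl)+
         (simp add: matrix_vector_mult_add_rdistrib outer_vector mult_ac flip: scaleR_matrix_vector_assoc)
  next
    have cS: "continuous_on (ball x0 r) (\<lambda>y. f ((y - c) \<bullet> (y - c)))" if "continuous_on S f" for f :: "real \<Rightarrow> real"
      by (intro continuous_on_compose2[OF that] continuous_intros) (use rS in auto)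
    have "continuous_on S \<Phi>'"
      using p2 by (meson DERIV_isCont continuous_at_imp_continuous_on)
    note c1 = cS[OF this] and c2 = cS[OF cont]
    have c3: "continuous_on (ball x0 r) (\<lambda>y. outer (y - c))"
      unfolding outer_def by (intro continuous_intros)
    show "continuous_on (ball x0 r) (\<lambda>y. (2 * \<Phi>' ((y - c) \<bullet> (y - c))) *\<^sub>R mat 1 + (4 * \<Phi>'' ((y - c) \<bullet> (y - c))) *\<^sub>R outer (y - c))"
      by (intro continuous_intros c1 c2 c3)
  qed (simp add: s0_def)
qed

lemma C2_near_quadratic:
  fixes c x0 :: "real^'n"
  shows "C2_near (\<lambda>x. a * ((x - c) \<bullet> (x - c))) x0 ((2 * a) *\<^sub>R mat 1)"
proof -
  have "C2_near (\<lambda>x. (\<lambda>s. a * s) ((x - c) \<bullet> (x - c))) x0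
    ((2 * (\<lambda>s. a) ((x0 - c) \<bullet> (x0 - c))) *\<^sub>R mat 1 + (4 * (\<lambda>s. 0) ((x0 - c) \<bullet> (x0 - c))) *\<^sub>R outer (x0 - c))"
    by (rule C2_near_radial[where S = UNIV and \<Phi> = "\<lambda>s. a * s" and \<Phi>' = "\<lambda>s. a" and \<Phi>'' = "\<lambda>s. 0"]) (auto intro!: derivative_eq_intros)
  then show ?thesis by simp
qed

section \<open>Viscosity subsolutions\<close>

lemma C2_near_nbhd:
  assumes "C2_near phi x0 H"
  obtains r D2 where "0 < r" "\<And>y. y \<in> ball x0 r \<Longrightarrow> C2_near phi y (D2 y)"
    "continuous_on (ball x0 r) D2" "D2 x0 = H"
proof -
  obtain r D D2 where r: "0 < r"
    and d1: "\<And>y. y \<in> ball x0 r \<Longrightarrow> (phi has_derivative (\<lambda>h. D y \<bullet> h)) (at y)"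
    and d2: "\<And>y. y \<in> ball x0 r \<Longrightarrow> (D has_derivative (\<lambda>h. D2 y *v h)) (at y)"
    and c: "continuous_on (ball x0 r) D2" and H: "D2 x0 = H"
    using assms by (metis C2_nearE)
  have "C2_near phi y (D2 y)" if y: "y \<in> ball x0 r" for y
  proof -
    obtain q where q: "0 < q" "ball y q \<subseteq> ball x0 r" using y by (meson openE open_ball)
    show ?thesis unfolding C2_near_def
      by (rule exI[of _ q], intro conjI q exI[of _ D] exI[of _ D2] continuous_on_subset[OF c])
         (use q d1 d2 in auto)
  qed
  then show thesis using that r c H by blast
qed

lemma C2_near_isCont: "C2_near phi x0 H \<Longrightarrow> isCont phi x0"
  by (metis C2_nearE centre_in_ball has_derivative_continuous)

section \<open>Touching rules, duality and invariances of viscosity inequalities\<close>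

lemma visc_subD:
  assumes "visc_sub F h U u" "x0 \<in> U" "C2_near phi x0 H" "0 < r"
    and "\<And>y. y \<in> ball x0 r \<Longrightarrow> y \<in> U \<Longrightarrow> u y - phi y \<le> u x0 - phi x0"
  shows "h x0 \<le> F H"
  using assms unfolding visc_sub_def by (metis IntE)

lemma visc_subI:
  assumes "continuous_on U u"
    and "\<And>x0 phi H r. x0 \<in> U \<Longrightarrow> C2_near phi x0 H \<Longrightarrow> 0 < r \<Longrightarrow>
      (\<And>y. y \<in> ball x0 r \<Longrightarrow> y \<in> U \<Longrightarrow> u y - phi y \<le> u x0 - phi x0) \<Longrightarrow> h x0 \<le> F H"
  shows "visc_sub F h U u"
  using assms unfolding visc_sub_def by (metis IntI)

lemma visc_super_dual:
  "visc_super F h U u \<longleftrightarrow> visc_sub (\<lambda>M. - F (- M)) (\<lambda>x. - h x) U (\<lambda>x. - u x)" (is "?A \<longleftrightarrow> ?B")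
proof
  assume A: ?A
  show ?B
  proof (rule visc_subI)
    show "continuous_on U (\<lambda>x. - u x)" using A by (auto simp: visc_super_def intro: continuous_intros)
    fix x0 phi H and r :: real
    assume *: "x0 \<in> U" "C2_near phi x0 H" "0 < r"
      and t: "\<And>y. y \<in> ball x0 r \<Longrightarrow> y \<in> U \<Longrightarrow> - u y - phi y \<le> - u x0 - phi x0"
    have "F (- H) \<le> h x0"
    proof (rule A[unfolded visc_super_def, THEN conjunct2, rule_format, OF *(1)], intro conjI)
      show "C2_near (\<lambda>x. - phi x) x0 (- H)" by (rule C2_near_uminus[OF *(2)])
      show "\<exists>r>0. \<forall>y\<in>ball x0 r \<inter> U. u x0 - - phi x0 \<le> u y - - phi y"
      proof (intro exI[of _ r] conjI ballI)
        fix y assume "y \<in> ball x0 r \<inter> U"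
        then show "u x0 - - phi x0 \<le> u y - - phi y" using t[of y] by auto
      qed (rule *)
    qed
    then show "- h x0 \<le> - F (- H)" by simp
  qed
next
  assume B: ?B
  show ?A unfolding visc_super_def
  proof (intro conjI ballI allI impI)
    have "continuous_on U (\<lambda>x. - (- u x))"
      by (rule continuous_on_minus) (use B in \<open>simp add: visc_sub_def\<close>)
    then show "continuous_on U u" by simp
    fix x0 phi H assume x0: "x0 \<in> U"
      and *: "C2_near phi x0 H \<and> (\<exists>r>0. \<forall>y\<in>ball x0 r \<inter> U. u x0 - phi x0 \<le> u y - phi y)"
    then obtain r where r: "r > 0" "\<forall>y\<in>ball x0 r \<inter> U. u x0 - phi x0 \<le> u y - phi y" by blast
    have "- h x0 \<le> - F (- (- H))"
    proof (rule visc_subD[OF B x0 _ r(1)])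
      show "C2_near (\<lambda>x. - phi x) x0 (- H)" using * by (intro C2_near_uminus) auto
      fix y assume "y \<in> ball x0 r" "y \<in> U"
      then have "u x0 - phi x0 \<le> u y - phi y" using r(2) by blast
      then show "- u y - - phi y \<le> - u x0 - - phi x0" by simp
    qed
    then show "F H \<le> h x0" by simp
  qed
qed

lemma visc_superD:
  assumes "visc_super F h U u" "x0 \<in> U" "C2_near phi x0 H" "0 < r"
    and "\<And>y. y \<in> ball x0 r \<Longrightarrow> y \<in> U \<Longrightarrow> u x0 - phi x0 \<le> u y - phi y"
  shows "F H \<le> h x0"
  using assms unfolding visc_super_def by (metis IntE)

lemma visc_sub_weaken:
  assumes "visc_sub F h U u" "open V" "V \<subseteq> U" "\<And>x. x \<in> V \<Longrightarrow> h' x \<le> h x"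
  shows "visc_sub F h' V u"
proof (rule visc_subI)
  show "continuous_on V u" using assms by (meson continuous_on_subset visc_sub_def)
  fix x0 phi H and r :: real
  assume *: "x0 \<in> V" "C2_near phi x0 H" "0 < r"
    and t: "\<And>y. y \<in> ball x0 r \<Longrightarrow> y \<in> V \<Longrightarrow> u y - phi y \<le> u x0 - phi x0"
  obtain q where q: "q > 0" "ball x0 q \<subseteq> V" using assms(2) *(1) openE by blast
  have "h x0 \<le> F H"
    by (rule visc_subD[OF assms(1) _ *(2), of "min r q"]) (use * q t assms(3) in auto)
  then show "h' x0 \<le> F H" using assms(4)[OF *(1)] by simp
qed

lemma visc_super_weaken:
  assumes "visc_super F h U u" "open V" "V \<subseteq> U" "\<And>x. x \<in> V \<Longrightarrow> h x \<le> h' x"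
  shows "visc_super F h' V u"
  using assms visc_sub_weaken[of _ _ U _ V "\<lambda>x. - h' x"] by (simp add: visc_super_dual)

lemma C2_visc_sub:
  assumes ell: "unif_elliptic F lam Lam"
    and C2: "\<And>x. x \<in> V \<Longrightarrow> C2_near g x (D2 x)" and V: "open V"
    and F: "\<And>x. x \<in> V \<Longrightarrow> h x \<le> F (D2 x)"
  shows "visc_sub F h V g"
proof (rule visc_subI)
  show "continuous_on V g"
    using C2 by (meson C2_near_isCont continuous_at_imp_continuous_on)
  fix x0 phi H and r :: real
  assume *: "x0 \<in> V" "C2_near phi x0 H" "0 < r"
    and t: "\<And>y. y \<in> ball x0 r \<Longrightarrow> y \<in> V \<Longrightarrow> g y - phi y \<le> g x0 - phi x0"
  obtain q where q: "q > 0" "ball x0 q \<subseteq> V" using V *(1) openE by blast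
  have "v \<bullet> ((D2 x0 - H) *v v) \<le> 0" for v
    by (rule C2_near_max_second_order[OF C2_near_diff[OF C2[OF *(1)] *(2)], of "min r q"])
       (use q t * in auto)
  then have "F (D2 x0) \<le> F H"
    by (intro unif_elliptic_mono[OF ell C2_near_sym[OF C2[OF *(1)]] C2_near_sym[OF *(2)]])
       (simp add: matrix_vector_mult_diff_rdistrib inner_diff_right)
  then show "h x0 \<le> F H" using F[OF *(1)] by simp
qed

lemma visc_sub_add_C2:
  assumes u: "visc_sub F h U u"
    and q: "\<And>x. x \<in> U \<Longrightarrow> C2_near q x (Q x)"
    and F: "\<And>x H. x \<in> U \<Longrightarrow> sym_mat H \<Longrightarrow> h x \<le> F H \<Longrightarrow> h' x \<le> F (H + Q x)"
  shows "visc_sub F h' U (\<lambda>x. u x + q x)"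
proof (rule visc_subI)
  show "continuous_on U (\<lambda>x. u x + q x)"
    using u q unfolding visc_sub_def
    by (intro continuous_intros) (auto intro!: continuous_at_imp_continuous_on C2_near_isCont)
  fix x0 phi H and r :: real
  assume *: "x0 \<in> U" "C2_near phi x0 H" "0 < r"
    and t: "\<And>y. y \<in> ball x0 r \<Longrightarrow> y \<in> U \<Longrightarrow> u y + q y - phi y \<le> u x0 + q x0 - phi x0"
  have C: "C2_near (\<lambda>x. phi x - q x) x0 (H - Q x0)"
    by (rule C2_near_diff[OF *(2) q[OF *(1)]])
  have "h x0 \<le> F (H - Q x0)"
  proof (rule visc_subD[OF u *(1) C *(3)])
    fix y assume "y \<in> ball x0 r" "y \<in> U"
    then show "u y - (phi y - q y) \<le> u x0 - (phi x0 - q x0)" using t[of y] by simp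
  qed
  from F[OF *(1) C2_near_sym[OF C] this] show "h' x0 \<le> F H" by simp
qed

text \<open>Dividing by \<open>r\<^sup>2\<close> compensates the effect of the dilation on the
  Hessian, so the inequality survives without homogeneity of \<open>F\<close>. The test function is
  transported by the inverse dilation.\<close>

lemma visc_sub_rescale:
  assumes u: "visc_sub F (\<lambda>x. c) U u" and r: "0 < r"
  shows "visc_sub F (\<lambda>x. c) {x. a + r *\<^sub>R x \<in> U} (\<lambda>x. u (a + r *\<^sub>R x) / r\<^sup>2)"
proof (rule visc_subI)
  have "continuous_on U u" using u by (simp add: visc_sub_def)
  then have "continuous_on {x. a + r *\<^sub>R x \<in> U} (\<lambda>x. u (a + r *\<^sub>R x))"
    by (rule continuous_on_compose2) (auto intro!: continuous_intros)
  then show "continuous_on {x. a + r *\<^sub>R x \<in> U} (\<lambda>x. u (a + r *\<^sub>R x) / r\<^sup>2)"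
    using r by (intro continuous_on_divide continuous_on_const) auto
  fix x0 phi H and q :: real
  assume *: "x0 \<in> {x. a + r *\<^sub>R x \<in> U}" "C2_near phi x0 H" "0 < q"
    and t: "\<And>y. y \<in> ball x0 q \<Longrightarrow> y \<in> {x. a + r *\<^sub>R x \<in> U} \<Longrightarrow>
      u (a + r *\<^sub>R y) / r\<^sup>2 - phi y \<le> u (a + r *\<^sub>R x0) / r\<^sup>2 - phi x0"
  define \<psi> where "\<psi> z = r\<^sup>2 * phi (- (1 / r) *\<^sub>R a + (1 / r) *\<^sub>R z)" for z
  have inv: "- (1 / r) *\<^sub>R a + (1 / r) *\<^sub>R (a + r *\<^sub>R x) = x" for x
    using r by (simp add: scaleR_add_right)
  have inv': "a + r *\<^sub>R (- (1 / r) *\<^sub>R a + (1 / r) *\<^sub>R x) = x" for x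
    using r by (simp add: scaleR_diff_right)
  have "C2_near \<psi> (a + r *\<^sub>R x0) ((r\<^sup>2 * (1 / r)\<^sup>2) *\<^sub>R H)"
    unfolding \<psi>_def by (rule C2_near_rescale) (simp only: inv *(2))
  then have C: "C2_near \<psi> (a + r *\<^sub>R x0) H" using r by (simp add: power_divide)
  show "c \<le> F H"
  proof (rule visc_subD[OF u _ C, of "r * q"])
    show "a + r *\<^sub>R x0 \<in> U" "0 < r * q" using * r by auto
    fix z assume z: "z \<in> ball (a + r *\<^sub>R x0) (r * q)" "z \<in> U"
    define y where "y = - (1 / r) *\<^sub>R a + (1 / r) *\<^sub>R z"
    have zy: "z = a + r *\<^sub>R y" unfolding y_def inv' by simp
    have "dist (a + r *\<^sub>R x0) z = r * dist x0 y"
      using r unfolding zy by (simp add: dist_norm flip: scaleR_diff_right)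
    then have "u (a + r *\<^sub>R y) / r\<^sup>2 - phi y \<le> u (a + r *\<^sub>R x0) / r\<^sup>2 - phi x0"
      using z r by (intro t) (auto simp: zy)
    then have "r\<^sup>2 * (u (a + r *\<^sub>R y) / r\<^sup>2 - phi y) \<le> r\<^sup>2 * (u (a + r *\<^sub>R x0) / r\<^sup>2 - phi x0)"
      using r by (intro mult_left_mono) auto
    then show "u z - \<psi> z \<le> u (a + r *\<^sub>R x0) - \<psi> (a + r *\<^sub>R x0)"
      using r unfolding \<psi>_def zy inv by (simp add: right_diff_distrib)
  qed
qed

section \<open>Gluing, local bumps and stability under limits\<close>

lemma continuous_on_modify:
  fixes v w :: "'a::t2_space \<Rightarrow> 'b::topological_space"
  assumes "open U" "U \<subseteq> C" "compact K" "K \<subseteq> U" "continuous_on U w" "continuous_on C v"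
    and "\<And>x. x \<notin> K \<Longrightarrow> w x = v x"
  shows "continuous_on C w"
proof -
  have C: "C = U \<union> (C - K)" using assms by blast
  have "continuous_on (C - K) v" using assms(6) by (rule continuous_on_subset) auto
  then have c: "continuous_on (C - K) w" by (rule continuous_on_eq) (use assms(7) in auto)
  have "continuous_on (U \<union> (C - K)) w"
  proof (rule continuous_on_Un_local_open[OF _ _ assms(5) c])
    show "openin (top_of_set (U \<union> (C - K))) U" using assms(1,2) C by (metis open_subset)
    show "openin (top_of_set (U \<union> (C - K))) (C - K)"
      unfolding C[symmetric]
      by (metis Diff_eq Int_commute assms(3) compact_imp_closed open_Compl openin_open_Int)
  qed
  then show ?thesis using C by simp
qed

text \<open>At a touching point \<open>w\<close> equals \<open>v\<close> or \<open>g\<close>, and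
  that branch is touched by the same test function. The right-hand side is evaluated only there, so
  it may depend on the unknown through an arbitrary \<open>G\<close>. Confining the switch to
  \<open>K\<close> gives continuity across the boundary of \<open>V\<close>.\<close>

lemma visc_sub_glue:
  assumes v: "visc_sub F (\<lambda>x. G (v x)) U v" and g: "visc_sub F (\<lambda>x. G (g x)) V g"
    and V: "open V" "V \<subseteq> U" and K: "compact K" "K \<subseteq> V"
    and le: "\<And>x. x \<in> V \<Longrightarrow> x \<notin> K \<Longrightarrow> g x \<le> v x"
  defines "w \<equiv> \<lambda>x. if x \<in> V then max (v x) (g x) else v x"
  shows "visc_sub F (\<lambda>x. G (w x)) U w"
proof (rule visc_subI)
  have cv: "continuous_on U v" and cg: "continuous_on V g" using v g by (auto simp: visc_sub_def)
  have "continuous_on V (\<lambda>x. max (v x) (g x))"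
    using cv cg V by (intro continuous_on_max) (auto intro: continuous_on_subset)
  then have "continuous_on V w" by (simp add: w_def cong: continuous_on_cong)
  then show "continuous_on U w"
    by (rule continuous_on_modify[OF V K _ cv]) (auto simp: w_def max_absorb1 le)
  fix x0 phi H and r :: real
  assume *: "x0 \<in> U" "C2_near phi x0 H" "0 < r"
    and t: "\<And>y. y \<in> ball x0 r \<Longrightarrow> y \<in> U \<Longrightarrow> w y - phi y \<le> w x0 - phi x0"
  have wv: "v y \<le> w y" for y by (simp add: w_def)
  have wg: "g y \<le> w y" if "y \<in> V" for y using that by (simp add: w_def)
  consider "w x0 = v x0" | "x0 \<in> V" "w x0 = g x0" unfolding w_def max_def by presburger
  then show "G (w x0) \<le> F H"
  proof cases
    case 1
    have "G (v x0) \<le> F H"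
    proof (rule visc_subD[OF v *])
      fix y assume "y \<in> ball x0 r" "y \<in> U"
      from t[OF this] show "v y - phi y \<le> v x0 - phi x0" using wv[of y] 1 by simp
    qed
    then show ?thesis using 1 by simp
  next
    case 2
    have "G (g x0) \<le> F H"
    proof (rule visc_subD[OF g 2(1) *(2,3)])
      fix y assume "y \<in> ball x0 r" "y \<in> V"
      then show "g y - phi y \<le> g x0 - phi x0" using t[of y] wg[of y] 2 V by auto
    qed
    then show ?thesis using 2 by simp
  qed
qed

text \<open>\<open>F\<close> is Lipschitz on symmetric matrices and the Hessian of
  \<open>phi\<close> is continuous. The bound \<open>2 * \<eta>\<close> anticipates the Hessian of
  the quadratic \<eta>|x - x0|^2 that will be added to or subtracted from
  \<open>phi\<close>.\<close>

lemma C2_near_perturb: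
  fixes x0 :: "real^'n"
  assumes ell: "unif_elliptic F lam Lam" and phi: "C2_near phi x0 H" and e: "0 < e"
  obtains \<eta> r D2 where "0 < \<eta>" "0 < r" "\<And>y. y \<in> ball x0 r \<Longrightarrow> C2_near phi y (D2 y)"
    "\<And>y c. y \<in> ball x0 r \<Longrightarrow> \<bar>c\<bar> \<le> 2 * \<eta> \<Longrightarrow> \<bar>F (D2 y + c *\<^sub>R mat 1) - F H\<bar> < e"
proof -
  have l: "0 < Lam" using ell by (auto simp: unif_elliptic_def)
  define n1 where "n1 = norm (mat 1 :: real^'n^'n)"
  define \<eta> where "\<eta> = e / (4 * Lam * (n1 + 1))"
  have n1: "0 < n1 + 1" by (simp add: n1_def add_nonneg_pos)
  have \<eta>: "0 < \<eta>" unfolding \<eta>_def using l e n1 by (intro divide_pos_pos mult_pos_pos) auto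
  have cancel: "Lam * (2 * (e / (4 * Lam * N)) * N) = e / 2" if "0 < N" for N
    using that l by (simp add: field_simps)
  have \<eta>n: "Lam * (2 * \<eta> * (n1 + 1)) = e / 2" unfolding \<eta>_def by (rule cancel[OF n1])
  obtain r1 D2 where r1: "0 < r1" and C: "\<And>y. y \<in> ball x0 r1 \<Longrightarrow> C2_near phi y (D2 y)"
    and cD: "continuous_on (ball x0 r1) D2" and D2: "D2 x0 = H"
    using C2_near_nbhd[OF phi] by metis
  have "isCont D2 x0" using cD r1 by (simp add: continuous_on_eq_continuous_at)
  then obtain d where d: "d > 0" "\<And>y. dist y x0 < d \<Longrightarrow> norm (D2 y - H) < e / (2 * Lam)"
    using e l D2 unfolding continuous_at_eps_delta dist_norm
    by (metis divide_pos_pos mult_pos_pos zero_less_numeral)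
  have "\<bar>F (D2 y + c *\<^sub>R mat 1) - F H\<bar> < e" if y: "y \<in> ball x0 (min r1 d)" and c: "\<bar>c\<bar> \<le> 2 * \<eta>" for y c
  proof -
    let ?N = "D2 y + c *\<^sub>R mat 1 :: real^'n^'n"
    have "norm (?N - H) \<le> norm (D2 y - H) + norm (c *\<^sub>R (mat 1 :: real^'n^'n))"
      using norm_triangle_ineq[of "D2 y - H" "c *\<^sub>R mat 1"] by (simp add: algebra_simps)
    also have "norm (c *\<^sub>R (mat 1 :: real^'n^'n)) \<le> 2 * \<eta> * (n1 + 1)"
      using c \<eta> by (auto simp: n1_def intro!: mult_mono)
    finally have "Lam * norm (?N - H) \<le> Lam * (norm (D2 y - H) + 2 * \<eta> * (n1 + 1))"
      using l by (intro mult_left_mono) auto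
    also have "\<dots> = Lam * norm (D2 y - H) + e / 2" using \<eta>n by (simp add: distrib_left)
    also have "Lam * norm (D2 y - H) < e / 2"
      using d(2)[of y] y l by (simp add: dist_commute pos_less_divide_eq field_simps)
    finally have small: "Lam * norm (?N - H) < e" by simp
    have "C2_near phi y (D2 y)" using y by (intro C) auto
    then have "sym_mat ?N" by (intro sym_mat_intros C2_near_sym)
    then show ?thesis
      using unif_elliptic_lipschitz[OF ell C2_near_sym[OF phi], of ?N]
        unif_elliptic_lipschitz[OF ell _ C2_near_sym[OF phi], of ?N] small
      by (simp add: norm_minus_commute abs_less_iff)
  qed
  moreover have "C2_near phi y (D2 y)" if "y \<in> ball x0 (min r1 d)" for y using that by (intro C) auto
  ultimately show thesis using that[of \<eta> "min r1 d" D2] \<eta> r1 d(1) by auto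
qed

text \<open>Perron's device: when \<open>phi\<close> touches \<open>v\<close> from below with
  \<open>F H > 0\<close>, a slightly lifted \<open>phi\<close>, bent down by a quadratic, is still a
  subsolution; it exceeds \<open>v\<close> at \<open>x0\<close> and lies below \<open>v\<close> near
  the edge of a small ball. There is room under the ceiling \<open>tp\<close>, which is strictly
  above \<open>v\<close> at \<open>x0\<close>.\<close>

lemma visc_sub_bump:
  fixes U :: "(real^'n) set"
  assumes ell: "unif_elliptic F lam Lam"
    and v: "visc_sub F (\<lambda>x. G (v x)) U v" and G: "\<And>t. G t \<le> 0"
    and U: "open U" "x0 \<in> U" and phi: "C2_near phi x0 H" "0 < F H"
    and r: "0 < r" "\<And>y. y \<in> ball x0 r \<Longrightarrow> y \<in> U \<Longrightarrow> v x0 - phi x0 \<le> v y - phi y"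
    and tp: "continuous_on U tp" "\<And>x. x \<in> U \<Longrightarrow> v x \<le> tp x" "v x0 < tp x0"
  obtains w K where "visc_sub F (\<lambda>x. G (w x)) U w" "compact K" "K \<subseteq> U" "\<And>x. x \<notin> K \<Longrightarrow> w x = v x"
    "\<And>x. v x \<le> w x" "\<And>x. x \<in> U \<Longrightarrow> w x \<le> tp x" "v x0 < w x0"
proof -
  define e where "e = tp x0 - v x0"
  have e: "e > 0" using tp by (simp add: e_def)
  obtain \<eta> r1 D2 where \<eta>: "0 < \<eta>" and r1: "0 < r1" and C: "\<And>y. y \<in> ball x0 r1 \<Longrightarrow> C2_near phi y (D2 y)"
    and FD: "\<And>y c. y \<in> ball x0 r1 \<Longrightarrow> \<bar>c\<bar> \<le> 2 * \<eta> \<Longrightarrow> \<bar>F (D2 y + c *\<^sub>R mat 1) - F H\<bar> < F H"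
    using C2_near_perturb[OF ell phi] by metis
  obtain d2 where d2: "d2 > 0" "\<And>y. dist y x0 < d2 \<Longrightarrow> \<bar>phi y - phi x0\<bar> < e / 4"
    using C2_near_isCont[OF phi(1)] e unfolding continuous_at_eps_delta dist_real_def
    by (metis divide_pos_pos zero_less_numeral)
  have "isCont tp x0" using tp(1) U by (simp add: continuous_on_eq_continuous_at)
  then obtain d3 where d3: "d3 > 0" "\<And>y. dist y x0 < d3 \<Longrightarrow> \<bar>tp y - tp x0\<bar> < e / 4"
    using e unfolding continuous_at_eps_delta dist_real_def
    by (metis divide_pos_pos zero_less_numeral)
  obtain d4 where d4: "d4 > 0" "ball x0 d4 \<subseteq> U" using U openE by blast
  define \<rho> where "\<rho> = min (min r r1) (min d2 (min d3 d4))"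
  have \<rho>: "\<rho> > 0" using r r1 d2 d3 d4 by (simp add: \<rho>_def)
  \<comment> \<open>The first bound puts the bump below \<open>v\<close> outside the ball of radius
    \<open>\<rho> / 2\<close>; the second, with the oscillations of \<open>phi\<close> and
    \<open>tp\<close> below \<open>e / 4\<close>, keeps it under \<open>tp\<close>.\<close>
  define \<kappa> where "\<kappa> = min (\<eta> * \<rho>\<^sup>2 / 4) (e / 4)"
  have \<kappa>: "\<kappa> > 0" using \<eta> \<rho> e by (simp add: \<kappa>_def)
  define g where "g x = (phi x + (v x0 - phi x0 + \<kappa>)) - \<eta> * ((x - x0) \<bullet> (x - x0))" for x
  define V where "V = ball x0 \<rho>"
  define K where "K = cball x0 (\<rho> / 2)"
  have VU: "V \<subseteq> U" using d4 by (auto simp: V_def \<rho>_def)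
  have gC: "C2_near g x (D2 x - (2 * \<eta>) *\<^sub>R mat 1)" if "x \<in> V" for x
  proof -
    have "C2_near phi x (D2 x)" using that by (intro C) (auto simp: V_def \<rho>_def)
    from C2_near_diff[OF C2_near_add[OF this C2_near_const] C2_near_quadratic] show ?thesis
      by (simp add: g_def[abs_def])
  qed
  have gF: "0 \<le> F (D2 x - (2 * \<eta>) *\<^sub>R mat 1)" if x: "x \<in> V" for x
    using FD[of x "- (2 * \<eta>)"] x \<eta> by (simp add: V_def \<rho>_def abs_less_iff)
  have gsub: "visc_sub F (\<lambda>x. G (g x)) V g"
    using gC by (rule C2_visc_sub[OF ell]) (use G gF in \<open>auto simp: V_def intro: order_trans\<close>)
  have sq: "(x - x0) \<bullet> (x - x0) = (dist x0 x)\<^sup>2" for x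
    by (simp add: dist_norm norm_minus_commute dot_square_norm)
  have le: "g x \<le> v x" if "x \<in> V" "x \<notin> K" for x
  proof -
    have "(\<rho> / 2)\<^sup>2 \<le> (dist x0 x)\<^sup>2" using that \<rho> by (intro power_mono) (auto simp: K_def)
    then have "\<eta> * (\<rho>\<^sup>2 / 4) \<le> \<eta> * ((x - x0) \<bullet> (x - x0))"
      using \<eta> by (intro mult_left_mono) (auto simp: sq power_divide)
    moreover have "v x0 - phi x0 \<le> v x - phi x" using that VU by (intro r(2)) (auto simp: V_def \<rho>_def)
    moreover have "\<kappa> \<le> \<eta> * (\<rho>\<^sup>2 / 4)" by (simp add: \<kappa>_def)
    ultimately show ?thesis by (simp add: g_def)
  qed
  define w where "w = (\<lambda>x. if x \<in> V then max (v x) (g x) else v x)"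
  have KV: "K \<subseteq> V" using \<rho> by (auto simp: K_def V_def)
  have "visc_sub F (\<lambda>x. G (w x)) U w"
    unfolding w_def by (rule visc_sub_glue[OF v gsub _ VU _ KV le]) (auto simp: V_def K_def)
  moreover have "compact K" "K \<subseteq> U" using KV VU by (auto simp: K_def)
  moreover have "w x = v x" if "x \<notin> K" for x using that le by (auto simp: w_def max_absorb1)
  moreover have "v x \<le> w x" for x by (simp add: w_def)
  moreover have "w x \<le> tp x" if "x \<in> U" for x
  proof -
    have "g x \<le> tp x" if "x \<in> V"
    proof -
      have "\<bar>phi x - phi x0\<bar> < e / 4" "\<bar>tp x - tp x0\<bar> < e / 4"
        using that d2(2)[of x] d3(2)[of x] by (auto simp: V_def \<rho>_def dist_commute)
      moreover have "0 \<le> \<eta> * ((x - x0) \<bullet> (x - x0))" using \<eta> by simp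
      moreover have "\<kappa> \<le> e / 4" by (simp add: \<kappa>_def)
      ultimately show ?thesis unfolding g_def e_def by (simp add: abs_if split: if_splits)
    qed
    then show ?thesis using tp(2)[OF that] by (simp add: w_def)
  qed
  moreover have "v x0 < w x0" using \<rho> \<kappa> by (simp add: w_def V_def g_def)
  ultimately show thesis using that by blast
qed

text \<open>The approximants need to be close to \<open>W\<close> only from above on a ball and from
  below at its centre, and may change with the point and with \<kappa>. This covers suprema of
  families as well as locally uniform limits. Adding a quadratic to the test function makes the
  touching strict, so a maximum for the approximant stays inside and its value there is close to
  \<open>W x0\<close>, where \<open>G\<close> is continuous.\<close>

lemma visc_sub_limit:
  fixes U :: "(real^'n) set"
  assumes ell: "unif_elliptic F lam Lam"
    and U: "open U" and W: "continuous_on U W"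
    and approx: "\<And>x. x \<in> U \<Longrightarrow> \<exists>\<rho>>0. ball x \<rho> \<subseteq> U \<and>
      (\<forall>\<kappa>>0. \<exists>v. visc_sub F (\<lambda>y. G (v y)) (ball x \<rho>) v \<and>
         (\<forall>y\<in>ball x \<rho>. v y \<le> W y + \<kappa>) \<and> W x - \<kappa> < v x)"
    and G: "\<And>x. x \<in> U \<Longrightarrow> isCont G (W x)"
  shows "visc_sub F (\<lambda>x. G (W x)) U W"
proof (rule visc_subI[OF W])
  fix x0 phi H and r :: real
  assume x0: "x0 \<in> U" and phi: "C2_near phi x0 H" and r: "0 < r"
    and t: "\<And>y. y \<in> ball x0 r \<Longrightarrow> y \<in> U \<Longrightarrow> W y - phi y \<le> W x0 - phi x0"
  show "G (W x0) \<le> F H"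
  proof (rule ccontr)
    assume "\<not> G (W x0) \<le> F H"
    define e where "e = G (W x0) - F H"
    have e: "e > 0" using \<open>\<not> G (W x0) \<le> F H\<close> by (simp add: e_def)
    obtain \<eta> r1 D2 where \<eta>: "0 < \<eta>" and r1: "0 < r1" and C: "\<And>y. y \<in> ball x0 r1 \<Longrightarrow> C2_near phi y (D2 y)"
      and FD: "\<And>y c. y \<in> ball x0 r1 \<Longrightarrow> \<bar>c\<bar> \<le> 2 * \<eta> \<Longrightarrow> \<bar>F (D2 y + c *\<^sub>R mat 1) - F H\<bar> < e / 2"
      using C2_near_perturb[OF ell phi half_gt_zero[OF e]] by metis
    obtain r2 where r2: "0 < r2" "ball x0 r2 \<subseteq> U"
      and v_ex: "\<And>\<kappa>. \<kappa> > 0 \<Longrightarrow> \<exists>v. visc_sub F (\<lambda>y. G (v y)) (ball x0 r2) v \<and>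
         (\<forall>y\<in>ball x0 r2. v y \<le> W y + \<kappa>) \<and> W x0 - \<kappa> < v x0"
      using approx[OF x0] by blast
    obtain \<nu> where \<nu>: "\<nu> > 0" "\<And>s. dist s (W x0) < \<nu> \<Longrightarrow> \<bar>G s - G (W x0)\<bar> < e / 2"
      using G[OF x0] e unfolding continuous_at_eps_delta dist_real_def by (metis half_gt_zero)
    obtain d2 where d2: "d2 > 0" "\<And>y. dist y x0 < d2 \<Longrightarrow> \<bar>phi y - phi x0\<bar> < \<nu> / 4"
      using C2_near_isCont[OF phi] \<nu>(1) unfolding continuous_at_eps_delta dist_real_def
      by (metis divide_pos_pos zero_less_numeral)
    have "isCont W x0" using W U x0 by (simp add: continuous_on_eq_continuous_at)
    then obtain d3 where d3: "d3 > 0" "\<And>y. dist y x0 < d3 \<Longrightarrow> \<bar>W y - W x0\<bar> < \<nu> / 2"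
      using \<nu>(1) unfolding continuous_at_eps_delta dist_real_def by (metis half_gt_zero)
    define q where "q = min (min r r1) (min r2 (min d2 d3)) / 2"
    have q: "q > 0" "q < r" "q < r1" "q < r2" "q < d2" "q < d3"
      using r r1 r2 d2 d3 by (auto simp: q_def)
    \<comment> \<open>On the sphere of radius \<open>q\<close> the quadratic costs
      \<open>\<eta> * q\<^sup>2\<close>, more than the total error \<open>2 * \<kappa>\<close>, so
      the maximum is interior; \<open>\<nu> / 4\<close> keeps the value at the maximum within \<nu>
      of \<open>W x0\<close>.\<close>
    define \<kappa> where "\<kappa> = min (\<eta> * q\<^sup>2 / 4) (\<nu> / 4)"
    have \<kappa>: "\<kappa> > 0" using \<eta> q \<nu> by (simp add: \<kappa>_def)
    obtain v where v: "visc_sub F (\<lambda>y. G (v y)) (ball x0 r2) v"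
      and vW: "\<And>y. y \<in> ball x0 r2 \<Longrightarrow> v y \<le> W y + \<kappa>" and vx0: "W x0 - \<kappa> < v x0"
      using v_ex[OF \<kappa>] by blast
    define \<psi> where "\<psi> x = phi x + \<eta> * ((x - x0) \<bullet> (x - x0))" for x
    have sq: "(x - x0) \<bullet> (x - x0) = (dist x0 x)\<^sup>2" for x
      by (simp add: dist_norm norm_minus_commute dot_square_norm)
    have \<psi>C: "C2_near \<psi> x (D2 x + (2 * \<eta>) *\<^sub>R mat 1)" if "x \<in> cball x0 q" for x
      using C2_near_add[OF C C2_near_quadratic] that q by (auto simp: \<psi>_def[abs_def])
    have "continuous_on (cball x0 q) (\<lambda>x. v x - \<psi> x)"
    proof (intro continuous_on_diff)
      show "continuous_on (cball x0 q) v"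
        using v q by (auto simp: visc_sub_def elim!: continuous_on_subset)
      show "continuous_on (cball x0 q) \<psi>"
        using \<psi>C by (meson C2_near_isCont continuous_at_imp_continuous_on)
    qed
    then obtain x1 where x1: "x1 \<in> cball x0 q" "\<And>x. x \<in> cball x0 q \<Longrightarrow> v x - \<psi> x \<le> v x1 - \<psi> x1"
      using continuous_attains_sup[of "cball x0 q" "\<lambda>x. v x - \<psi> x"] q by auto
    have low: "v x0 - phi x0 \<le> v x1 - \<psi> x1" using x1(2)[of x0] q by (simp add: \<psi>_def)
    have x1r: "x1 \<in> ball x0 r" "x1 \<in> U" "x1 \<in> ball x0 r2" using x1 q r2 by auto
    have "dist x0 x1 < q"
    proof (rule ccontr)
      assume "\<not> dist x0 x1 < q"
      then have "dist x0 x1 = q" using x1 by simp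
      then have "v x1 - \<psi> x1 \<le> W x1 + \<kappa> - phi x1 - \<eta> * q\<^sup>2"
        using vW[OF x1r(3)] by (simp add: \<psi>_def sq)
      also have "\<dots> \<le> W x0 - phi x0 + \<kappa> - \<eta> * q\<^sup>2" using t[OF x1r(1,2)] by simp
      finally have "\<eta> * q\<^sup>2 < 2 * \<kappa>" using low vx0 by simp
      moreover have "\<kappa> \<le> \<eta> * q\<^sup>2 / 4" by (simp add: \<kappa>_def)
      moreover have "0 < \<eta> * q\<^sup>2" using \<eta> q by simp
      ultimately show False by linarith
    qed
    then obtain q' where q': "q' > 0" "ball x1 q' \<subseteq> ball x0 q" by (metis mem_ball openE open_ball)
    have GF: "G (v x1) \<le> F (D2 x1 + (2 * \<eta>) *\<^sub>R mat 1)"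
    proof (rule visc_subD[OF v x1r(3) \<psi>C[OF x1(1)] q'(1)])
      fix y assume "y \<in> ball x1 q'"
      then show "v y - \<psi> y \<le> v x1 - \<psi> x1" using q' by (intro x1(2)) auto
    qed
    have "v x1 < W x0 + \<nu>"
    proof -
      have "\<bar>W x1 - W x0\<bar> < \<nu> / 2" using x1 q by (intro d3) (auto simp: dist_commute)
      moreover have "\<kappa> \<le> \<nu> / 4" by (simp add: \<kappa>_def)
      ultimately show ?thesis using vW[OF x1r(3)] \<nu> by linarith
    qed
    moreover have "v x1 > W x0 - \<nu>"
    proof -
      have "\<bar>phi x1 - phi x0\<bar> < \<nu> / 4" using x1 q by (intro d2) (auto simp: dist_commute)
      moreover have "\<kappa> \<le> \<nu> / 4" by (simp add: \<kappa>_def)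
      moreover have "0 \<le> \<eta> * ((x1 - x0) \<bullet> (x1 - x0))" using \<eta> by simp
      ultimately show ?thesis using low vx0 \<nu> unfolding \<psi>_def by linarith
    qed
    ultimately have "\<bar>G (v x1) - G (W x0)\<bar> < e / 2" by (intro \<nu>) (auto simp: dist_real_def)
    moreover have "\<bar>F (D2 x1 + (2 * \<eta>) *\<^sub>R mat 1) - F H\<bar> < e / 2"
      using x1(1) q \<eta> by (intro FD) auto
    ultimately show False using GF e unfolding e_def abs_less_iff by argo
  qed
qed

section \<open>Interior Lipschitz estimate\<close>

lemma visc_sub_add_affine:
  assumes "visc_sub F h U u"
  shows "visc_sub F h U (\<lambda>x. u x + (c + p \<bullet> x))"
  by (rule visc_sub_add_C2[OF assms C2_near_affine]) auto

lemma visc_super_add_affine: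
  assumes "visc_super F h U u"
  shows "visc_super F h U (\<lambda>x. u x + (c + p \<bullet> x))"
  using visc_sub_add_affine[OF assms[unfolded visc_super_dual], of "- c" "- p"]
  unfolding visc_super_dual by (simp add: algebra_simps)

lemma visc_super_rescale:
  assumes "visc_super F (\<lambda>x. c) U u" "0 < r"
  shows "visc_super F (\<lambda>x. c) {x. a + r *\<^sub>R x \<in> U} (\<lambda>x. u (a + r *\<^sub>R x) / r\<^sup>2)"
  using visc_sub_rescale[OF assms(1)[unfolded visc_super_dual] assms(2), of a]
  unfolding visc_super_dual by simp

text \<open>Perron's method for \<open>F(D\<^sup>2W) = 0\<close> between the subsolution \<open>u\<close> and the supersolution
  \<open>u + c (r\<^sup>2 - |x - X|\<^sup>2)\<^sup>+\<close>. No comparison principle is needed: the equation is invariant under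
  translations, so the supremum of the admissible subsolutions inherits the modulus of continuity
  of the two bounds.\<close>

lemma perron_sandwich:
  fixes X :: "real^'n"
  assumes ell: "unif_elliptic F lam Lam" and R: "0 < R"
    and cu: "continuous_on (cball X R) u"
    and sub: "visc_sub F (\<lambda>x. 0) (ball X R) u"
    and sup: "visc_super F (\<lambda>x. K) (ball X R) u" and K: "0 \<le> K"
  obtains W where "continuous_on (cball X (R / 2)) W" "visc_sol F (\<lambda>x. 0) (ball X (R / 2)) W"
    "\<And>x. x \<in> cball X (R / 2) \<Longrightarrow> u x \<le> W x"
    "\<And>x. x \<in> cball X (R / 2) \<Longrightarrow> W x \<le> u x + K * R\<^sup>2 / (8 * lam)"
proof -
  have l: "0 < lam" using ell by (simp add: unif_elliptic_def)
  define r where "r = R / 2"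
  \<comment> \<open>The quadratic with coefficient \<open>c\<close> has Hessian \<open>2 * c\<close>
    times the identity, and \<open>lam * (2 * c) = K\<close> absorbs the right-hand side of the
    supersolution inequality.\<close>
  define c where "c = K / (2 * lam)"
  define D where "D = ball X R"
  define ub where "ub x = u x + c * max 0 (r\<^sup>2 - (x - X) \<bullet> (x - X))" for x
  have r: "0 < r" "r < R" using R by (auto simp: r_def)
  have c: "0 \<le> c" using K l by (simp add: c_def)
  have sq: "(x - X) \<bullet> (x - X) = (dist X x)\<^sup>2" for x
    by (simp add: dist_norm norm_minus_commute dot_square_norm)
  have ub_out: "ub x = u x" if "x \<notin> ball X r" for x
  proof -
    have "r\<^sup>2 \<le> (dist X x)\<^sup>2" using that r by (intro power_mono) auto
    then show ?thesis by (simp add: ub_def sq)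
  qed
  have ub_ge: "u x \<le> ub x" for x using c by (simp add: ub_def)
  have ub_le: "ub x \<le> u x + K * R\<^sup>2 / (8 * lam)" for x
  proof -
    have "c * max 0 (r\<^sup>2 - (x - X) \<bullet> (x - X)) \<le> c * r\<^sup>2" using c by (intro mult_left_mono) auto
    also have "\<dots> = K * R\<^sup>2 / (8 * lam)" by (simp add: c_def r_def power2_eq_square)
    finally show ?thesis by (simp add: ub_def)
  qed
  have cub: "continuous_on (cball X R) ub"
    unfolding ub_def by (intro continuous_intros cu)
  define S where "S = {v. visc_sub F (\<lambda>x. 0) D v \<and> (\<forall>x\<in>D. u x \<le> v x \<and> v x \<le> ub x)}"
  have uS: "u \<in> S" using sub ub_ge by (auto simp: S_def D_def)
  define W where "W x = (SUP v\<in>S. v x)" for x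
  have bdd: "bdd_above ((\<lambda>v. v x) ` S)" if "x \<in> D" for x
    using that by (intro bdd_aboveI[of _ "ub x"]) (auto simp: S_def)
  have W_ge: "v x \<le> W x" if "v \<in> S" "x \<in> D" for v x
    unfolding W_def by (rule cSUP_upper[OF that(1) bdd[OF that(2)]])
  have W_le: "W x \<le> ub x" if "x \<in> D" for x
    unfolding W_def using uS that by (intro cSUP_least) (auto simp: S_def)
  have W_u: "u x \<le> W x" if "x \<in> D" for x by (rule W_ge[OF uS that])
  have W_approx: "\<exists>v\<in>S. W x - e < v x" if "x \<in> D" "e > 0" for x e
    using less_cSUP_iff[OF _ bdd[OF that(1)], of "W x - e"] uS that(2) by (auto simp flip: W_def)
  \<comment> \<open>A translate of an admissible subsolution, lowered by \<open>e\<close>, is below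
    \<open>ub\<close> by uniform continuity. Outside \<open>cball X r\<close> the two bounds
    coincide, so there it is also below the subsolution itself, and the maximum of both is
    admissible again.\<close>
  have trans: "\<exists>d>0. \<forall>h. norm h < d \<longrightarrow> (\<forall>x\<in>ball X (3 * R / 4). W (x + h) \<le> W x + e)"
    if e: "e > 0" for e
  proof -
    have "uniformly_continuous_on (cball X R) u" "uniformly_continuous_on (cball X R) ub"
      using cu cub by (auto intro: compact_uniformly_continuous)
    then obtain d1 d2 where d1: "d1 > 0" "\<And>x y. x \<in> cball X R \<Longrightarrow> y \<in> cball X R \<Longrightarrow> dist y x < d1 \<Longrightarrow> dist (u y) (u x) < e"
      and d2: "d2 > 0" "\<And>x y. x \<in> cball X R \<Longrightarrow> y \<in> cball X R \<Longrightarrow> dist y x < d2 \<Longrightarrow> dist (ub y) (ub x) < e"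
      using e unfolding uniformly_continuous_on_def by metis
    define d where "d = min (min d1 d2) (R / 4)"
    have "W (x + h) \<le> W x + e" if h: "norm h < d" and x: "x \<in> ball X (3 * R / 4)" for h x
    proof (rule field_le_epsilon)
      fix e' :: real assume e': "e' > 0"
      define V where "V = ball X (3 * R / 4)"
      have VD: "V \<subseteq> D" using R by (auto simp: V_def D_def)
      have hD: "y + h \<in> D" if "y \<in> V" for y
      proof -
        have "dist X (y + h) \<le> dist X y + norm h"
          using dist_triangle[of X "y + h" y] by (simp add: dist_norm)
        then show ?thesis using that h by (simp add: V_def D_def d_def)
      qed
      have ubh: "ub (y + h) \<le> ub y + e" if "y \<in> V" for y
      proof -
        have "dist (ub (y + h)) (ub y) < e"
          using that hD[OF that] VD h by (intro d2(2)) (auto simp: D_def dist_norm d_def)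
        then show ?thesis by (simp add: dist_real_def)
      qed
      obtain v where v: "v \<in> S" "W (x + h) - e' < v (x + h)"
        using W_approx[OF hD e'] x by (auto simp: V_def)
      define g where "g y = v (y + h) - e" for y
      have vs: "visc_sub F (\<lambda>x. 0) D v" and vb: "\<And>x. x \<in> D \<Longrightarrow> u x \<le> v x" "\<And>x. x \<in> D \<Longrightarrow> v x \<le> ub x"
        using v(1) by (auto simp: S_def)
      have "visc_sub F (\<lambda>x. 0) V (\<lambda>y. v (h + 1 *\<^sub>R y) / 1\<^sup>2)"
        by (rule visc_sub_weaken[OF visc_sub_rescale[OF vs]]) (use hD in \<open>auto simp: V_def add.commute\<close>)
      then have gs: "visc_sub F (\<lambda>x. 0) V g"
        using visc_sub_add_affine[of F "\<lambda>x. 0" V _ "- e" 0] by (auto simp: g_def[abs_def] add.commute)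
      have gub: "g y \<le> ub y" if "y \<in> V" for y
        using vb(2)[OF hD[OF that]] ubh[OF that] by (simp add: g_def)
      define w where "w = (\<lambda>x. if x \<in> V then max (v x) (g x) else v x)"
      have "visc_sub F (\<lambda>x. (\<lambda>t. 0) (w x)) D w"
        unfolding w_def
      proof (rule visc_sub_glue[OF vs gs])
        show "open V" "V \<subseteq> D" "compact (cball X r)" "cball X r \<subseteq> V"
          using VD R by (auto simp: V_def r_def)
        fix y assume y: "y \<in> V" "y \<notin> cball X r"
        then have "ub y = u y" by (intro ub_out) auto
        then show "g y \<le> v y" using gub[OF y(1)] vb(1)[of y] y VD by auto
      qed
      then have "w \<in> S" using vb gub VD by (auto simp: S_def w_def max_def intro: order_trans)
      then have "w x \<le> W x" using x VD by (intro W_ge) (auto simp: V_def)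
      moreover have "v (x + h) - e \<le> w x" using x by (simp add: w_def V_def g_def)
      ultimately show "W (x + h) \<le> W x + e + e'" using v(2) by simp
    qed
    moreover have "d > 0" using d1 d2 R by (simp add: d_def)
    ultimately show ?thesis by blast
  qed
  have "continuous_on (ball X (3 * R / 4)) W"
    unfolding continuous_on_iff
  proof (intro ballI allI impI)
    fix x and e :: real assume x: "x \<in> ball X (3 * R / 4)" and e: "e > 0"
    obtain d where d: "d > 0" "\<And>h x. norm h < d \<Longrightarrow> x \<in> ball X (3 * R / 4) \<Longrightarrow> W (x + h) \<le> W x + e / 2"
      using trans[of "e / 2"] e by auto
    have "dist (W y) (W x) < e" if y: "y \<in> ball X (3 * R / 4)" "dist y x < d" for y
      using d(2)[of "y - x" x] d(2)[of "x - y" y] x y e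
      by (auto simp: dist_norm norm_minus_commute)
    then show "\<exists>d>0. \<forall>x'\<in>ball X (3 * R / 4). dist x' x < d \<longrightarrow> dist (W x') (W x) < e"
      using d(1) by blast
  qed
  moreover have "continuous_on (D - cball X r) W"
  proof (rule continuous_on_eq)
    show "continuous_on (D - cball X r) u" using cu by (rule continuous_on_subset) (auto simp: D_def)
    fix x assume x: "x \<in> D - cball X r"
    then have "ub x = u x" by (intro ub_out) auto
    then show "u x = W x" using W_u[of x] W_le[of x] x by auto
  qed
  ultimately have "continuous_on (ball X (3 * R / 4) \<union> (D - cball X r)) W"
    by (intro continuous_on_open_Un) (auto simp: D_def)
  moreover have "ball X (3 * R / 4) \<union> (D - cball X r) = D" using R by (auto simp: D_def r_def)
  ultimately have cW: "continuous_on D W" by simp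
  have Wsub: "visc_sub F (\<lambda>x. (\<lambda>t. 0) (W x)) D W"
  proof (rule visc_sub_limit[OF ell _ cW])
    fix x assume x: "x \<in> D"
    then obtain \<rho> where \<rho>: "\<rho> > 0" "ball x \<rho> \<subseteq> D" by (metis D_def openE open_ball)
    show "\<exists>\<rho>>0. ball x \<rho> \<subseteq> D \<and> (\<forall>\<kappa>>0. \<exists>v. visc_sub F (\<lambda>y. 0) (ball x \<rho>) v \<and>
        (\<forall>y\<in>ball x \<rho>. v y \<le> W y + \<kappa>) \<and> W x - \<kappa> < v x)"
    proof (intro exI[of _ \<rho>] conjI \<rho> allI impI)
      fix \<kappa> :: real assume "\<kappa> > 0"
      then obtain v where v: "v \<in> S" "W x - \<kappa> < v x" using W_approx[OF x] by blast
      have "visc_sub F (\<lambda>y. 0) (ball x \<rho>) v"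
        by (rule visc_sub_weaken[of F "\<lambda>y. 0" D]) (use v(1) \<rho> in \<open>auto simp: S_def\<close>)
      moreover have "v y \<le> W y + \<kappa>" if "y \<in> ball x \<rho>" for y
        using W_ge[OF v(1), of y] that \<rho> \<open>\<kappa> > 0\<close> by force
      ultimately show "\<exists>v. visc_sub F (\<lambda>y. 0) (ball x \<rho>) v \<and>
        (\<forall>y\<in>ball x \<rho>. v y \<le> W y + \<kappa>) \<and> W x - \<kappa> < v x" using v(2) by blast
    qed
  qed (auto simp: D_def)
  have BD: "cball X r \<subseteq> D" using r by (auto simp: D_def)
  have "visc_super F (\<lambda>x. 0) (ball X r) W"
    unfolding visc_super_def
  proof (intro conjI ballI allI impI)
    show "continuous_on (ball X r) W" using BD by (intro continuous_on_subset[OF cW]) auto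
    fix x0 phi H assume x0: "x0 \<in> ball X r"
      and *: "C2_near phi x0 H \<and> (\<exists>r'>0. \<forall>y\<in>ball x0 r' \<inter> ball X r. W x0 - phi x0 \<le> W y - phi y)"
    then obtain q where q: "q > 0" "\<And>y. y \<in> ball x0 q \<Longrightarrow> y \<in> ball X r \<Longrightarrow> W x0 - phi x0 \<le> W y - phi y"
      and phi: "C2_near phi x0 H" by blast
    obtain q' where q': "q' > 0" "ball x0 q' \<subseteq> ball X r" using x0 by (metis openE open_ball)
    have x0D: "x0 \<in> D" using x0 BD by auto
    show "F H \<le> 0"
    proof (rule ccontr)
      assume "\<not> F H \<le> 0"
      then have pos: "0 < F H" by simp
      \<comment> \<open>If \<open>W\<close> met the upper bound at \<open>x0\<close>, then
        \<open>phi\<close> plus the quadratic would touch \<open>u\<close> from below, giving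
        \<open>F (H + (2 * c) *\<^sub>R mat 1) \<le> K\<close>; ellipticity makes the left side at
        least \<open>F H + K\<close>.\<close>
      have lt: "W x0 < ub x0"
      proof (rule ccontr)
        assume "\<not> W x0 < ub x0"
        then have eq: "W x0 = ub x0" using W_le[OF x0D] by simp
        have ub_in: "ub y = u y + c * r\<^sup>2 - c * ((y - X) \<bullet> (y - X))" if "y \<in> ball X r" for y
        proof -
          have "(dist X y)\<^sup>2 \<le> r\<^sup>2" using that by (intro power_mono) auto
          then show ?thesis by (simp add: ub_def sq right_diff_distrib)
        qed
        have "C2_near (\<lambda>y. phi y + c * ((y - X) \<bullet> (y - X))) x0 (H + (2 * c) *\<^sub>R mat 1)"
          by (rule C2_near_add[OF phi C2_near_quadratic])
        then have "F (H + (2 * c) *\<^sub>R mat 1) \<le> K"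
        proof (rule visc_superD[OF sup, rotated])
          show "0 < min q q'" using q q' by simp
          show "x0 \<in> ball X R" using x0D by (simp add: D_def)
          fix y assume y: "y \<in> ball x0 (min q q')"
          then have yB: "y \<in> ball X r" using q' by auto
          then have "W y \<le> ub y" using BD by (intro W_le) auto
          then show "u x0 - (phi x0 + c * ((x0 - X) \<bullet> (x0 - X))) \<le> u y - (phi y + c * ((y - X) \<bullet> (y - X)))"
            using q(2)[of y] y yB eq ub_in[OF yB] ub_in[OF x0] by auto
        qed
        moreover have "F H + lam * (2 * c) \<le> F (H + (2 * c) *\<^sub>R mat 1)"
          using c by (intro unif_elliptic_add_id[OF ell C2_near_sym[OF phi]]) auto
        moreover have "lam * (2 * c) = K" using l by (simp add: c_def)
        ultimately show False using pos by simp
      qed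
      obtain w K' where w: "visc_sub F (\<lambda>x. (\<lambda>t. 0) (w x)) D w" "\<And>x. W x \<le> w x"
        "\<And>x. x \<in> D \<Longrightarrow> w x \<le> ub x" "W x0 < w x0"
      proof (rule visc_sub_bump[OF ell Wsub _ _ x0D phi pos, where r = "min q q'" and tp = ub])
        show "continuous_on D ub" by (rule continuous_on_subset[OF cub]) (auto simp: D_def)
        fix y assume "y \<in> ball x0 (min q q')"
        then show "W x0 - phi x0 \<le> W y - phi y" using q q' by auto
      qed (use q q' lt W_le in \<open>auto simp: D_def\<close>)
      have "w \<in> S" using w(1,3) order_trans[OF W_u w(2)] by (simp add: S_def)
      then show False using W_ge[of w x0] w(4) x0D by simp
    qed
  qed
  moreover have "visc_sub F (\<lambda>x. 0) (ball X r) W"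
    using BD by (intro visc_sub_weaken[OF Wsub]) auto
  moreover have "continuous_on (cball X r) W" using BD by (rule continuous_on_subset[OF cW])
  ultimately show thesis
    using that[of W] W_u W_le ub_le BD unfolding visc_sol_def r_def by (meson order_trans subsetD)
qed

text \<open>The rescaling \<open>W (X + r *\<^sub>R x) / r\<^sup>2\<close> brings the ball to unit
  size and keeps \<open>F = 0\<close>. Two applications of the mean value theorem along a segment
  turn the Hessian bound into a quadratic remainder.\<close>

lemma interior_taylor_estimate:
  fixes F :: "real^'n^'n \<Rightarrow> real"
  assumes "interior_C2tau_estimates F tau"
  obtains C where "0 < C"
    "\<And>X r W M. 0 < r \<Longrightarrow> continuous_on (cball X r) W \<Longrightarrow> visc_sol F (\<lambda>x. 0) (ball X r) W \<Longrightarrow>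
      (\<And>x. x \<in> cball X r \<Longrightarrow> \<bar>W x\<bar> \<le> M) \<Longrightarrow>
      \<exists>p. norm p \<le> C * M / r \<and>
        (\<forall>y\<in>ball X (r / 2). \<bar>W y - W X - p \<bullet> (y - X)\<bar> \<le> C * M * (norm (y - X) / r)\<^sup>2)"
proof -
  obtain C where C: "C > 0" and est: "\<And>w. continuous_on (cball 0 1) w \<Longrightarrow> visc_sol F (\<lambda>x. 0) (ball 0 1) w \<Longrightarrow>
     (let Mw = Sup ((\<lambda>x. \<bar>w x\<bar>) ` ball 0 1) in
      \<exists>Dw D2w. \<forall>x\<in>ball 0 (1/2).
        (w has_derivative (\<lambda>h. Dw x \<bullet> h)) (at x) \<and>
        (Dw has_derivative (\<lambda>h. D2w x *v h)) (at x) \<and>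
        \<bar>w x\<bar> \<le> C * Mw \<and> norm (Dw x) \<le> C * Mw \<and> norm (D2w x) \<le> C * Mw \<and>
        (\<forall>y\<in>ball 0 (1/2). norm (D2w x - D2w y) \<le> C * Mw * dist x y powr tau))"
    using assms unfolding interior_C2tau_estimates_def by blast
  show thesis
  proof (rule that[OF C])
    fix X :: "real^'n" and r W M
    assume r: "0 < r" and cW: "continuous_on (cball X r) W" and sol: "visc_sol F (\<lambda>x. 0) (ball X r) W"
      and M: "\<And>x. x \<in> cball X r \<Longrightarrow> \<bar>W x\<bar> \<le> M"
    define w where "w x = W (X + r *\<^sub>R x) / r\<^sup>2" for x
    have inr: "X + r *\<^sub>R x \<in> ball X r \<longleftrightarrow> x \<in> ball 0 1" "X + r *\<^sub>R x \<in> cball X r \<longleftrightarrow> x \<in> cball 0 1" for x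
      using r by (auto simp: dist_norm)
    have "continuous_on (cball 0 1) (\<lambda>x. W (X + r *\<^sub>R x))"
      by (rule continuous_on_compose2[OF cW]) (use inr in \<open>auto intro!: continuous_intros\<close>)
    then have cw: "continuous_on (cball 0 1) w"
      unfolding w_def using r by (intro continuous_on_divide continuous_on_const) auto
    have "visc_sub F (\<lambda>x. 0) (ball X r) W" "visc_super F (\<lambda>x. 0) (ball X r) W"
      using sol by (auto simp: visc_sol_def)
    from visc_sub_rescale[OF this(1) r, of X] visc_super_rescale[OF this(2) r, of X]
    have "visc_sol F (\<lambda>x. 0) (ball 0 1) w"
      unfolding visc_sol_def inr w_def[abs_def] by (simp add: ball_def)
    from est[OF cw this] obtain Dw D2w where
      e: "\<And>x. x \<in> ball 0 (1/2) \<Longrightarrow> (w has_derivative (\<lambda>h. Dw x \<bullet> h)) (at x)"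
        "\<And>x. x \<in> ball 0 (1/2) \<Longrightarrow> (Dw has_derivative (\<lambda>h. D2w x *v h)) (at x)"
        "\<And>x. x \<in> ball 0 (1/2) \<Longrightarrow> norm (Dw x) \<le> C * Sup ((\<lambda>x. \<bar>w x\<bar>) ` ball 0 1)"
        "\<And>x. x \<in> ball 0 (1/2) \<Longrightarrow> norm (D2w x) \<le> C * Sup ((\<lambda>x. \<bar>w x\<bar>) ` ball 0 1)"
      unfolding Let_def by metis
    have "Sup ((\<lambda>x. \<bar>w x\<bar>) ` ball 0 1) \<le> M / r\<^sup>2"
    proof (rule cSup_least)
      show "(\<lambda>x. \<bar>w x\<bar>) ` ball 0 1 \<noteq> {}" by simp
      fix y assume "y \<in> (\<lambda>x. \<bar>w x\<bar>) ` ball 0 1"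
      then obtain x where x: "x \<in> ball 0 1" "y = \<bar>w x\<bar>" by blast
      have "\<bar>W (X + r *\<^sub>R x)\<bar> \<le> M" by (rule M) (use x inr(2)[of x] in auto)
      then show "y \<le> M / r\<^sup>2" using r x by (simp add: w_def abs_divide divide_right_mono)
    qed
    then have CM: "C * Sup ((\<lambda>x. \<bar>w x\<bar>) ` ball 0 1) \<le> C * (M / r\<^sup>2)" using C by (intro mult_left_mono) auto
    have taylor: "\<bar>w x - w 0 - Dw 0 \<bullet> x\<bar> \<le> C * (M / r\<^sup>2) * (norm x)\<^sup>2" if x: "x \<in> ball 0 (1/2)" for x
    proof -
      have sx: "s *\<^sub>R x \<in> ball 0 (1/2)" if "0 \<le> s" "s \<le> 1" for s
        using x mult_right_mono[OF that(2) norm_ge_zero[of x]] that by simp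
      have "\<exists>t>0. t < 1 \<and> w (0 + 1 *\<^sub>R x) - w (0 + 0 *\<^sub>R x) = (1 - 0) * (Dw (0 + t *\<^sub>R x) \<bullet> x)"
        by (rule MVT2) (use sx in \<open>auto intro!: DERIV_along_line[where c = 0, simplified] e\<close>)
      then obtain t where t: "0 < t" "t < 1" "w x - w 0 = Dw (t *\<^sub>R x) \<bullet> x" by auto
      have "\<exists>s>0. s < t \<and> Dw (0 + t *\<^sub>R x) \<bullet> x - Dw (0 + 0 *\<^sub>R x) \<bullet> x = (t - 0) * (x \<bullet> (D2w (0 + s *\<^sub>R x) *v x))"
        by (rule MVT2) (use sx t in \<open>auto intro!: DERIV_along_line2[where c = 0, simplified] e\<close>)
      then obtain s where s: "0 < s" "s < t" "Dw (t *\<^sub>R x) \<bullet> x - Dw 0 \<bullet> x = t * (x \<bullet> (D2w (s *\<^sub>R x) *v x))" by auto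
      have "\<bar>w x - w 0 - Dw 0 \<bullet> x\<bar> = t * \<bar>x \<bullet> (D2w (s *\<^sub>R x) *v x)\<bar>"
        using s t by (simp add: abs_mult)
      also have "\<dots> \<le> 1 * (norm (D2w (s *\<^sub>R x)) * norm x * norm x)"
        using t by (intro mult_mono abs_quadratic_form_le) auto
      also have "\<dots> \<le> C * (M / r\<^sup>2) * norm x * norm x"
        unfolding mult_1_left
        by (intro mult_right_mono order_trans[OF e(4)[OF sx] CM]) (use s t in auto)
      finally show ?thesis by (simp add: power2_eq_square mult_ac)
    qed
    show "\<exists>p. norm p \<le> C * M / r \<and>
        (\<forall>y\<in>ball X (r / 2). \<bar>W y - W X - p \<bullet> (y - X)\<bar> \<le> C * M * (norm (y - X) / r)\<^sup>2)"
    proof (intro exI[of _ "r *\<^sub>R Dw 0"] conjI ballI)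
      have "norm (Dw 0) \<le> C * (M / r\<^sup>2)" using order_trans[OF e(3) CM] by simp
      then have "r * norm (Dw 0) \<le> r * (C * (M / r\<^sup>2))" using r by (intro mult_left_mono) auto
      then show "norm (r *\<^sub>R Dw 0) \<le> C * M / r" using r by (simp add: power2_eq_square)
      fix y assume y: "y \<in> ball X (r / 2)"
      define x where "x = (1 / r) *\<^sub>R (y - X)"
      have yx: "y = X + r *\<^sub>R x" using r by (simp add: x_def)
      have "x \<in> ball 0 (1/2)" using y r by (simp add: yx dist_norm)
      from taylor[OF this] have "r\<^sup>2 * \<bar>w x - w 0 - Dw 0 \<bullet> x\<bar> \<le> r\<^sup>2 * (C * (M / r\<^sup>2) * (norm x)\<^sup>2)"
        using r by (intro mult_left_mono) auto
      moreover have "r\<^sup>2 * \<bar>w x - w 0 - Dw 0 \<bullet> x\<bar> = \<bar>r\<^sup>2 * (w x - w 0 - Dw 0 \<bullet> x)\<bar>" by (simp add: abs_mult)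
      moreover have "r\<^sup>2 * (w x - w 0 - Dw 0 \<bullet> x) = W y - W X - (r *\<^sub>R Dw 0) \<bullet> (y - X)"
        using r by (simp add: w_def yx right_diff_distrib power2_eq_square)
      moreover have "norm (y - X) / r = norm x" using r by (simp add: yx)
      ultimately show "\<bar>W y - W X - (r *\<^sub>R Dw 0) \<bullet> (y - X)\<bar> \<le> C * M * (norm (y - X) / r)\<^sup>2"
        using r by simp
    qed
  qed
qed

text \<open>On the half ball \<open>perron_sandwich\<close> supplies a solution of
  \<open>F = 0\<close> within \<open>K * R\<^sup>2 / (8 * lam)\<close> of \<open>u\<close>. Its
  affine expansion is used for \<open>u\<close>, and the discrepancy costs the additive term of
  order \<open>K * R\<^sup>2\<close>.\<close>

lemma affine_approximation_step:
  fixes F :: "real^'n^'n \<Rightarrow> real"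
  assumes ell: "unif_elliptic F lam Lam" and est: "interior_C2tau_estimates F tau"
  obtains C where "0 < C"
    "\<And>X R u M K. 0 < R \<Longrightarrow> 0 \<le> K \<Longrightarrow> continuous_on (cball X R) u \<Longrightarrow> visc_sub F (\<lambda>x. 0) (ball X R) u \<Longrightarrow>
      visc_super F (\<lambda>x. K) (ball X R) u \<Longrightarrow> (\<And>x. x \<in> cball X R \<Longrightarrow> \<bar>u x\<bar> \<le> M) \<Longrightarrow>
      \<exists>p. norm p \<le> C * (M / R + K * R) \<and>
        (\<forall>y\<in>ball X (R / 4). \<bar>u y - u X - p \<bullet> (y - X)\<bar> \<le> C * (M * (norm (y - X) / R)\<^sup>2 + K * R\<^sup>2))"
proof -
  have l: "0 < lam" using ell by (simp add: unif_elliptic_def)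
  obtain C where C: "C > 0" and t:
    "\<And>X r W M. 0 < r \<Longrightarrow> continuous_on (cball X r) W \<Longrightarrow> visc_sol F (\<lambda>x. 0) (ball X r) W \<Longrightarrow>
      (\<And>x. x \<in> cball X r \<Longrightarrow> \<bar>W x\<bar> \<le> M) \<Longrightarrow>
      \<exists>p. norm p \<le> C * M / r \<and>
        (\<forall>y\<in>ball X (r / 2). \<bar>W y - W X - p \<bullet> (y - X)\<bar> \<le> C * M * (norm (y - X) / r)\<^sup>2)"
    using interior_taylor_estimate[OF est] by metis
  define C1 where "C1 = 4 * C + C / lam + 1 / lam"
  have C1: "C1 > 0" using C l by (simp add: C1_def add_pos_pos)
  show thesis
  proof (rule that[OF C1])
    fix X :: "real^'n" and R u M K
    assume R: "0 < R" and K: "0 \<le> K" and cu: "continuous_on (cball X R) u"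
      and sub: "visc_sub F (\<lambda>x. 0) (ball X R) u"
      and sup: "visc_super F (\<lambda>x. K) (ball X R) u" and M: "\<And>x. x \<in> cball X R \<Longrightarrow> \<bar>u x\<bar> \<le> M"
    have M0: "0 \<le> M" using M[of X] R by (auto intro: order_trans[OF abs_ge_zero])
    obtain W where W: "continuous_on (cball X (R / 2)) W" "visc_sol F (\<lambda>x. 0) (ball X (R / 2)) W"
      "\<And>x. x \<in> cball X (R / 2) \<Longrightarrow> u x \<le> W x"
      "\<And>x. x \<in> cball X (R / 2) \<Longrightarrow> W x \<le> u x + K * R\<^sup>2 / (8 * lam)"
      using perron_sandwich[OF ell R cu sub sup K] by metis
    define E where "E = K * R\<^sup>2 / (8 * lam)"
    have E: "0 \<le> E" using K l by (simp add: E_def)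
    have "\<bar>W x\<bar> \<le> M + E" if "x \<in> cball X (R / 2)" for x
    proof -
      have "x \<in> cball X R" using that R by auto
      from M[OF this] W(3,4)[OF that] E show ?thesis by (simp add: E_def abs_le_iff)
    qed
    from t[OF _ W(1,2) this] R obtain p where p: "norm p \<le> C * (M + E) / (R / 2)"
      "\<And>y. y \<in> ball X (R / 2 / 2) \<Longrightarrow> \<bar>W y - W X - p \<bullet> (y - X)\<bar> \<le> C * (M + E) * (norm (y - X) / (R / 2))\<^sup>2"
      by auto
    show "\<exists>p. norm p \<le> C1 * (M / R + K * R) \<and>
        (\<forall>y\<in>ball X (R / 4). \<bar>u y - u X - p \<bullet> (y - X)\<bar> \<le> C1 * (M * (norm (y - X) / R)\<^sup>2 + K * R\<^sup>2))"
    proof (intro exI[of _ p] conjI ballI)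
      have "norm p \<le> (2 * C) * (M / R) + (C / (4 * lam)) * (K * R)"
        using p(1) R l by (simp add: E_def field_simps power2_eq_square)
      also have "\<dots> \<le> C1 * (M / R) + C1 * (K * R)"
      proof (intro add_mono mult_right_mono)
        show "2 * C \<le> C1" "C / (4 * lam) \<le> C1"
          using C l divide_left_mono[of lam "4 * lam" C] by (auto simp: C1_def intro: add_increasing2 add_increasing)
      qed (use M0 K R in auto)
      finally show "norm p \<le> C1 * (M / R + K * R)" by (simp add: distrib_left)
      fix y assume y: "y \<in> ball X (R / 4)"
      define s where "s = norm (y - X) / R"
      have s: "0 \<le> s" "s \<le> 1 / 4" using y R by (auto simp: s_def dist_norm norm_minus_commute divide_le_eq)
      have s2: "s\<^sup>2 \<le> 1 / 16" using power_mono[OF s(2,1), of 2] by (simp add: power_divide)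
      have "\<bar>W y - W X - p \<bullet> (y - X)\<bar> \<le> C * (M + E) * (norm (y - X) / (R / 2))\<^sup>2"
        using y by (intro p(2)) auto
      also have "norm (y - X) / (R / 2) = 2 * s" by (simp add: s_def)
      also have "C * (M + E) * (2 * s)\<^sup>2 = 4 * C * M * s\<^sup>2 + 4 * C * E * s\<^sup>2"
        by (simp add: algebra_simps power2_eq_square)
      also have "\<dots> \<le> 4 * C * M * s\<^sup>2 + 4 * C * E * 1"
        using s2 C E by (intro add_left_mono mult_left_mono) auto
      finally have "\<bar>W y - W X - p \<bullet> (y - X)\<bar> \<le> 4 * C * (M * s\<^sup>2) + 4 * C * E" by (simp add: mult_ac)
      moreover have "y \<in> cball X (R / 2)" "X \<in> cball X (R / 2)" using y R by auto
      note W(3,4)[OF this(1)] W(3,4)[OF this(2)]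
      ultimately have "\<bar>u y - u X - p \<bullet> (y - X)\<bar> \<le> 4 * C * (M * s\<^sup>2) + (4 * C * E + 2 * E)"
        unfolding E_def by linarith
      also have "\<dots> \<le> C1 * (M * s\<^sup>2) + C1 * (K * R\<^sup>2)"
      proof (intro add_mono mult_right_mono)
        show "4 * C \<le> C1" using C l by (simp add: C1_def)
        have "4 * C * E + 2 * E = (C / (2 * lam) + 1 / (4 * lam)) * (K * R\<^sup>2)"
          using l by (simp add: E_def field_simps)
        also have "\<dots> \<le> C1 * (K * R\<^sup>2)"
        proof (rule mult_right_mono)
          have "C / (2 * lam) \<le> C / lam" "1 / (4 * lam) \<le> 1 / lam" using C l by (auto intro: divide_left_mono)
          then show "C / (2 * lam) + 1 / (4 * lam) \<le> C1" using C by (simp add: C1_def)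
        qed (use K in auto)
        finally show "4 * C * E + 2 * E \<le> C1 * (K * R\<^sup>2)" .
      qed (use M0 in auto)
      finally show "\<bar>u y - u X - p \<bullet> (y - X)\<bar> \<le> C1 * (M * (norm (y - X) / R)\<^sup>2 + K * R\<^sup>2)"
        by (simp add: s_def distrib_left)
    qed
  qed
qed

text \<open>At the scales \<open>\<eta> ^ k * R\<close> the distance of \<open>u\<close> to an
  affine function, divided by the radius, is halved in every step, so the corrections of the slope
  form a convergent geometric series. Subtracting an affine function does not change the Hessian,
  hence both inequalities persist.\<close>

lemma interior_lipschitz_estimate:
  fixes F :: "real^'n^'n \<Rightarrow> real"
  assumes ell: "unif_elliptic F lam Lam" and est: "interior_C2tau_estimates F tau"
  obtains C where "0 < C"
    "\<And>X R u M K y. 0 < R \<Longrightarrow> 0 \<le> K \<Longrightarrow> continuous_on (cball X R) u \<Longrightarrow> visc_sub F (\<lambda>x. 0) (ball X R) u \<Longrightarrow>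
      visc_super F (\<lambda>x. K) (ball X R) u \<Longrightarrow> (\<And>x. x \<in> cball X R \<Longrightarrow> \<bar>u x\<bar> \<le> M) \<Longrightarrow> y \<in> cball X R \<Longrightarrow>
      \<bar>u y - u X\<bar> \<le> C * (M / R + K * R) * norm (y - X)"
proof -
  obtain C where C: "C > 0" and step:
    "\<And>X R u M K. 0 < R \<Longrightarrow> 0 \<le> K \<Longrightarrow> continuous_on (cball X R) u \<Longrightarrow> visc_sub F (\<lambda>x. 0) (ball X R) u \<Longrightarrow>
      visc_super F (\<lambda>x. K) (ball X R) u \<Longrightarrow> (\<And>x. x \<in> cball X R \<Longrightarrow> \<bar>u x\<bar> \<le> M) \<Longrightarrow>
      \<exists>p. norm p \<le> C * (M / R + K * R) \<and>
        (\<forall>y\<in>ball X (R / 4). \<bar>u y - u X - p \<bullet> (y - X)\<bar> \<le> C * (M * (norm (y - X) / R)\<^sup>2 + K * R\<^sup>2))"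
    using affine_approximation_step[OF ell est] by metis
  \<comment> \<open>With \<open>C * \<eta> \<le> 1 / 4\<close> the quadratic remainder at radius
    \<eta> is a quarter of the target scale \<open>\<eta> * (T * (1/2) ^ k * rr k)\<close>; the
    right-hand side contributes at most another quarter, which makes the factor one half.\<close>
  define \<eta> where "\<eta> = 1 / (4 * C + 8)"
  have \<eta>: "0 < \<eta>" "\<eta> \<le> 1 / 8" "C * \<eta> \<le> 1 / 4" "\<eta> \<le> 1 / 2" "\<eta> < 1"
    using C by (auto simp: \<eta>_def field_simps)
  define CL where "CL = (2 * (C + 1) + 1 / \<eta>) * (2 + 4 * C / \<eta>)"
  have CL: "0 < CL" using C \<eta> by (auto simp: CL_def intro!: mult_pos_pos add_pos_pos)
  show thesis
  proof (rule that[OF CL])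
    fix X :: "real^'n" and R u M K y
    assume R: "0 < R" and K: "0 \<le> K" and cu: "continuous_on (cball X R) u"
      and sub: "visc_sub F (\<lambda>x. 0) (ball X R) u"
      and sup: "visc_super F (\<lambda>x. K) (ball X R) u" and M: "\<And>x. x \<in> cball X R \<Longrightarrow> \<bar>u x\<bar> \<le> M"
      and y: "y \<in> cball X R"
    have M0: "0 \<le> M" using M[of X] R by (auto intro: order_trans[OF abs_ge_zero])
    \<comment> \<open>The first summand starts the induction, as the oscillation is at most
      \<open>2 * M\<close>; the second is what \<open>C * (K * R) \<le> \<eta> * T / 4\<close> asks
      for.\<close>
    define T where "T = 2 * M / R + 4 * (C / \<eta>) * (K * R)"
    have T: "0 \<le> T" using M0 R C \<eta> K by (simp add: T_def)
    have KT: "C * (K * R) \<le> \<eta> * T / 4"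
    proof -
      have "\<eta> * T / 4 = \<eta> * (2 * M / R) / 4 + C * (K * R)" using \<eta> by (simp add: T_def field_simps)
      then show ?thesis using M0 R \<eta> by simp
    qed
    define rr where "rr k = \<eta> ^ k * R" for k
    have rr: "0 < rr k" "rr (Suc k) = \<eta> * rr k" "rr k \<le> (1/2) ^ k * R" "rr k \<le> R" for k
    proof -
      show "0 < rr k" "rr (Suc k) = \<eta> * rr k" using \<eta> R by (auto simp: rr_def)
      show "rr k \<le> (1/2) ^ k * R" unfolding rr_def using \<eta> R by (intro mult_right_mono power_mono) auto
      show "rr k \<le> R" unfolding rr_def using \<eta> R by (simp add: power_le_one mult_left_le_one_le)
    qed
    have iter: "\<exists>p. norm p \<le> 2 * (C + 1) * T * (1 - (1/2) ^ k) \<and>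
        (\<forall>y\<in>cball X (rr k). \<bar>u y - u X - p \<bullet> (y - X)\<bar> \<le> T * (1/2) ^ k * rr k)" for k
    proof (induction k)
      case 0
      have "\<bar>u y - u X\<bar> \<le> T * R" if "y \<in> cball X R" for y
      proof -
        have "\<bar>u y - u X\<bar> \<le> 2 * M" using M[OF that] M[of X] R by simp
        also have "\<dots> \<le> T * R" using R C K \<eta> by (simp add: T_def field_simps)
        finally show ?thesis .
      qed
      then show ?case by (intro exI[of _ 0]) (simp add: rr_def)
    next
      case (Suc k)
      then obtain p where p: "norm p \<le> 2 * (C + 1) * T * (1 - (1/2) ^ k)"
        and pe: "\<And>y. y \<in> cball X (rr k) \<Longrightarrow> \<bar>u y - u X - p \<bullet> (y - X)\<bar> \<le> T * (1/2) ^ k * rr k" by blast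
      define v where "v y = u y + ((p \<bullet> X - u X) + (- p) \<bullet> y)" for y
      have v: "v y = u y - u X - p \<bullet> (y - X)" for y by (simp add: v_def inner_diff_right)
      have kr: "cball X (rr k) \<subseteq> cball X R" "ball X (rr k) \<subseteq> ball X R" using rr(4)[of k] by auto
      have "\<exists>q. norm q \<le> C * ((T * (1/2) ^ k * rr k) / rr k + K * rr k) \<and>
        (\<forall>y\<in>ball X (rr k / 4). \<bar>v y - v X - q \<bullet> (y - X)\<bar> \<le> C * ((T * (1/2) ^ k * rr k) * (norm (y - X) / rr k)\<^sup>2 + K * (rr k)\<^sup>2))"
      proof (rule step[OF rr(1) K])
        show "continuous_on (cball X (rr k)) v"
          unfolding v_def by (intro continuous_intros continuous_on_subset[OF cu] kr)
        show "visc_sub F (\<lambda>x. 0) (ball X (rr k)) v" unfolding v_def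
          by (rule visc_sub_add_affine[OF visc_sub_weaken[OF sub _ kr(2)]]) auto
        show "visc_super F (\<lambda>x. K) (ball X (rr k)) v" unfolding v_def
          by (rule visc_super_add_affine[OF visc_super_weaken[OF sup _ kr(2)]]) auto
        show "\<bar>v x\<bar> \<le> T * (1/2) ^ k * rr k" if "x \<in> cball X (rr k)" for x
          unfolding v by (rule pe[OF that])
      qed
      then obtain q where q: "norm q \<le> C * ((T * (1/2) ^ k * rr k) / rr k + K * rr k)"
        and qe: "\<And>y. y \<in> ball X (rr k / 4) \<Longrightarrow>
          \<bar>v y - v X - q \<bullet> (y - X)\<bar> \<le> C * ((T * (1/2) ^ k * rr k) * (norm (y - X) / rr k)\<^sup>2 + K * (rr k)\<^sup>2)" by blast
      have Kr: "C * (K * rr k) \<le> \<eta> / 4 * (T * (1/2) ^ k)"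
      proof -
        have "C * (K * rr k) \<le> C * (K * ((1/2) ^ k * R))"
          using C K rr(3)[of k] by (intro mult_left_mono) auto
        also have "\<dots> = (1/2) ^ k * (C * (K * R))" by simp
        also have "\<dots> \<le> (1/2) ^ k * (\<eta> * T / 4)" by (intro mult_left_mono KT) auto
        finally show ?thesis by (simp add: mult_ac)
      qed
      show ?case
      proof (intro exI[of _ "p + q"] conjI ballI)
        have "norm q \<le> C * (T * (1/2) ^ k) + C * (K * rr k)"
          using q rr(1)[of k] by (simp add: distrib_left)
        also have "\<dots> \<le> C * (T * (1/2) ^ k) + 1 * (T * (1/2) ^ k)"
          using \<eta> T by (intro add_left_mono order_trans[OF Kr] mult_right_mono) auto
        also have "\<dots> = (C + 1) * T * (1/2) ^ k" by (simp add: algebra_simps)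
        finally have "norm (p + q) \<le> 2 * (C + 1) * T * (1 - (1/2) ^ k) + (C + 1) * T * (1/2) ^ k"
          using p norm_triangle_ineq[of p q] by linarith
        also have "\<dots> = 2 * (C + 1) * T * (1 - (1/2) ^ Suc k)" by (simp add: algebra_simps)
        finally show "norm (p + q) \<le> 2 * (C + 1) * T * (1 - (1/2) ^ Suc k)" .
        fix y assume y: "y \<in> cball X (rr (Suc k))"
        have ny: "norm (y - X) \<le> \<eta> * rr k" using y by (simp add: rr(2) dist_norm norm_minus_commute)
        have "\<eta> * rr k \<le> 1 / 8 * rr k" using \<eta> rr(1)[of k] by (intro mult_right_mono) auto
        then have "norm (y - X) < rr k / 4" using ny rr(1)[of k] by linarith
        then have yb: "y \<in> ball X (rr k / 4)" by (simp only: mem_ball dist_norm norm_minus_commute)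
        have "norm (y - X) / rr k \<le> \<eta>" using ny rr(1)[of k] by (simp add: divide_le_eq)
        then have n2: "(norm (y - X) / rr k)\<^sup>2 \<le> \<eta>\<^sup>2" using rr(1)[of k] by (intro power_mono) auto
        have "\<bar>u y - u X - (p + q) \<bullet> (y - X)\<bar> = \<bar>v y - v X - q \<bullet> (y - X)\<bar>"
          by (simp add: v inner_add_left)
        also have "\<dots> \<le> C * ((T * (1/2) ^ k * rr k) * (norm (y - X) / rr k)\<^sup>2 + K * (rr k)\<^sup>2)" by (rule qe[OF yb])
        also have "\<dots> \<le> C * ((T * (1/2) ^ k * rr k) * \<eta>\<^sup>2 + K * (rr k)\<^sup>2)"
          using C T rr(1)[of k] n2 by (intro mult_left_mono add_right_mono) auto
        also have "\<dots> = (C * \<eta>) * (\<eta> * (T * (1/2) ^ k * rr k)) + C * (K * rr k) * rr k"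
          by (simp add: algebra_simps power2_eq_square)
        also have "\<dots> \<le> (1 / 4) * (\<eta> * (T * (1/2) ^ k * rr k)) + \<eta> / 4 * (T * (1/2) ^ k) * rr k"
          using \<eta> T rr(1)[of k] Kr by (intro add_mono mult_right_mono) auto
        also have "\<dots> = T * (1/2) ^ Suc k * rr (Suc k)" by (simp add: rr(2) field_simps)
        finally show "\<bar>u y - u X - (p + q) \<bullet> (y - X)\<bar> \<le> T * (1/2) ^ Suc k * rr (Suc k)" .
      qed
    qed
    have main: "\<bar>u y - u X\<bar> \<le> (2 * (C + 1) + 1 / \<eta>) * T * norm (y - X)"
    proof (cases "y = X")
      case False
      then have ypos: "0 < norm (y - X)" by simp
      have ex: "\<exists>k. rr (Suc k) < norm (y - X)"
      proof -
        obtain k where "\<eta> ^ k < norm (y - X) / R" using real_arch_pow_inv[of "norm (y - X) / R" \<eta>] ypos R \<eta> by auto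
        then have "rr k < norm (y - X)" using R by (simp add: rr_def pos_less_divide_eq)
        moreover have "rr (Suc k) \<le> 1 * rr k" unfolding rr(2) using \<eta> rr(1)[of k] by (intro mult_right_mono) auto
        ultimately show ?thesis by (intro exI[of _ k]) simp
      qed
      \<comment> \<open>The scale adapted to \<open>y\<close>: its distance lies between
        \<open>\<eta> * rr k\<close> and \<open>rr k\<close>, so an error proportional to
        \<open>rr k\<close> is at most a multiple of that distance.\<close>
      define k where "k = (LEAST k. rr (Suc k) < norm (y - X))"
      have k1: "rr (Suc k) < norm (y - X)" unfolding k_def using ex by (rule LeastI_ex)
      have k2: "norm (y - X) \<le> rr k"
      proof (cases k)
        case 0
        then show ?thesis using y by (simp add: rr_def dist_norm norm_minus_commute)
      next
        case (Suc j)
        then have "j < k" by simp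
        then have "\<not> rr (Suc j) < norm (y - X)" unfolding k_def by (rule not_less_Least)
        then show ?thesis using Suc by simp
      qed
      obtain p where p: "norm p \<le> 2 * (C + 1) * T * (1 - (1/2) ^ k)"
        and pe: "\<And>y. y \<in> cball X (rr k) \<Longrightarrow> \<bar>u y - u X - p \<bullet> (y - X)\<bar> \<le> T * (1/2) ^ k * rr k"
        using iter by blast
      have "norm p \<le> 2 * (C + 1) * T * 1" using C T by (intro order_trans[OF p] mult_left_mono) auto
      then have "\<bar>p \<bullet> (y - X)\<bar> \<le> 2 * (C + 1) * T * norm (y - X)"
        by (intro order_trans[OF Cauchy_Schwarz_ineq2] mult_right_mono) auto
      moreover have "\<bar>u y - u X - p \<bullet> (y - X)\<bar> \<le> T * (1/2) ^ k * rr k"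
        using k2 by (intro pe) (simp add: dist_norm norm_minus_commute)
      moreover have "T * (1/2) ^ k * rr k \<le> T * 1 * rr k"
        using T rr(1)[of k] by (intro mult_right_mono mult_left_mono) (auto simp: power_le_one)
      moreover have "T * rr k \<le> T * (norm (y - X) / \<eta>)"
        using T \<eta> k1 by (intro mult_left_mono) (auto simp: rr(2) field_simps)
      ultimately have "\<bar>u y - u X\<bar> \<le> 2 * (C + 1) * T * norm (y - X) + T * (norm (y - X) / \<eta>)"
        by linarith
      then show ?thesis by (simp add: algebra_simps)
    qed simp
    have "T = 2 * (M / R) + (4 * C / \<eta>) * (K * R)" by (simp add: T_def)
    also have "\<dots> \<le> (2 + 4 * C / \<eta>) * (M / R) + (2 + 4 * C / \<eta>) * (K * R)"
      using C \<eta> M0 K R by (intro add_mono mult_right_mono) auto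
    finally have "T \<le> (2 + 4 * C / \<eta>) * (M / R + K * R)" by (simp add: distrib_left)
    then have "(2 * (C + 1) + 1 / \<eta>) * T \<le> (2 * (C + 1) + 1 / \<eta>) * ((2 + 4 * C / \<eta>) * (M / R + K * R))"
      using C \<eta> by (intro mult_left_mono) auto
    also have "\<dots> = CL * (M / R + K * R)" by (simp add: CL_def)
    finally show "\<bar>u y - u X\<bar> \<le> CL * (M / R + K * R) * norm (y - X)"
      using main by (meson mult_right_mono norm_ge_zero order_trans)
  qed
qed

section \<open>Growth from the zero set\<close>

text \<open>Here \<open>s\<close> stands for the squared distance to the centre. The base
  \<open>(s / R\<^sup>2) powr (- p) - 1\<close> is a negative power of the radius normalised to
  vanish on the outer sphere; its linear occurrence supplies the positive slope there. The power
  \<open>1 + gam\<close> is chosen because its second derivative has the singularity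
  \<open>gam - 1\<close> of the right-hand side.\<close>

definition barrier :: "real \<Rightarrow> real \<Rightarrow> real \<Rightarrow> real \<Rightarrow> real \<Rightarrow> real" where
  "barrier gam p K R s = K * (((s / R\<^sup>2) powr (- p) - 1) + ((s / R\<^sup>2) powr (- p) - 1) powr (1 + gam))"

text \<open>With \<open>p \<ge> Lam / lam\<close> the radial second derivative of the negative power
  outweighs the first-order terms. The remaining term comes from the power \<open>1 + gam\<close>
  and is of order \<open>\<psi> powr (gam - 1)\<close>, like the right-hand side, since the barrier
  is at least \<open>K * \<psi>\<close>. The size condition on \<open>K\<close> makes it dominate
  with the factor \<open>1 + gam\<close> to spare.\<close>

lemma barrier_strict_subsolution:
  fixes F :: "real^'n^'n \<Rightarrow> real" and c x :: "real^'n"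
  assumes ell: "unif_elliptic F lam Lam" and F0: "F 0 = 0" and gam: "0 < gam" "gam < 1"
    and p: "0 < p" "Lam \<le> lam * p" and K: "0 < K" "R\<^sup>2 \<le> K powr (2 - gam) * (4 * lam * p\<^sup>2)"
    and x: "0 < dist c x" "dist c x < R"
  shows "\<exists>H. C2_near (\<lambda>x. barrier gam p K R ((x - c) \<bullet> (x - c))) x H \<and>
    gam * barrier gam p K R ((x - c) \<bullet> (x - c)) powr (gam - 1) < F H"
proof -
  have l: "0 < lam" "0 < Lam" using ell by (auto simp: unif_elliptic_def)
  have R: "0 < R" using x by (rule less_trans)
  define \<psi> where "\<psi> s = (s / R\<^sup>2) powr (- p) - 1" for s
  define \<psi>1 where "\<psi>1 s = - (p / R\<^sup>2) * (s / R\<^sup>2) powr (- p - 1)" for s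
  define \<psi>2 where "\<psi>2 s = (p * (p + 1) / (R\<^sup>2)\<^sup>2) * (s / R\<^sup>2) powr (- p - 2)" for s
  define A where "A s = 1 + (1 + gam) * \<psi> s powr gam" for s
  define \<Phi>1 where "\<Phi>1 s = K * (A s * \<psi>1 s)" for s
  define \<Phi>2 where "\<Phi>2 s = K * (A s * \<psi>2 s + (1 + gam) * gam * \<psi> s powr (gam - 1) * (\<psi>1 s)\<^sup>2)" for s
  define S where "S = {0<..<R\<^sup>2}"
  have \<psi>pos: "0 < \<psi> s" if "s \<in> S" for s
  proof -
    have "0 < s / R\<^sup>2" "s / R\<^sup>2 < 1" using that R by (auto simp: S_def)
    then have "1 powr (- p) < (s / R\<^sup>2) powr (- p)" using p by (intro powr_less_mono2_neg) auto
    then show ?thesis by (simp add: \<psi>_def)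
  qed
  have dpow: "((\<lambda>s. (s / R\<^sup>2) powr r) has_real_derivative r * (s / R\<^sup>2) powr (r - 1) * (1 / R\<^sup>2)) (at s)"
    if "s \<in> S" for r s
    using DERIV_fun_powr[OF DERIV_cdivide[OF DERIV_ident], of s "R\<^sup>2" r] that R
    by (simp add: S_def)
  have d\<psi>: "(\<psi> has_real_derivative \<psi>1 s) (at s)" if "s \<in> S" for s
    using DERIV_diff[OF dpow[OF that, of "- p"] DERIV_const[of 1]]
    by (simp add: \<psi>_def[abs_def] \<psi>1_def)
  have d\<psi>1: "(\<psi>1 has_real_derivative \<psi>2 s) (at s)" if "s \<in> S" for s
  proof -
    have "- (p / R\<^sup>2) * ((- p - 1) * P * (1 / R\<^sup>2)) = p * (p + 1) / (R\<^sup>2)\<^sup>2 * P" for P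
      using R by (simp add: field_simps power2_eq_square)
    moreover have "- p - 1 - 1 = - p - 2" by simp
    ultimately show ?thesis
      using DERIV_cmult[OF dpow[OF that, of "- p - 1"], of "- (p / R\<^sup>2)"]
      unfolding \<psi>1_def[abs_def] \<psi>2_def by metis
  qed
  have d\<Phi>: "((\<lambda>s. barrier gam p K R s) has_real_derivative \<Phi>1 s) (at s)" if "s \<in> S" for s
  proof -
    have "((\<lambda>s. K * (\<psi> s + \<psi> s powr (1 + gam))) has_real_derivative
        K * (\<psi>1 s + (1 + gam) * \<psi> s powr (1 + gam - 1) * \<psi>1 s)) (at s)"
      using \<psi>pos[OF that] by (auto intro!: derivative_eq_intros d\<psi>[OF that])
    then show ?thesis by (simp add: barrier_def[abs_def] \<psi>_def[abs_def] \<Phi>1_def A_def algebra_simps)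
  qed
  have d\<Phi>1: "(\<Phi>1 has_real_derivative \<Phi>2 s) (at s)" if "s \<in> S" for s
    unfolding \<Phi>1_def A_def
    by (rule derivative_eq_intros d\<psi>[OF that] d\<psi>1[OF that] refl \<psi>pos[OF that])+
       (simp add: \<Phi>2_def A_def power2_eq_square algebra_simps)
  have c\<psi>: "continuous_on S \<psi>" using d\<psi> by (meson DERIV_isCont continuous_at_imp_continuous_on)
  have c\<psi>1: "continuous_on S \<psi>1" using d\<psi>1 by (meson DERIV_isCont continuous_at_imp_continuous_on)
  have c\<psi>2: "continuous_on S \<psi>2"
    unfolding \<psi>2_def using R by (intro continuous_intros) (auto simp: S_def)
  have c\<Phi>2: "continuous_on S \<Phi>2"
    unfolding \<Phi>2_def A_def using \<psi>pos
    by (intro continuous_intros c\<psi> c\<psi>1 c\<psi>2) (auto simp: less_imp_neq[symmetric])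
  define z where "z = x - c"
  define s where "s = z \<bullet> z"
  have nz: "norm z = dist c x" by (simp add: z_def dist_norm norm_minus_commute)
  have s2: "s = (norm z)\<^sup>2" by (simp add: s_def dot_square_norm)
  have sS: "s \<in> S" using x unfolding S_def s2 nz by (auto intro!: power_strict_mono)
  have sp: "0 < s" "s / R\<^sup>2 < 1" using sS R by (auto simp: S_def)
  define H where "H = (2 * \<Phi>1 s) *\<^sub>R mat 1 + (4 * \<Phi>2 s) *\<^sub>R outer z"
  have C2: "C2_near (\<lambda>x. barrier gam p K R ((x - c) \<bullet> (x - c))) x H"
    unfolding H_def s_def z_def
    by (rule C2_near_radial[where S = S and \<Phi> = "\<lambda>s. barrier gam p K R s" and \<Phi>' = \<Phi>1 and \<Phi>'' = \<Phi>2])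
       (use sS d\<Phi> d\<Phi>1 c\<Phi>2 in \<open>auto simp: s_def z_def S_def\<close>)
  have Apos: "0 < A s" using gam by (simp add: A_def add_pos_nonneg)
  have \<psi>1neg: "\<psi>1 s < 0" using p R sp by (simp add: \<psi>1_def)
  have \<psi>2pos: "0 \<le> \<psi>2 s" using p R sp by (simp add: \<psi>2_def)
  have \<Phi>2pos: "0 \<le> \<Phi>2 s" using K Apos \<psi>2pos gam by (simp add: \<Phi>2_def)
  have \<Phi>1neg: "\<Phi>1 s \<le> 0" using K Apos \<psi>1neg by (simp add: \<Phi>1_def mult_nonneg_nonpos)
  \<comment> \<open>In the radial direction the rank-one term attains its eigenvalue
    \<open>4 * \<Phi>2 s * s\<close>; the identity term has a nonpositive coefficient and is paid
    for with \<open>Lam\<close>.\<close>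
  define e where "e = (1 / norm z) *\<^sub>R z"
  have e: "norm e = 1" using x by (simp add: e_def nz)
  have ez: "(z \<bullet> e)\<^sup>2 = s"
    using x by (simp add: e_def s2 dot_square_norm power2_eq_square nz)
  have "F ((2 * \<Phi>1 s) *\<^sub>R mat 1) + lam * (e \<bullet> (((4 * \<Phi>2 s) *\<^sub>R outer z) *v e)) \<le> F H"
    unfolding H_def
  proof (rule unif_elliptic_strict[OF ell _ _ _ e])
    fix v show "0 \<le> v \<bullet> (((4 * \<Phi>2 s) *\<^sub>R outer z) *v v)"
      using \<Phi>2pos by (simp add: outer_vector inner_commute flip: scaleR_matrix_vector_assoc)
  qed (auto intro: sym_mat_intros sym_mat_outer)
  moreover have "e \<bullet> (((4 * \<Phi>2 s) *\<^sub>R outer z) *v e) = 4 * \<Phi>2 s * s"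
    using ez by (simp add: outer_vector inner_commute power2_eq_square flip: scaleR_matrix_vector_assoc)
  moreover have "F ((2 * \<Phi>1 s) *\<^sub>R mat 1 + (- (2 * \<Phi>1 s)) *\<^sub>R mat 1) \<le> F ((2 * \<Phi>1 s) *\<^sub>R mat 1) + Lam * (- (2 * \<Phi>1 s))"
    by (rule unif_elliptic_upper[OF ell]) (use \<Phi>1neg in \<open>auto intro: sym_mat_intros simp: scaled_id_vector uminus_matrix_vector\<close>)
  ultimately have FH: "lam * (4 * \<Phi>2 s * s) + 2 * Lam * \<Phi>1 s \<le> F H"
    using F0 by simp
  have s\<psi>2: "s * \<psi>2 s = (p + 1) * (- \<psi>1 s)"
  proof -
    have "(s / R\<^sup>2) powr (- p - 1) = (s / R\<^sup>2) powr (- p - 2) * (s / R\<^sup>2)"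
    proof -
      have e: "- p - 2 + 1 = - p - 1" by simp
      show ?thesis using sp R powr_add[of "s / R\<^sup>2" "- p - 2" 1] unfolding e by simp
    qed
    then show ?thesis using R by (simp add: \<psi>2_def \<psi>1_def power2_eq_square)
  qed
  have s\<psi>1: "p\<^sup>2 / R\<^sup>2 \<le> s * (\<psi>1 s)\<^sup>2"
  proof -
    have "1 \<le> (s / R\<^sup>2) powr (- (2 * p + 1))"
      using sp R p powr_mono2'[of "- (2 * p + 1)" "s / R\<^sup>2" 1] by simp
    also have "\<dots> = (s / R\<^sup>2) * ((s / R\<^sup>2) powr (- p - 1) * (s / R\<^sup>2) powr (- p - 1))"
    proof -
      have "(s / R\<^sup>2) powr 1 * ((s / R\<^sup>2) powr (- p - 1) * (s / R\<^sup>2) powr (- p - 1)) = (s / R\<^sup>2) powr (- (2 * p + 1))"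
        unfolding powr_add[symmetric] by (rule arg_cong2[OF refl]) simp
      then show ?thesis using sp R by simp
    qed
    finally have "p\<^sup>2 / R\<^sup>2 * 1 \<le> p\<^sup>2 / R\<^sup>2 * ((s / R\<^sup>2) * ((s / R\<^sup>2) powr (- p - 1) * (s / R\<^sup>2) powr (- p - 1)))"
      by (intro mult_left_mono) auto
    also have "\<dots> = s * (\<psi>1 s)\<^sup>2" by (simp add: \<psi>1_def power2_eq_square)
    finally show ?thesis by simp
  qed
  define B where "B = (1 + gam) * gam * \<psi> s powr (gam - 1)"
  have B: "0 < B" using gam \<psi>pos[OF sS] by (simp add: B_def)
  have "lam * (4 * \<Phi>2 s * s) + 2 * Lam * \<Phi>1 s
      = K * A s * (4 * lam * (s * \<psi>2 s) + 2 * Lam * \<psi>1 s) + 4 * lam * K * B * (s * (\<psi>1 s)\<^sup>2)"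
    by (simp add: \<Phi>1_def \<Phi>2_def B_def algebra_simps)
  also have "4 * lam * (s * \<psi>2 s) + 2 * Lam * \<psi>1 s = (4 * lam * (p + 1) - 2 * Lam) * (- \<psi>1 s)"
    unfolding s\<psi>2 by (simp add: algebra_simps)
  finally have "lam * (4 * \<Phi>2 s * s) + 2 * Lam * \<Phi>1 s
      = K * A s * ((4 * lam * (p + 1) - 2 * Lam) * (- \<psi>1 s)) + 4 * lam * K * B * (s * (\<psi>1 s)\<^sup>2)" .
  moreover have "0 \<le> K * A s * ((4 * lam * (p + 1) - 2 * Lam) * (- \<psi>1 s))"
    using K Apos \<psi>1neg p l by (intro mult_nonneg_nonneg) (auto simp: algebra_simps)
  moreover have "4 * lam * K * B * (p\<^sup>2 / R\<^sup>2) \<le> 4 * lam * K * B * (s * (\<psi>1 s)\<^sup>2)"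
    using l K B by (intro mult_left_mono s\<psi>1) auto
  ultimately have low: "4 * lam * K * B * (p\<^sup>2 / R\<^sup>2) \<le> F H" using FH by linarith
  have "barrier gam p K R s powr (gam - 1) \<le> (K * \<psi> s) powr (gam - 1)"
  proof (rule powr_mono2')
    show "K * \<psi> s \<le> barrier gam p K R s" using K by (simp add: barrier_def \<psi>_def)
  qed (use gam K \<psi>pos[OF sS] in auto)
  then have "gam * barrier gam p K R s powr (gam - 1) \<le> gam * (K * \<psi> s) powr (gam - 1)"
    using gam by (intro mult_left_mono) auto
  also have "\<dots> = (gam * \<psi> s powr (gam - 1)) * K powr (gam - 1)"
    using K \<psi>pos[OF sS] by (simp add: powr_mult)
  also have "\<dots> < (gam * \<psi> s powr (gam - 1)) * (4 * lam * K * (1 + gam) * (p\<^sup>2 / R\<^sup>2))"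
  proof (rule mult_strict_left_mono)
    have "K powr (gam - 1) * R\<^sup>2 \<le> K powr (gam - 1) * (K powr (2 - gam) * (4 * lam * p\<^sup>2))"
      using K by (intro mult_left_mono) auto
    also have "\<dots> = K * (4 * lam * p\<^sup>2)"
    proof -
      have "K powr (gam - 1) * K powr (2 - gam) = K" using K by (simp flip: powr_add)
      then show ?thesis by (simp flip: mult.assoc)
    qed
    also have "\<dots> < (1 + gam) * (K * (4 * lam * p\<^sup>2))" using K l p gam by simp
    finally show "K powr (gam - 1) < 4 * lam * K * (1 + gam) * (p\<^sup>2 / R\<^sup>2)"
      using R by (simp add: field_simps)
    show "0 < gam * \<psi> s powr (gam - 1)" using gam \<psi>pos[OF sS] by simp
  qed
  also have "\<dots> = 4 * lam * K * B * (p\<^sup>2 / R\<^sup>2)" by (simp add: B_def mult_ac)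
  finally show ?thesis using C2 low by (intro exI[of _ H]) (simp add: s_def z_def)
qed

text \<open>The barrier is slid from below by letting its outer radius grow; since the right-hand side
  \<open>gam * u powr (gam - 1)\<close> decreases in \<open>u\<close>, sliding at equal values replaces the comparison
  principle, which fails here.\<close>

lemma barrier_below:
  fixes F :: "real^'n^'n \<Rightarrow> real" and c :: "real^'n"
  assumes ell: "unif_elliptic F lam Lam" and F0: "F 0 = 0" and gam: "0 < gam" "gam < 1"
    and p: "0 < p" "Lam \<le> lam * p" and K: "0 < K" "R1\<^sup>2 \<le> K powr (2 - gam) * (4 * lam * p\<^sup>2)"
    and a: "0 < a" "a < R1"
    and cu: "continuous_on (cball c R1) u" and upos: "\<And>x. x \<in> cball c R1 \<Longrightarrow> 0 < u x"
    and sup: "visc_super F (\<lambda>x. gam * u x powr (gam - 1)) (ball c R1) u"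
    and inner: "\<And>x. dist c x = a \<Longrightarrow> barrier gam p K R1 (a\<^sup>2) < u x"
    and x: "a \<le> dist c x" "dist c x \<le> R1"
  shows "K * (((dist c x)\<^sup>2 / R1\<^sup>2) powr (- p) - 1) \<le> u x"
proof -
  \<comment> \<open>Truncation at zero extends the barrier continuously beyond its outer sphere, so
    that it depends continuously on the radius and the point over a compact product.\<close>
  define m where "m R x = max 0 (((dist c x)\<^sup>2 / R\<^sup>2) powr (- p) - 1)" for R x
  define h where "h R x = K * (m R x + m R x powr (1 + gam))" for R x
  define A where "A = {x. a \<le> dist c x \<and> dist c x \<le> R1}"
  have m0: "0 \<le> m R x" for R x by (simp add: m_def)
  have hm: "K * m R x \<le> h R x" for R x using K by (simp add: h_def)
  have dpos: "0 < dist c x" if "x \<in> A" for x using that a by (auto simp: A_def)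
  have "h R1 x \<le> u x" if xA: "x \<in> A" for x
  proof (rule ccontr)
    assume neg: "\<not> h R1 x \<le> u x"
    have contm: "continuous_on ({a..R1} \<times> A) (\<lambda>z. m (fst z) (snd z))"
      unfolding m_def using a dpos
      by (intro continuous_on_max continuous_intros) (auto dest: dpos)
    have conth: "continuous_on ({a..R1} \<times> A) (\<lambda>z. h (fst z) (snd z))"
      unfolding h_def using gam m0
      by (intro continuous_intros contm continuous_on_powr') auto
    have A_eq: "A = cball c R1 - ball c a" by (auto simp: A_def)
    have Acomp: "compact A" unfolding A_eq by (rule compact_diff) auto
    have "continuous_on A u" by (rule continuous_on_subset[OF cu]) (auto simp: A_def)
    then have contu: "continuous_on ({a..R1} \<times> A) (\<lambda>z. u (snd z))"
      by (rule continuous_on_compose2) (auto intro!: continuous_intros)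
    \<comment> \<open>Pairs of a radius and a point at which the barrier has reached
      \<open>u\<close>. A pair with least radius is the first contact; at radius \<open>a\<close>
      the barrier vanishes on the annulus, so nothing is reached there.\<close>
    define Z where "Z = ({a..R1} \<times> A) \<inter> (\<lambda>z. h (fst z) (snd z) - u (snd z)) -` {0..}"
    have S: "compact ({a..R1} \<times> A)" using Acomp by (intro compact_Times) auto
    have "closed Z" unfolding Z_def
      by (rule continuous_closed_preimage) (use S in \<open>auto intro!: continuous_intros conth contu compact_imp_closed\<close>)
    moreover have "bounded Z" using compact_imp_bounded[OF S] by (rule bounded_subset) (auto simp: Z_def)
    ultimately have "compact Z" by (simp add: compact_eq_bounded_closed)
    moreover have "(R1, x) \<in> Z" using neg xA a by (auto simp: Z_def)
    moreover have "continuous_on Z fst" by (intro continuous_intros)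
    ultimately have "\<exists>z\<in>Z. \<forall>w\<in>Z. fst z \<le> fst w" by (intro continuous_attains_inf) auto
    then obtain z where z: "z \<in> Z" "\<And>w. w \<in> Z \<Longrightarrow> fst z \<le> fst w" by blast
    obtain R y where zRy: "z = (R, y)" by (cases z)
    have R: "a \<le> R" "R \<le> R1" and y: "y \<in> A" and hy: "u y \<le> h R y" using z(1) by (auto simp: Z_def zRy)
    have minR: "R \<le> R'" if "a \<le> R'" "R' \<le> R1" "w \<in> A" "u w \<le> h R' w" for R' w
      using z(2)[of "(R', w)"] that by (auto simp: Z_def zRy)
    have u_A: "0 < u w" if "w \<in> A" for w using that by (intro upos) (auto simp: A_def)
    have ha: "h a w = 0" if "w \<in> A" for w
    proof -
      have "1 \<le> (dist c w)\<^sup>2 / a\<^sup>2" using that a by (auto simp: A_def power_mono)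
      then have "((dist c w)\<^sup>2 / a\<^sup>2) powr (- p) \<le> 1 powr (- p)" using p by (intro powr_mono2') auto
      then show ?thesis by (simp add: h_def m_def)
    qed
    \<comment> \<open>An excess over \<open>u\<close> at the least radius would, by the intermediate
      value theorem in the radius, mean contact at a smaller one.\<close>
    have below: "h R w \<le> u w" if w: "w \<in> A" for w
    proof (rule ccontr)
      assume "\<not> h R w \<le> u w"
      then have gt: "u w < h R w" by simp
      have "continuous_on {a..R} (\<lambda>R. h (fst (R, w)) (snd (R, w)))"
        by (rule continuous_on_compose2[OF conth, where f = "\<lambda>R. (R, w)"]) (use R w in \<open>auto intro!: continuous_intros\<close>)
      then have "\<exists>R'\<ge>a. R' \<le> R \<and> h R' w = u w"
        using ha[OF w] u_A[OF w] gt R by (intro IVT') auto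
      then obtain R' where R': "a \<le> R'" "R' \<le> R" "h R' w = u w" by blast
      then have "R \<le> R'" using R w by (intro minR) auto
      then show False using R' gt by simp
    qed
    have eq: "u y = h R y" using below[OF y] hy by simp
    have mpos: "0 < m R y"
    proof (rule ccontr)
      assume "\<not> 0 < m R y"
      then have "m R y = 0" using m0[of R y] by simp
      then show False using eq u_A[OF y] by (simp add: h_def)
    qed
    have Rpos: "0 < R" using a R by simp
    have h_barrier: "h R w = barrier gam p K R ((w - c) \<bullet> (w - c)) \<and> 0 < m R w" if w: "0 < dist c w" "dist c w < R" for w
    proof -
      have "0 < (dist c w)\<^sup>2 / R\<^sup>2" using w Rpos by simp
      moreover have "(dist c w)\<^sup>2 / R\<^sup>2 < 1" using w Rpos by (simp add: power_strict_mono)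
      ultimately have "1 powr (- p) < ((dist c w)\<^sup>2 / R\<^sup>2) powr (- p)" using p by (intro powr_less_mono2_neg) auto
      then have "m R w = ((dist c w)\<^sup>2 / R\<^sup>2) powr (- p) - 1" "0 < m R w" by (auto simp: m_def)
      moreover have "(w - c) \<bullet> (w - c) = (dist c w)\<^sup>2" by (simp add: dist_norm norm_minus_commute dot_square_norm)
      ultimately show ?thesis by (simp add: h_def barrier_def)
    qed
    have yR: "dist c y < R"
    proof (rule ccontr)
      assume "\<not> dist c y < R"
      then have "1 \<le> (dist c y)\<^sup>2 / R\<^sup>2" using Rpos by (simp add: power_mono)
      then have "((dist c y)\<^sup>2 / R\<^sup>2) powr (- p) \<le> 1 powr (- p)" using p by (intro powr_mono2') auto
      then show False using mpos by (simp add: m_def)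
    qed
    \<comment> \<open>Contact on the inner sphere is impossible: the barrier increases with the
      outer radius, and already the largest one is below \<open>u\<close> there.\<close>
    have ya: "a < dist c y"
    proof (rule ccontr)
      assume "\<not> a < dist c y"
      then have ya: "dist c y = a" using y by (simp add: A_def)
      have "(dist c y)\<^sup>2 / R1\<^sup>2 \<le> (dist c y)\<^sup>2 / R\<^sup>2" using R Rpos a by (intro divide_left_mono power_mono) auto
      then have "((dist c y)\<^sup>2 / R\<^sup>2) powr (- p) \<le> ((dist c y)\<^sup>2 / R1\<^sup>2) powr (- p)"
        using p a ya by (intro powr_mono2') auto
      then have mm: "m R y \<le> m R1 y" by (simp add: m_def)
      then have "m R1 y = ((dist c y)\<^sup>2 / R1\<^sup>2) powr (- p) - 1" using mpos by (auto simp: m_def max_def split: if_splits)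
      then have "h R1 y = barrier gam p K R1 (a\<^sup>2)" by (simp add: h_def barrier_def ya)
      moreover have "h R y \<le> h R1 y"
        unfolding h_def using K mm gam m0 by (intro mult_left_mono add_mono powr_mono2) auto
      ultimately show False using inner[OF ya] eq by simp
    qed
    have "\<exists>H. C2_near (\<lambda>x. barrier gam p K R ((x - c) \<bullet> (x - c))) y H \<and>
        gam * barrier gam p K R ((y - c) \<bullet> (y - c)) powr (gam - 1) < F H"
    proof (rule barrier_strict_subsolution[OF ell F0 gam p K(1)])
      have "R\<^sup>2 \<le> R1\<^sup>2" using R Rpos by (intro power_mono) auto
      then show "R\<^sup>2 \<le> K powr (2 - gam) * (4 * lam * p\<^sup>2)" using K by simp
    qed (use ya yR a in auto)
    then obtain H where H: "C2_near (\<lambda>x. barrier gam p K R ((x - c) \<bullet> (x - c))) y H"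
      and lt: "gam * barrier gam p K R ((y - c) \<bullet> (y - c)) powr (gam - 1) < F H" by blast
    define q where "q = min (dist c y - a) (R - dist c y)"
    have hb: "h R y = barrier gam p K R ((y - c) \<bullet> (y - c))"
      using h_barrier[OF less_trans[OF a(1) ya] yR] by blast
    have "F H \<le> gam * u y powr (gam - 1)"
    proof (rule visc_superD[OF sup _ H])
      show "y \<in> ball c R1" using yR R by simp
      show "0 < q" using ya yR by (simp add: q_def)
      fix w assume "w \<in> ball y q"
      then have w: "dist c y - dist y w > a" "dist c y + dist y w < R" by (auto simp: q_def)
      then have wa: "a < dist c w" and wR: "dist c w < R"
        using dist_triangle[of c w y] dist_triangle[of c y w] by (auto simp: dist_commute)
      then have "w \<in> A" using R by (simp add: A_def)
      then show "u y - barrier gam p K R ((y - c) \<bullet> (y - c)) \<le> u w - barrier gam p K R ((w - c) \<bullet> (w - c))"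
        using below[of w] h_barrier[OF less_trans[OF a(1) wa] wR] hb eq by simp
    qed
    then show False using lt eq hb by simp
  qed
  moreover have "x \<in> A" using x by (simp add: A_def)
  ultimately have "K * m R1 x \<le> u x" using hm order_trans by blast
  moreover have "K * (((dist c x)\<^sup>2 / R1\<^sup>2) powr (- p) - 1) \<le> K * m R1 x"
    using K by (intro mult_left_mono) (auto simp: m_def)
  ultimately show ?thesis by simp
qed

text \<open>Both summands are bounded by the square of \<open>(R\<^sup>2 / s) powr p\<close>,
  because this base is at least 1 and \<open>1 + gam \<le> 2\<close>.\<close>

lemma barrier_le:
  assumes "0 \<le> K" "0 < s" "0 < R" "s \<le> R\<^sup>2" "0 < gam" "gam < 1" "0 < p"
  shows "barrier gam p K R s \<le> 2 * K * (R\<^sup>2 / s) powr (2 * p)"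
proof -
  define A where "A = (R\<^sup>2 / s) powr p"
  have A1: "1 \<le> A" using assms unfolding A_def by (intro ge_one_powr_ge_zero) auto
  have inv: "(s / R\<^sup>2) powr (- p) = A"
    using assms by (simp add: A_def powr_minus powr_divide field_simps)
  have A2: "A powr 2 = (R\<^sup>2 / s) powr (2 * p)" by (simp add: A_def powr_powr mult.commute)
  have "A powr 1 \<le> A powr 2" using A1 by (intro powr_mono) auto
  then have "A - 1 \<le> A powr 2" using A1 by simp
  moreover have "(A - 1) powr (1 + gam) \<le> A powr (1 + gam)" using A1 assms by (intro powr_mono2) auto
  moreover have "A powr (1 + gam) \<le> A powr 2" using A1 assms by (intro powr_mono) auto
  ultimately have "(A - 1) + (A - 1) powr (1 + gam) \<le> 2 * A powr 2" by linarith
  then have "K * ((A - 1) + (A - 1) powr (1 + gam)) \<le> K * (2 * A powr 2)" using assms by (intro mult_left_mono) auto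
  then show ?thesis by (simp add: barrier_def inv A2)
qed

section \<open>One-sided Harnack inequality and growth away from zeros\<close>

definition singular_sol ::
    "(real^'n^'n \<Rightarrow> real) \<Rightarrow> real \<Rightarrow> (real^'n) set \<Rightarrow> (real^'n \<Rightarrow> real) \<Rightarrow> bool" where
  "singular_sol F gam U u \<longleftrightarrow> (\<forall>x\<in>U. 0 < u x) \<and> visc_sub F (\<lambda>x. 0) U u \<and>
     visc_super F (\<lambda>x. gam * u x powr (gam - 1)) U u"

lemma singular_sol_subset:
  assumes "singular_sol F gam U u" "open V" "V \<subseteq> U"
  shows "singular_sol F gam V u"
  using assms unfolding singular_sol_def by (auto intro: visc_sub_weaken visc_super_weaken)

lemma singular_sol_continuous: "singular_sol F gam U u \<Longrightarrow> continuous_on U u"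
  by (simp add: singular_sol_def visc_sub_def)

lemma nearest_point_attained:
  fixes g :: "'a::heine_borel \<Rightarrow> real"
  assumes "continuous_on (cball X t) g" "closed T" "y \<in> cball X t" "g y \<in> T"
  obtains z where "z \<in> cball X t" "g z \<in> T" "\<And>w. w \<in> cball X t \<Longrightarrow> g w \<in> T \<Longrightarrow> dist X z \<le> dist X w"
proof -
  define Z where "Z = cball X t \<inter> g -` T"
  have "closed Z" unfolding Z_def using assms by (intro continuous_closed_preimage) auto
  moreover have "bounded Z" using bounded_cball by (rule bounded_subset) (auto simp: Z_def)
  ultimately have "compact Z" by (simp add: compact_eq_bounded_closed)
  moreover have "y \<in> Z" using assms by (simp add: Z_def)
  ultimately have "\<exists>z\<in>Z. \<forall>w\<in>Z. dist X z \<le> dist X w"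
    by (intro continuous_attains_inf continuous_intros) auto
  then show thesis using that by (auto simp: Z_def)
qed

text \<open>A one-sided Harnack inequality. It is run on the largest ball around \<open>X\<close> where \<open>u\<close> exceeds
  a small multiple of \<open>u X\<close>: the right-hand side is bounded there, while the barrier only needs
  positivity and may leave that ball.\<close>

lemma harnack_lower:
  fixes F :: "real^'n^'n \<Rightarrow> real"
  assumes ell: "unif_elliptic F lam Lam" and F0: "F 0 = 0" and gam: "0 < gam" "gam < 1"
    and est: "interior_C2tau_estimates F tau"
  obtains c \<kappa> where "0 < c" "c < 1" "0 < \<kappa>"
    "\<And>X R u y. 0 < R \<Longrightarrow> singular_sol F gam (ball X R) u \<Longrightarrow> R\<^sup>2 \<le> \<kappa> * u X powr (2 - gam) \<Longrightarrow>
      y \<in> cball X (R / 8) \<Longrightarrow> c * u X \<le> u y"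
proof -
  have l: "0 < lam" "0 < Lam" using ell by (auto simp: unif_elliptic_def)
  obtain CL where CL: "CL > 0" and lip:
    "\<And>X R u M K y. 0 < R \<Longrightarrow> 0 \<le> K \<Longrightarrow> continuous_on (cball X R) u \<Longrightarrow> visc_sub F (\<lambda>x. 0) (ball X R) u \<Longrightarrow>
      visc_super F (\<lambda>x. K) (ball X R) u \<Longrightarrow> (\<And>x. x \<in> cball X R \<Longrightarrow> \<bar>u x\<bar> \<le> M) \<Longrightarrow> y \<in> cball X R \<Longrightarrow>
      \<bar>u y - u X\<bar> \<le> CL * (M / R + K * R) * norm (y - X)"
    using interior_lipschitz_estimate[OF ell est] by metis
  define p where "p = max 1 (Lam / lam)"
  have p: "1 \<le> p" "0 < p" "Lam \<le> lam * p" using l by (auto simp: p_def max_def field_simps)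
  \<comment> \<open>The barrier on its inner sphere is bounded by the ratio of radii to the power
    \<open>4 * p\<close>. A weight with the same exponent lets
    \<open>\<rho> powr q * m \<le> d powr q * m1\<close> cancel this factor.\<close>
  define q where "q = 4 * p"
  have q: "0 < q" using p by (simp add: q_def)
  define Q where "Q = CL * (2 * 2 powr q + 1)"
  have Q: "0 < Q" using CL by (simp add: Q_def add_pos_pos)
  define s where "s = 1 / (2 * Q + 2)"
  have s: "0 < s" "s \<le> 1 / 2" "Q * s \<le> 1 / 2" using Q by (auto simp: s_def field_simps)
  \<comment> \<open>Chosen so that the barrier with constant \<open>2 * c * m\<close> and radii
    \<open>s * d\<close> and \<open>3 * \<rho>\<close> is at most \<open>m1 / 4\<close> on the inner
    sphere, where \<open>u \<ge> m1 / 2\<close>.\<close>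
  define c where "c = (s / 3) powr q / 16"
  have c: "0 < c" "c < 1 / 2"
  proof -
    have "(s / 3) powr q \<le> 1 powr q" using s q by (intro powr_mono2) auto
    then show "c < 1 / 2" by (simp add: c_def)
    show "0 < c" using s by (simp add: c_def)
  qed
  \<comment> \<open>The first entry gives \<open>K * d\<^sup>2 \<le> m1\<close> for the bound
    \<open>K\<close> of the right-hand side where \<open>u \<ge> c * m\<close>; the second is the
    size condition of the barrier.\<close>
  define \<kappa> where "\<kappa> = min (c powr (1 - gam)) ((2 * c) powr (2 - gam) * (4 * lam * p\<^sup>2))"
  have \<kappa>: "0 < \<kappa>" using c l p by (simp add: \<kappa>_def)
  show thesis
  proof (rule that[of c \<kappa>])
    fix X :: "real^'n" and R u y
    assume R: "0 < R" and sol: "singular_sol F gam (ball X R) u"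
      and small: "R\<^sup>2 \<le> \<kappa> * u X powr (2 - gam)" and y: "y \<in> cball X (R / 8)"
    have upos: "\<And>x. x \<in> ball X R \<Longrightarrow> 0 < u x" and sub: "visc_sub F (\<lambda>x. 0) (ball X R) u"
      and sup: "visc_super F (\<lambda>x. gam * u x powr (gam - 1)) (ball X R) u"
      using sol by (auto simp: singular_sol_def)
    have cu: "continuous_on (ball X R) u" by (rule singular_sol_continuous[OF sol])
    define m where "m = u X"
    have m: "0 < m" using upos R by (simp add: m_def)
    show "c * u X \<le> u y"
    proof (rule ccontr)
      assume "\<not> c * u X \<le> u y"
      then have yl: "u y < c * m" by (simp add: m_def)
      have cu8: "continuous_on (cball X (R / 8)) u" using R by (intro continuous_on_subset[OF cu]) auto
      obtain z where z: "z \<in> cball X (R / 8)" "u z \<in> {..c * m}"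
        "\<And>w. w \<in> cball X (R / 8) \<Longrightarrow> u w \<in> {..c * m} \<Longrightarrow> dist X z \<le> dist X w"
        using nearest_point_attained[OF cu8 closed_atMost y, of "c * m"] yl by (metis atMost_iff less_imp_le)
      define \<rho> where "\<rho> = dist X z"
      have uz: "u z \<le> c * m" and \<rho>8: "\<rho> \<le> R / 8" using z(1,2) by (auto simp: \<rho>_def)
      have \<rho>: "0 < \<rho>"
      proof (rule ccontr)
        assume "\<not> 0 < \<rho>"
        then have "z = X" by (simp add: \<rho>_def)
        then show False using uz c m by (simp add: m_def)
      qed
      have above: "c * m \<le> u w" if "w \<in> ball X \<rho>" for w
      proof (rule ccontr)
        assume "\<not> c * m \<le> u w"
        then show False using z(3)[of w] that \<rho>8 by (simp add: \<rho>_def)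
      qed
      have cu\<rho>: "continuous_on (cball X \<rho>) u" using R \<rho>8 by (intro continuous_on_subset[OF cu]) auto
      \<comment> \<open>The weight vanishes on the sphere, so the maximum is interior, at distance
        \<open>d\<close> from it. On the ball of radius \<open>d / 2\<close> around the maximum
        point the weight drops at most by \<open>2 powr q\<close>, which yields
        \<open>u \<le> 2 powr q * m1\<close> there without an upper Harnack inequality.\<close>
      define g where "g x = (\<rho> - dist X x) powr q * u x" for x
      have "continuous_on (cball X \<rho>) g"
        unfolding g_def using q by (intro continuous_intros continuous_on_powr' cu\<rho>) auto
      then obtain x1 where x1: "x1 \<in> cball X \<rho>" and gmax: "\<And>x. x \<in> cball X \<rho> \<Longrightarrow> g x \<le> g x1"
        using continuous_attains_sup[of "cball X \<rho>" g] \<rho> by auto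
      define d where "d = \<rho> - dist X x1"
      define m1 where "m1 = u x1"
      have gX: "\<rho> powr q * m \<le> d powr q * m1" using gmax[of X] \<rho> by (simp add: g_def d_def m1_def m_def)
      have m1: "0 < m1" using x1 \<rho>8 R unfolding m1_def by (intro upos) auto
      have d: "0 < d"
      proof (rule ccontr)
        assume "\<not> 0 < d"
        then have "d = 0" using x1 by (simp add: d_def)
        then show False using gX \<rho> m by (simp add: mult_le_0_iff)
      qed
      have d\<rho>: "d \<le> \<rho>" by (simp add: d_def)
      have mm1: "m \<le> m1"
      proof -
        have "d powr q * m \<le> \<rho> powr q * m" using d d\<rho> q m by (intro mult_right_mono powr_mono2) auto
        then have "d powr q * m \<le> d powr q * m1" using gX by simp
        then show ?thesis using d by simp
      qed
      have inb: "w \<in> ball X \<rho>" "d / 2 \<le> \<rho> - dist X w" if "w \<in> cball x1 (d / 2)" for w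
        using that d dist_triangle[of X w x1] by (auto simp: d_def)
      define K where "K = gam * (c * m) powr (gam - 1)"
      have K: "0 \<le> K" using gam by (simp add: K_def)
      have subB: "cball x1 (d / 2) \<subseteq> ball X R" using inb(1) \<rho>8 R by fastforce
      have near: "m1 / 2 \<le> u w" if w: "w \<in> cball x1 (s * d)" for w
      proof -
        have w2: "w \<in> cball x1 (d / 2)" using w mult_right_mono[OF s(2) less_imp_le[OF d]] by auto
        have "\<bar>u w - u x1\<bar> \<le> CL * ((2 powr q * m1) / (d / 2) + K * (d / 2)) * norm (w - x1)"
        proof (rule lip[OF _ K _ _ _ _ w2])
          show "0 < d / 2" using d by simp
          show "continuous_on (cball x1 (d / 2)) u" by (rule continuous_on_subset[OF cu subB])
          show "visc_sub F (\<lambda>x. 0) (ball x1 (d / 2)) u"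
            using subB by (intro visc_sub_weaken[OF sub]) auto
          show "visc_super F (\<lambda>x. K) (ball x1 (d / 2)) u"
          proof (rule visc_super_weaken[OF sup])
            fix x assume "x \<in> ball x1 (d / 2)"
            then have "c * m \<le> u x" using inb(1)[of x] above by auto
            then show "gam * u x powr (gam - 1) \<le> K"
              unfolding K_def using gam c m by (intro mult_left_mono powr_mono2') auto
          qed (use subB in auto)
          fix x assume x: "x \<in> cball x1 (d / 2)"
          have xb: "x \<in> ball X \<rho>" by (rule inb(1)[OF x])
          then have ux: "0 < u x" using \<rho>8 R by (intro upos) auto
          have "(d / 2) powr q * u x \<le> g x"
            unfolding g_def using inb(2)[OF x] d q ux by (intro mult_right_mono powr_mono2) auto
          also have "\<dots> \<le> d powr q * m1" using gmax[of x] xb by (auto simp: g_def d_def m1_def)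
          finally have "u x \<le> 2 powr q * m1" using d by (simp add: powr_divide field_simps)
          then show "\<bar>u x\<bar> \<le> 2 powr q * m1" using ux by simp
        qed
        also have "\<dots> \<le> CL * ((2 * 2 powr q + 1) * (m1 / d)) * norm (w - x1)"
        proof (intro mult_right_mono mult_left_mono)
          have "K * d\<^sup>2 \<le> m1"
          proof -
            have "d\<^sup>2 \<le> R\<^sup>2" using d d\<rho> \<rho>8 R by (intro power_mono) auto
            also have "\<dots> \<le> \<kappa> * m powr (2 - gam)" using small by (simp add: m_def)
            also have "\<dots> \<le> c powr (1 - gam) * m powr (2 - gam)" by (intro mult_right_mono) (auto simp: \<kappa>_def)
            finally have "K * d\<^sup>2 \<le> K * (c powr (1 - gam) * m powr (2 - gam))" using K by (intro mult_left_mono)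
            also have "\<dots> = gam * m"
            proof -
              have "c powr (gam - 1) * c powr (1 - gam) = 1" using c by (simp flip: powr_add)
              moreover have "m powr (gam - 1) * m powr (2 - gam) = m" using m by (simp flip: powr_add)
              moreover have "K * (c powr (1 - gam) * m powr (2 - gam)) =
                  gam * (c powr (gam - 1) * c powr (1 - gam)) * (m powr (gam - 1) * m powr (2 - gam))"
                using c m by (simp add: K_def powr_mult mult_ac)
              ultimately show ?thesis by simp
            qed
            also have "\<dots> \<le> m" using gam m by simp
            finally show ?thesis using mm1 by simp
          qed
          then have "K * d \<le> m1 / d" using d by (simp add: field_simps power2_eq_square)
          moreover have "0 < m1 / d" using m1 d by simp
          moreover have "2 powr q * m1 / (d / 2) = 2 * 2 powr q * (m1 / d)" by simp
          moreover have "0 \<le> K * d" using K d by simp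
          ultimately show "2 powr q * m1 / (d / 2) + K * (d / 2) \<le> (2 * 2 powr q + 1) * (m1 / d)"
            unfolding distrib_right by linarith
        qed (use CL in auto)
        also have "\<dots> = Q * (m1 / d) * norm (w - x1)" by (simp add: Q_def)
        also have "\<dots> \<le> Q * (m1 / d) * (s * d)"
          using w Q m1 d by (intro mult_left_mono) (auto simp: dist_norm norm_minus_commute)
        also have "\<dots> = (Q * s) * m1" using d by simp
        also have "\<dots> \<le> 1 / 2 * m1" using s m1 by (intro mult_right_mono) auto
        finally show ?thesis unfolding m1_def abs_le_iff by simp
      qed
      have big: "cball x1 (3 * \<rho>) \<subseteq> ball X R"
      proof
        fix w assume "w \<in> cball x1 (3 * \<rho>)"
        then show "w \<in> ball X R" using dist_triangle[of X w x1] x1 \<rho>8 \<rho> R by auto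
      qed
      have zx1: "dist x1 z \<le> 2 * \<rho>" using dist_triangle[of x1 z X] x1 by (simp add: \<rho>_def dist_commute)
      show False
      proof (cases "dist x1 z \<le> s * d")
        case True
        then have "m1 / 2 \<le> u z" by (intro near) simp
        moreover have "c * m < m / 2" using c m by simp
        ultimately show False using uz mm1 by simp
      next
        case False
        \<comment> \<open>The point \<open>z\<close> is within \<open>2 * \<rho>\<close> of
          \<open>x1\<close>. An outer radius of \<open>3 * \<rho>\<close> gives a squared ratio of
          at most 4/9, hence a profile of at least 1 at \<open>z\<close>, and the constant
          \<open>2 * c * m\<close> then exceeds \<open>u z\<close>.\<close>
        have "2 * c * m * (((dist x1 z)\<^sup>2 / (3 * \<rho>)\<^sup>2) powr (- p) - 1) \<le> u z"
        proof (rule barrier_below[OF ell F0 gam p(2,3)])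
          show "0 < 2 * c * m" using c m by simp
          have "(3 * \<rho>)\<^sup>2 \<le> R\<^sup>2" using \<rho> \<rho>8 by (intro power_mono) auto
          also have "\<dots> \<le> \<kappa> * m powr (2 - gam)" using small by (simp add: m_def)
          also have "\<dots> \<le> (2 * c) powr (2 - gam) * (4 * lam * p\<^sup>2) * m powr (2 - gam)"
            by (intro mult_right_mono) (auto simp: \<kappa>_def)
          finally show "(3 * \<rho>)\<^sup>2 \<le> (2 * c * m) powr (2 - gam) * (4 * lam * p\<^sup>2)"
            using c m by (simp add: powr_mult mult_ac)
          show "0 < s * d" using s d by simp
          have sd: "s * d \<le> 1 / 2 * \<rho>" using s d d\<rho> by (intro mult_mono) auto
          then show sd3: "s * d < 3 * \<rho>" using \<rho> by simp
          show "continuous_on (cball x1 (3 * \<rho>)) u" by (rule continuous_on_subset[OF cu big])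
          show "0 < u x" if "x \<in> cball x1 (3 * \<rho>)" for x using that big by (intro upos) auto
          show "visc_super F (\<lambda>x. gam * u x powr (gam - 1)) (ball x1 (3 * \<rho>)) u"
            using big by (intro visc_super_weaken[OF sup]) auto
          show "s * d \<le> dist x1 z" "dist x1 z \<le> 3 * \<rho>" using False zx1 \<rho> by auto
          fix x assume "dist x1 x = s * d"
          then have ux: "m1 / 2 \<le> u x" by (intro near) simp
          have "barrier gam p (2 * c * m) (3 * \<rho>) ((s * d)\<^sup>2) \<le> 2 * (2 * c * m) * ((3 * \<rho>)\<^sup>2 / (s * d)\<^sup>2) powr (2 * p)"
            using c m s d \<rho> sd3 gam p by (intro barrier_le power_mono) auto
          also have "((3 * \<rho>)\<^sup>2 / (s * d)\<^sup>2) powr (2 * p) = (3 / s * (\<rho> / d)) powr q"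
          proof -
            have "(3 * \<rho>)\<^sup>2 / (s * d)\<^sup>2 = (3 / s * (\<rho> / d)) powr 2"
              using s d \<rho> by (simp add: power_divide power_mult_distrib)
            then show ?thesis by (simp add: powr_powr q_def)
          qed
          also have "\<dots> = (3 / s) powr q * (\<rho> powr q / d powr q)"
            using s d \<rho> by (simp only: powr_mult powr_divide)
          also have "2 * (2 * c * m) * \<dots> = (4 * c * (3 / s) powr q) * (\<rho> powr q * m / d powr q)" by simp
          also have "4 * c * (3 / s) powr q = 1 / 4"
          proof -
            have "(s / 3) powr q * (3 / s) powr q = (s / 3 * (3 / s)) powr q" by (simp only: powr_mult)
            also have "\<dots> = 1" using s by simp
            finally show ?thesis by (simp add: c_def)
          qed
          also have "\<rho> powr q * m / d powr q \<le> m1" using gX d by (simp add: pos_divide_le_eq mult.commute)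
          finally show "barrier gam p (2 * c * m) (3 * \<rho>) ((s * d)\<^sup>2) < u x"
            using ux m1 by simp
        qed
        moreover have "1 \<le> ((dist x1 z)\<^sup>2 / (3 * \<rho>)\<^sup>2) powr (- p) - 1"
        proof -
          have dz: "0 < dist x1 z" using False s d by (meson le_less_trans mult_pos_pos not_le less_imp_le)
          have "(dist x1 z)\<^sup>2 \<le> (2 * \<rho>)\<^sup>2" using zx1 by (intro power_mono) auto
          then have r: "(dist x1 z)\<^sup>2 / (3 * \<rho>)\<^sup>2 \<le> 4 / 9" using \<rho> by (simp add: field_simps power2_eq_square)
          have "2 \<le> (4 / 9) powr (- 1 :: real)" by (simp add: powr_minus)
          also have "\<dots> \<le> (4 / 9) powr (- p)" using p by (intro powr_mono') auto
          also have "\<dots> \<le> ((dist x1 z)\<^sup>2 / (3 * \<rho>)\<^sup>2) powr (- p)"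
            using r dz \<rho> p by (intro powr_mono2') auto
          finally show ?thesis by simp
        qed
        then have "2 * c * m * 1 \<le> 2 * c * m * (((dist x1 z)\<^sup>2 / (3 * \<rho>)\<^sup>2) powr (- p) - 1)"
          using c m by (intro mult_left_mono) auto
        moreover have "0 < c * m" using c m by simp
        ultimately show False using uz by linarith
      qed
    qed
  qed (use c \<kappa> in auto)
qed

text \<open>A zero of a nonnegative function is a minimum, so the derivative in direction
  \<open>v\<close> vanishes, which excludes growth at the positive rate \<open>k\<close>.\<close>

lemma nondifferentiable_linear_growth:
  fixes u :: "real^'n \<Rightarrow> real"
  assumes der: "(u has_derivative (\<lambda>h. D \<bullet> h)) (at Y)" and zero: "u Y = 0"
    and nonneg: "0 < r" "\<And>x. x \<in> ball Y r \<Longrightarrow> 0 \<le> u x" and k: "0 < k"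
    and growth: "\<And>t. 0 < t \<Longrightarrow> t < 1 / 2 \<Longrightarrow> k * t \<le> u (Y + t *\<^sub>R v)"
  shows False
proof -
  have d: "((\<lambda>t. u (Y + t *\<^sub>R v)) has_real_derivative D \<bullet> v) (at 0)"
    using der by (intro DERIV_along_line) simp
  define \<delta> where "\<delta> = r / (norm v + 1)"
  have \<delta>: "0 < \<delta>" using nonneg by (simp add: \<delta>_def add_nonneg_pos)
  have "0 \<le> u (Y + t *\<^sub>R v)" if "\<bar>t\<bar> < \<delta>" for t
  proof (rule nonneg(2))
    have "\<bar>t\<bar> * norm v \<le> \<bar>t\<bar> * (norm v + 1)" by (intro mult_left_mono) auto
    also have "\<dots> < \<delta> * (norm v + 1)" using that by (intro mult_strict_right_mono) (auto simp: add_nonneg_pos)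
    also have "\<dots> = r" by (simp add: \<delta>_def add_nonneg_pos less_imp_neq[symmetric])
    finally show "Y + t *\<^sub>R v \<in> ball Y r" by (simp add: dist_norm)
  qed
  then have "D \<bullet> v = 0"
    by (intro DERIV_local_min[OF d \<delta>]) (auto simp: zero)
  then have "((\<lambda>t. (u (Y + t *\<^sub>R v) - 0) / t) \<longlongrightarrow> 0) (at 0)"
    using d by (simp add: has_field_derivative_iff zero)
  then have "\<forall>\<^sub>F t in at 0. dist (u (Y + t *\<^sub>R v) / t) 0 < k"
    using k by (auto dest: tendstoD)
  then obtain \<epsilon> where \<epsilon>: "0 < \<epsilon>" "\<And>t. t \<noteq> 0 \<Longrightarrow> dist t 0 < \<epsilon> \<Longrightarrow> dist (u (Y + t *\<^sub>R v) / t) 0 < k"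
    unfolding eventually_at by blast
  define t where "t = min \<epsilon> (1 / 2) / 2"
  have t: "0 < t" "t < \<epsilon>" "t < 1 / 2" using \<epsilon> by (auto simp: t_def)
  have "u (Y + t *\<^sub>R v) / t < k" using \<epsilon>(2)[of t] t unfolding dist_real_def abs_less_iff by simp
  then show False using growth[of t] t by (simp add: pos_divide_less_eq)
qed

text \<open>Harnack's inequality fills the ball of radius \<open>d / 8\<close> around
  \<open>y\<close>, and the barrier carries the bound across the annulus towards \<open>Y\<close>.
  Positivity is known only in the open ball, so outer radii stay below \<open>d\<close> and the
  linear growth is obtained separately at each point of the segment.\<close>

lemma free_boundary_growth:
  fixes F :: "real^'n^'n \<Rightarrow> real"
  assumes ell: "unif_elliptic F lam Lam" and F0: "F 0 = 0" and gam: "0 < gam" "gam < 1"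
    and est: "interior_C2tau_estimates F tau"
  obtains \<kappa> where "0 < \<kappa>"
    "\<And>y d u Y r D. 0 < d \<Longrightarrow> singular_sol F gam (ball y d) u \<Longrightarrow> dist y Y = d \<Longrightarrow> u Y = 0 \<Longrightarrow>
      0 < r \<Longrightarrow> (\<And>x. x \<in> ball Y r \<Longrightarrow> 0 \<le> u x) \<Longrightarrow> (u has_derivative (\<lambda>h. D \<bullet> h)) (at Y) \<Longrightarrow>
      \<kappa> * u y powr (2 - gam) \<le> d\<^sup>2"
proof -
  have l: "0 < lam" "0 < Lam" using ell by (auto simp: unif_elliptic_def)
  obtain c \<kappa> where c: "0 < c" "c < 1" and \<kappa>: "0 < \<kappa>" and harnack:
    "\<And>X R u y. 0 < R \<Longrightarrow> singular_sol F gam (ball X R) u \<Longrightarrow> R\<^sup>2 \<le> \<kappa> * u X powr (2 - gam) \<Longrightarrow>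
      y \<in> cball X (R / 8) \<Longrightarrow> c * u X \<le> u y"
    using harnack_lower[OF ell F0 gam est] by metis
  define p where "p = max 1 (Lam / lam)"
  have p: "1 \<le> p" "0 < p" "Lam \<le> lam * p" using l by (auto simp: p_def max_def field_simps)
  \<comment> \<open>The squared ratio of the outer radius to \<open>d / 8\<close> is at most 64, so
    the barrier with constant \<open>b * m\<close> is at most \<open>c * m / 2\<close> on the inner
    sphere.\<close>
  define b where "b = c / (4 * 64 powr (2 * p))"
  have b: "0 < b" using c by (simp add: b_def)
  define \<kappa>' where "\<kappa>' = min \<kappa> (b powr (2 - gam) * (4 * lam * p\<^sup>2))"
  have \<kappa>': "0 < \<kappa>'" using \<kappa> b l p by (simp add: \<kappa>'_def)
  show thesis
  proof (rule that[OF \<kappa>'])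
    fix y :: "real^'n" and d u Y r D
    assume d: "0 < d" and sol: "singular_sol F gam (ball y d) u" and Y: "dist y Y = d" "u Y = 0"
      and r: "0 < r" "\<And>x. x \<in> ball Y r \<Longrightarrow> 0 \<le> u x" and der: "(u has_derivative (\<lambda>h. D \<bullet> h)) (at Y)"
    have upos: "\<And>x. x \<in> ball y d \<Longrightarrow> 0 < u x"
      and sup: "visc_super F (\<lambda>x. gam * u x powr (gam - 1)) (ball y d) u"
      using sol by (auto simp: singular_sol_def)
    have cu: "continuous_on (ball y d) u" by (rule singular_sol_continuous[OF sol])
    define m where "m = u y"
    have m: "0 < m" using upos d by (simp add: m_def)
    show "\<kappa>' * u y powr (2 - gam) \<le> d\<^sup>2"
    proof (rule ccontr)
      assume "\<not> \<kappa>' * u y powr (2 - gam) \<le> d\<^sup>2"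
      then have lt: "d\<^sup>2 \<le> \<kappa>' * m powr (2 - gam)" by (simp add: m_def)
      also have "\<dots> \<le> \<kappa> * m powr (2 - gam)" by (intro mult_right_mono) (auto simp: \<kappa>'_def)
      finally have low: "c * m \<le> u x" if "x \<in> cball y (d / 8)" for x
        using harnack[OF d sol _ that] by (simp add: m_def)
      have bound: "b * m * (((dist y x)\<^sup>2 / R1\<^sup>2) powr (- p) - 1) \<le> u x"
        if R1: "d / 8 < R1" "R1 < d" and x: "d / 8 \<le> dist y x" "dist y x \<le> R1" for R1 x
      proof (rule barrier_below[OF ell F0 gam p(2,3)])
        show "0 < b * m" using b m by simp
        have "R1\<^sup>2 \<le> d\<^sup>2" using R1 d by (intro power_mono) auto
        also have "\<dots> \<le> (b powr (2 - gam) * (4 * lam * p\<^sup>2)) * m powr (2 - gam)"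
          by (rule order_trans[OF lt]) (intro mult_right_mono; auto simp: \<kappa>'_def)
        finally show "R1\<^sup>2 \<le> (b * m) powr (2 - gam) * (4 * lam * p\<^sup>2)"
          using b m by (simp add: powr_mult mult_ac)
        show "0 < d / 8" "d / 8 < R1" "d / 8 \<le> dist y x" "dist y x \<le> R1" using d R1 x by auto
        have sub: "cball y R1 \<subseteq> ball y d" using R1 by auto
        show "continuous_on (cball y R1) u" by (rule continuous_on_subset[OF cu sub])
        show "0 < u x" if "x \<in> cball y R1" for x using that sub by (intro upos) auto
        show "visc_super F (\<lambda>x. gam * u x powr (gam - 1)) (ball y R1) u"
          using sub by (intro visc_super_weaken[OF sup]) auto
        fix w assume "dist y w = d / 8"
        then have "c * m \<le> u w" by (intro low) simp
        have "barrier gam p (b * m) R1 ((d / 8)\<^sup>2) \<le> 2 * (b * m) * (R1\<^sup>2 / (d / 8)\<^sup>2) powr (2 * p)"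
          using b m d R1 gam p by (intro barrier_le power_mono) auto
        also have "\<dots> \<le> 2 * (b * m) * 64 powr (2 * p)"
        proof (intro mult_left_mono powr_mono2)
          show "R1\<^sup>2 / (d / 8)\<^sup>2 \<le> 64" using \<open>R1\<^sup>2 \<le> d\<^sup>2\<close> d by (simp add: power_divide field_simps)
        qed (use b m p in auto)
        also have "\<dots> = c * m / 2" by (simp add: b_def)
        also have "\<dots> < c * m" using c m by simp
        finally show "barrier gam p (b * m) R1 ((d / 8)\<^sup>2) < u w" using \<open>c * m \<le> u w\<close> by simp
      qed
      show False
      proof (rule nondifferentiable_linear_growth[OF der Y(2) r, of "b * m / 2" "y - Y"])
        show "0 < b * m / 2" using b m by simp
        fix t :: real assume t: "0 < t" "t < 1 / 2"
        define x where "x = Y + t *\<^sub>R (y - Y)"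
        have "y - x = (1 - t) *\<^sub>R (y - Y)" by (simp add: x_def algebra_simps)
        then have dx: "dist y x = (1 - t) * d" using t Y by (simp add: dist_norm)
        \<comment> \<open>Slightly larger than the distance from \<open>y\<close> to
          \<open>x\<close>, by the factor \<open>1 + t / 2\<close>, and still below
          \<open>d\<close>; the profile at \<open>x\<close> is then at least \<open>t / 2\<close>,
          the required linear rate.\<close>
        define R1 where "R1 = (1 + t / 2) * ((1 - t) * d)"
        have R1a: "R1 < d"
        proof -
          have "(1 + t / 2) * (1 - t) < 1" using t by (simp add: algebra_simps) (simp add: add_pos_pos)
          then have "(1 + t / 2) * (1 - t) * d < 1 * d" using d by (intro mult_strict_right_mono)
          then show ?thesis by (simp add: R1_def mult_ac)
        qed
        have "1 / 2 * d \<le> (1 - t) * d" using t d by (intro mult_right_mono) auto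
        then have dx8: "d / 8 \<le> dist y x" "0 < dist y x" using d by (auto simp: dx)
        have R1x: "R1 = (1 + t / 2) * dist y x" by (simp add: R1_def dx)
        have "1 * dist y x < (1 + t / 2) * dist y x" using t dx8 by (intro mult_strict_right_mono) auto
        then have R1b: "dist y x < R1" by (simp add: R1x)
        have "b * m * (((dist y x)\<^sup>2 / R1\<^sup>2) powr (- p) - 1) \<le> u x"
          by (rule bound) (use R1a R1b dx8 in auto)
        moreover have "t / 2 \<le> ((dist y x)\<^sup>2 / R1\<^sup>2) powr (- p) - 1"
        proof -
          have t2: "1 \<le> (1 + t / 2)\<^sup>2" "1 + t / 2 \<le> (1 + t / 2)\<^sup>2" using t by (auto simp: power2_eq_square algebra_simps)
          have "((dist y x)\<^sup>2 / R1\<^sup>2) powr (- p) = ((1 + t / 2)\<^sup>2) powr p"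
            using dx8 t by (simp add: R1x power_mult_distrib powr_minus powr_divide)
          also have "\<dots> \<ge> ((1 + t / 2)\<^sup>2) powr 1" using t2 p by (intro powr_mono) auto
          finally show ?thesis using t2 by simp
        qed
        then have "b * m * (t / 2) \<le> b * m * (((dist y x)\<^sup>2 / R1\<^sup>2) powr (- p) - 1)"
          using b m by (intro mult_left_mono) auto
        ultimately show "b * m / 2 * t \<le> u (Y + t *\<^sub>R (y - Y))" by (simp add: x_def)
      qed
    qed
  qed
qed

text \<open>Extracting the root of order \<open>2 - gam\<close> turns \<open>r\<^sup>2\<close> into
  \<open>r powr alpha_of gam\<close>, since \<open>alpha_of gam = 2 / (2 - gam)\<close>. This
  converts the scale conditions into growth bounds.\<close>

lemma le_powr_root:
  fixes x :: real
  assumes "0 \<le> x" "0 < k" "0 < r" "0 < gam" "gam < 1" "0 \<le> L" "k * x powr (2 - gam) \<le> L * r\<^sup>2"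
  shows "x \<le> (L / k) powr (1 / (2 - gam)) * r powr alpha_of gam"
proof -
  have al: "alpha_of gam = 2 * (1 / (2 - gam))" using assms by (simp add: alpha_of_def field_simps)
  have "x powr (2 - gam) \<le> L / k * r\<^sup>2" using assms by (simp add: field_simps)
  then have "(x powr (2 - gam)) powr (1 / (2 - gam)) \<le> (L / k * r\<^sup>2) powr (1 / (2 - gam))"
    using assms by (intro powr_mono2) auto
  moreover have "(x powr (2 - gam)) powr (1 / (2 - gam)) = x" using assms by (simp add: powr_powr)
  moreover have "r\<^sup>2 = r powr 2" using assms by simp
  then have "(L / k * r\<^sup>2) powr (1 / (2 - gam)) = (L / k) powr (1 / (2 - gam)) * r powr alpha_of gam"
    using assms by (simp only: powr_mult powr_powr al)
  ultimately show ?thesis by simp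
qed

text \<open>Free boundary growth needs a ball without zeros and a zero on its sphere; the given zero
  is therefore replaced by one nearest to \<open>y\<close>.\<close>

lemma growth_from_zero:
  fixes F :: "real^'n^'n \<Rightarrow> real"
  assumes ell: "unif_elliptic F lam Lam" and F0: "F 0 = 0" and gam: "0 < gam" "gam < 1"
    and est: "interior_C2tau_estimates F tau"
  obtains \<kappa> where "0 < \<kappa>"
    "\<And>Omega u Du y t Y. open Omega \<Longrightarrow> (\<And>x. x \<in> Omega \<Longrightarrow> 0 \<le> u x) \<Longrightarrow>
      (\<And>x. x \<in> Omega \<Longrightarrow> (u has_derivative (\<lambda>h. Du x \<bullet> h)) (at x)) \<Longrightarrow>
      singular_sol F gam {x \<in> Omega. 0 < u x} u \<Longrightarrow> cball y t \<subseteq> Omega \<Longrightarrow> Y \<in> cball y t \<Longrightarrow> u Y = 0 \<Longrightarrow>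
      \<kappa> * u y powr (2 - gam) \<le> t\<^sup>2"
proof -
  obtain \<kappa> where \<kappa>: "0 < \<kappa>" and growth:
    "\<And>y d u Y r D. 0 < d \<Longrightarrow> singular_sol F gam (ball y d) u \<Longrightarrow> dist y Y = d \<Longrightarrow> u Y = 0 \<Longrightarrow>
      0 < r \<Longrightarrow> (\<And>x. x \<in> ball Y r \<Longrightarrow> 0 \<le> u x) \<Longrightarrow> (u has_derivative (\<lambda>h. D \<bullet> h)) (at Y) \<Longrightarrow>
      \<kappa> * u y powr (2 - gam) \<le> d\<^sup>2"
    using free_boundary_growth[OF ell F0 gam est] by metis
  show thesis
  proof (rule that[OF \<kappa>])
    fix Omega u Du and y :: "real^'n" and t Y
    assume Om: "open Omega" and nn: "\<And>x. x \<in> Omega \<Longrightarrow> 0 \<le> u x"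
      and der: "\<And>x. x \<in> Omega \<Longrightarrow> (u has_derivative (\<lambda>h. Du x \<bullet> h)) (at x)"
      and sol: "singular_sol F gam {x \<in> Omega. 0 < u x} u"
      and sub: "cball y t \<subseteq> Omega" and Y: "Y \<in> cball y t" "u Y = 0"
    have t0: "0 \<le> t" using Y(1) zero_le_dist[of y Y] by (simp del: zero_le_dist)
    show "\<kappa> * u y powr (2 - gam) \<le> t\<^sup>2"
    proof (cases "u y = 0")
      case False
      then have uy: "0 < u y" using nn[of y] sub t0 by force
      have cu: "continuous_on (cball y t) u"
        using der sub by (meson continuous_at_imp_continuous_on has_derivative_continuous subsetD)
      obtain z where z: "z \<in> cball y t" "u z \<in> {0}"
        "\<And>w. w \<in> cball y t \<Longrightarrow> u w \<in> {0} \<Longrightarrow> dist y z \<le> dist y w"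
        using nearest_point_attained[OF cu closed_singleton Y(1), of 0] Y(2) by (metis singletonI)
      have uz: "u z = 0" and zt: "dist y z \<le> t" using z(1,2) by auto
      have "y \<noteq> z" using uz uy by auto
      then have d: "0 < dist y z" by simp
      have P: "ball y (dist y z) \<subseteq> {x \<in> Omega. 0 < u x}"
      proof
        fix w assume w: "w \<in> ball y (dist y z)"
        then have "w \<in> cball y t" using zt by auto
        then have "w \<in> Omega" "u w \<noteq> 0" using sub z(3)[of w] w by auto
        then show "w \<in> {x \<in> Omega. 0 < u x}" using nn[of w] by simp
      qed
      have zO: "z \<in> Omega" using zt sub by auto
      then obtain r where r: "0 < r" "ball z r \<subseteq> Omega" using Om openE by blast
      have nnz: "\<And>x. x \<in> ball z r \<Longrightarrow> 0 \<le> u x" using r(2) nn by blast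
      have "\<kappa> * u y powr (2 - gam) \<le> (dist y z)\<^sup>2"
        by (rule growth[OF d singular_sol_subset[OF sol open_ball P] refl uz r(1) nnz der[OF zO]])
      also have "\<dots> \<le> t\<^sup>2" using zt by (intro power_mono) auto
      finally show ?thesis .
    qed simp
  qed
qed

text \<open>Three regimes, by the distance \<open>D\<close> of \<open>X\<close> to its nearest zero
  and the intrinsic length \<open>R\<close> of order \<open>u X powr (1 - gam / 2)\<close>. If
  \<open>D \<le> 16 * r\<close>, growth from the zero bounds \<open>u y\<close> directly. If
  \<open>y\<close> is within \<open>R / 16\<close> of \<open>X\<close>, the Lipschitz estimate at
  scale \<open>R\<close> has slope of order \<open>u X powr (gam / 2)\<close>. Otherwise
  \<open>R \<le> 16 * r\<close>, and everything is of order
  \<open>r powr alpha_of gam\<close>.\<close>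

lemma growth_upper_estimate:
  fixes F :: "real^'n^'n \<Rightarrow> real"
  assumes ell: "unif_elliptic F lam Lam" and F0: "F 0 = 0" and gam: "0 < gam" "gam < 1"
    and est: "interior_C2tau_estimates F tau"
  obtains C where "0 < C"
    "\<And>Omega u Du X r Y y. open Omega \<Longrightarrow> (\<And>x. x \<in> Omega \<Longrightarrow> 0 \<le> u x) \<Longrightarrow>
      (\<And>x. x \<in> Omega \<Longrightarrow> (u has_derivative (\<lambda>h. Du x \<bullet> h)) (at x)) \<Longrightarrow>
      singular_sol F gam {x \<in> Omega. 0 < u x} u \<Longrightarrow> 0 < r \<Longrightarrow> ball X (dist X Y + 2 * r) \<subseteq> Omega \<Longrightarrow>
      u Y = 0 \<Longrightarrow> y \<in> ball X r \<Longrightarrow>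
      u y \<le> u X + C * u X powr (gam / 2) * r + C * r powr alpha_of gam"
proof (rule growth_from_zero[OF ell F0 gam est])
  fix \<kappa>' :: real
  assume \<kappa>': "0 < \<kappa>'" and growth:
    "\<And>Omega u Du y t Y. open Omega \<Longrightarrow> (\<And>x. x \<in> Omega \<Longrightarrow> 0 \<le> u x) \<Longrightarrow>
      (\<And>x. x \<in> Omega \<Longrightarrow> (u has_derivative (\<lambda>h. Du x \<bullet> h)) (at x)) \<Longrightarrow>
      singular_sol F gam {x \<in> Omega. 0 < u x} u \<Longrightarrow> cball y t \<subseteq> Omega \<Longrightarrow> Y \<in> cball y t \<Longrightarrow> u Y = 0 \<Longrightarrow>
      \<kappa>' * u y powr (2 - gam) \<le> t\<^sup>2"
  obtain c \<kappa> where c: "0 < c" "c < 1" and \<kappa>: "0 < \<kappa>" and harnack: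
    "\<And>X R u y. 0 < R \<Longrightarrow> singular_sol F gam (ball X R) u \<Longrightarrow> R\<^sup>2 \<le> \<kappa> * u X powr (2 - gam) \<Longrightarrow>
      y \<in> cball X (R / 8) \<Longrightarrow> c * u X \<le> u y"
    using harnack_lower[OF ell F0 gam est] by metis
  obtain CL where CL: "CL > 0" and lip:
    "\<And>X R u M K y. 0 < R \<Longrightarrow> 0 \<le> K \<Longrightarrow> continuous_on (cball X R) u \<Longrightarrow> visc_sub F (\<lambda>x. 0) (ball X R) u \<Longrightarrow>
      visc_super F (\<lambda>x. K) (ball X R) u \<Longrightarrow> (\<And>x. x \<in> cball X R \<Longrightarrow> \<bar>u x\<bar> \<le> M) \<Longrightarrow> y \<in> cball X R \<Longrightarrow>
      \<bar>u y - u X\<bar> \<le> CL * (M / R + K * R) * norm (y - X)"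
    using interior_lipschitz_estimate[OF ell est] by metis
  define k where "k = min \<kappa> \<kappa>'"
  have k: "0 < k" "k \<le> \<kappa>" "k \<le> \<kappa>'" using \<kappa> \<kappa>' by (auto simp: k_def)
  define \<beta> where "\<beta> = 1 / (2 - gam)"
  define C1 where "C1 = (289 / \<kappa>') powr \<beta>"
  define C2 where "C2 = (256 / k) powr \<beta> / c"
  define C3 where "C3 = (64 / \<kappa>) powr \<beta>"
  define C4 where "C4 = CL * (16 / (c * sqrt k) + gam * c powr (gam - 1) * sqrt k / 16)"
  define C where "C = C1 + C2 + C3 + C4"
  have C0: "0 < C1" "0 < C2" "0 < C3" "0 < C4"
    using \<kappa> \<kappa>' k c CL gam by (auto simp: C1_def C2_def C3_def C4_def intro!: mult_pos_pos add_pos_pos)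
  have C: "0 < C" "C1 \<le> C" "C2 \<le> C" "C3 \<le> C" "C4 \<le> C" using C0 by (auto simp: C_def)
  show thesis
  proof (rule that[OF C(1)])
    fix Omega u Du and X :: "real^'n" and r Y y
    assume Om: "open Omega" and nn: "\<And>x. x \<in> Omega \<Longrightarrow> 0 \<le> u x"
      and der: "\<And>x. x \<in> Omega \<Longrightarrow> (u has_derivative (\<lambda>h. Du x \<bullet> h)) (at x)"
      and sol: "singular_sol F gam {x \<in> Omega. 0 < u x} u"
      and r: "0 < r" and sub0: "ball X (dist X Y + 2 * r) \<subseteq> Omega" and Y: "u Y = 0"
      and y: "y \<in> ball X r"
    define D0 where "D0 = dist X Y"
    have cu: "continuous_on Omega u"
      using der by (meson continuous_at_imp_continuous_on has_derivative_continuous)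
    have cb: "cball X D0 \<subseteq> Omega" using sub0 r by (force simp: D0_def)
    have "Y \<in> cball X D0" by (simp add: D0_def)
    then obtain z where z: "z \<in> cball X D0" "u z \<in> {0}"
      "\<And>w. w \<in> cball X D0 \<Longrightarrow> u w \<in> {0} \<Longrightarrow> dist X z \<le> dist X w"
      using nearest_point_attained[OF continuous_on_subset[OF cu cb] closed_singleton, of Y 0] Y by (metis singletonI)
    define D where "D = dist X z"
    have uz: "u z = 0" and DD: "D \<le> D0" using z(1,2) by (auto simp: D_def)
    have sub: "ball X (D + 2 * r) \<subseteq> Omega" using sub0 DD by (force simp: D0_def)
    have P: "ball X D \<subseteq> {x \<in> Omega. 0 < u x}"
    proof
      fix w assume w: "w \<in> ball X D"
      then have "w \<in> cball X D0" using DD by auto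
      then have "w \<in> Omega" "u w \<noteq> 0" using cb z(3)[of w] w by (auto simp: D_def)
      then show "w \<in> {x \<in> Omega. 0 < u x}" using nn[of w] by simp
    qed
    have Dnn: "0 \<le> D" by (simp add: D_def)
    have yO: "y \<in> Omega" by (rule subsetD[OF sub]) (use y r Dnn in simp)
    have XO: "X \<in> Omega" by (rule subsetD[OF sub]) (use r Dnn in simp)
    have uy0: "0 \<le> u y" and uX0: "0 \<le> u X" using nn yO XO by auto
    have Cr: "u y \<le> u X + C * u X powr (gam / 2) * r + C * r powr alpha_of gam"
      if "u y \<le> C' * r powr alpha_of gam" "C' \<le> C" for C'
    proof -
      have "C' * r powr alpha_of gam \<le> C * r powr alpha_of gam" using that by (intro mult_right_mono) auto
      moreover have "0 \<le> C * u X powr (gam / 2) * r" using C r by simp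
      ultimately show ?thesis using that uX0 by linarith
    qed
    show "u y \<le> u X + C * u X powr (gam / 2) * r + C * r powr alpha_of gam"
    proof (cases "D \<le> 16 * r")
      case True
      \<comment> \<open>The smallest radius for which the triangle inequality guarantees that the
        ball about \<open>y\<close> contains the zero \<open>z\<close>. This ball stays within
        \<open>D + 2 * r\<close> of \<open>X\<close>, the reason for \<open>2 * r\<close> in the
        hypothesis on \<open>Omega\<close>.\<close>
      define t where "t = D + dist X y"
      have t: "t \<le> 17 * r" using True y by (simp add: t_def)
      have t0: "0 \<le> t" by (simp add: t_def D_def)
      have "cball y t \<subseteq> Omega"
      proof
        fix w assume "w \<in> cball y t"
        then have "dist X w < D + 2 * r" using dist_triangle[of X w y] y by (simp add: t_def)
        then show "w \<in> Omega" using sub by auto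
      qed
      moreover have "z \<in> cball y t" using dist_triangle[of y z X] by (simp add: t_def D_def dist_commute)
      ultimately have "\<kappa>' * u y powr (2 - gam) \<le> t\<^sup>2" using growth[OF Om nn der sol _ _ uz] by blast
      also have "\<dots> \<le> (17 * r)\<^sup>2" using t t0 by (intro power_mono) auto
      finally have "\<kappa>' * u y powr (2 - gam) \<le> 289 * r\<^sup>2" by (simp add: power_mult_distrib)
      then have "u y \<le> C1 * r powr alpha_of gam"
        unfolding C1_def \<beta>_def using uy0 \<kappa>' r gam by (intro le_powr_root) auto
      then show ?thesis by (rule Cr) (rule C)
    next
      case False
      then have Dr: "16 * r < D" by simp
      then have D: "0 < D" using r by simp
      define m where "m = u X"
      have m: "0 < m" using subsetD[OF P, of X] D by (simp add: m_def)
      \<comment> \<open>Then \<open>R\<^sup>2 = k * m powr (2 - gam)\<close>: Harnack's inequality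
        applies at this scale because \<open>k \<le> \<kappa>\<close>, and
        \<open>k \<le> \<kappa>'\<close> with growth from the zero gives
        \<open>R \<le> D\<close>.\<close>
      define R where "R = sqrt k * m powr (1 - gam / 2)"
      have R: "0 < R" using k m by (simp add: R_def)
      have R2: "R\<^sup>2 = k * m powr (2 - gam)"
      proof -
        have "(m powr (1 - gam / 2))\<^sup>2 = m powr (2 - gam)" by (simp add: power2_eq_square flip: powr_add)
        then show ?thesis using k by (simp add: R_def power_mult_distrib)
      qed
      have "\<kappa>' * m powr (2 - gam) \<le> D\<^sup>2" unfolding m_def
        by (rule growth[OF Om nn der sol _ _ uz]) (use cb DD in \<open>auto simp: D_def\<close>)
      moreover have "k * m powr (2 - gam) \<le> \<kappa>' * m powr (2 - gam)" using k by (intro mult_right_mono) auto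
      ultimately have "R\<^sup>2 \<le> D\<^sup>2" by (simp add: R2)
      then have RD: "R \<le> D" using less_imp_le[OF D] by (rule power2_le_imp_le)
      have solD: "singular_sol F gam (ball X D) u" by (rule singular_sol_subset[OF sol open_ball P])
      \<comment> \<open>The one-sided inequality is used with exchanged roles, centred at
        \<open>w\<close> and evaluated at \<open>X\<close>; this is how it yields an upper
        bound.\<close>
      have up: "u w \<le> m / c"
        if w: "0 < q" "q \<le> D - dist X w" "q\<^sup>2 \<le> \<kappa> * u w powr (2 - gam)" "dist X w \<le> q / 8" for w q
      proof -
        have "ball w q \<subseteq> ball X D"
        proof
          fix v assume "v \<in> ball w q"
          then show "v \<in> ball X D" using dist_triangle[of X v w] w by auto
        qed
        then have "c * u w \<le> u X"
          using w by (intro harnack[OF w(1) singular_sol_subset[OF solD open_ball]]) (auto simp: dist_commute)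
        then show ?thesis using c by (simp add: m_def pos_le_divide_eq mult.commute)
      qed
      show ?thesis
      proof (cases "dist X y \<le> R / 16")
        case True
        have sR: "singular_sol F gam (ball X R) u"
          using RD by (intro singular_sol_subset[OF solD open_ball]) auto
        have low: "c * m \<le> u w" if "w \<in> cball X (R / 8)" for w
          unfolding m_def
        proof (rule harnack[OF R sR _ that])
          show "R\<^sup>2 \<le> \<kappa> * u X powr (2 - gam)" unfolding R2 m_def using k by (intro mult_right_mono) auto
        qed
        have high: "u w \<le> m / c" if w: "w \<in> cball X (R / 16)" for w
        proof (cases "u w \<le> m")
          case True
          also have "m \<le> m / c" using c m by (simp add: pos_le_divide_eq)
          finally show ?thesis .
        next
          case False
          show ?thesis
          proof (rule up[of "R / 2"])
            have "(R / 2)\<^sup>2 \<le> R\<^sup>2" using R by (intro power_mono) auto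
            also have "\<dots> \<le> \<kappa> * u w powr (2 - gam)"
              unfolding R2 using k m gam False by (intro mult_mono powr_mono2) auto
            finally show "(R / 2)\<^sup>2 \<le> \<kappa> * u w powr (2 - gam)" .
          qed (use R RD w in auto)
        qed
        define K where "K = gam * (c * m) powr (gam - 1)"
        \<comment> \<open>On \<open>cball X (R / 16)\<close> the function lies between
          \<open>c * m\<close> and \<open>m / c\<close>, so the right-hand side is bounded; both
          \<open>m / R\<close> and \<open>K * R\<close> are constant multiples of
          \<open>m powr (gam / 2)\<close>.\<close>
        have "\<bar>u y - u X\<bar> \<le> CL * ((m / c) / (R / 16) + K * (R / 16)) * norm (y - X)"
        proof (rule lip)
          have s16: "cball X (R / 16) \<subseteq> ball X R" "ball X (R / 16) \<subseteq> ball X R" using R by auto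
          show "0 < R / 16" "0 \<le> K" using R gam by (auto simp: K_def)
          show "continuous_on (cball X (R / 16)) u"
            by (rule continuous_on_subset[OF singular_sol_continuous[OF sR] s16(1)])
          show "visc_sub F (\<lambda>x. 0) (ball X (R / 16)) u"
            using sR s16(2) unfolding singular_sol_def by (auto intro: visc_sub_weaken)
          show "visc_super F (\<lambda>x. K) (ball X (R / 16)) u"
          proof (rule visc_super_weaken[OF _ _ s16(2)])
            show "visc_super F (\<lambda>x. gam * u x powr (gam - 1)) (ball X R) u"
              using sR by (simp add: singular_sol_def)
            fix x assume "x \<in> ball X (R / 16)"
            then have "c * m \<le> u x" using zero_le_dist[of X x] by (intro low) (simp del: zero_le_dist)
            then show "gam * u x powr (gam - 1) \<le> K"
              unfolding K_def using gam c m by (intro mult_left_mono powr_mono2') auto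
          qed auto
          show "\<bar>u x\<bar> \<le> m / c" if x: "x \<in> cball X (R / 16)" for x
          proof -
            have "c * m \<le> u x" using x zero_le_dist[of X x] by (intro low) (simp del: zero_le_dist)
            moreover have "0 < c * m" using c m by simp
            ultimately show ?thesis using high[OF x] by simp
          qed
          show "y \<in> cball X (R / 16)" using True by simp
        qed
        also have "CL * ((m / c) / (R / 16) + K * (R / 16)) = C4 * m powr (gam / 2)"
        proof -
          have e1: "m / m powr (1 - gam / 2) = m powr (gam / 2)"
            using m powr_diff[of m 1 "1 - gam / 2"] by simp
          have e2: "m powr (gam - 1) * m powr (1 - gam / 2) = m powr (gam / 2)"
            unfolding powr_add[symmetric] by simp
          have "(m / c) / (R / 16) = 16 / (c * sqrt k) * (m / m powr (1 - gam / 2))"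
            by (simp add: R_def mult_ac)
          moreover have "K * (R / 16) = gam * c powr (gam - 1) * sqrt k / 16 * (m powr (gam - 1) * m powr (1 - gam / 2))"
            using c m by (simp add: K_def R_def powr_mult mult_ac)
          ultimately show ?thesis unfolding e1 e2 C4_def by (simp add: algebra_simps)
        qed
        finally have "u y \<le> u X + C4 * m powr (gam / 2) * norm (y - X)" by (simp add: abs_le_iff)
        moreover have "C4 * m powr (gam / 2) * norm (y - X) \<le> C * m powr (gam / 2) * r"
          using C C0 y by (intro mult_mono mult_right_mono) (auto simp: dist_norm norm_minus_commute)
        moreover have "0 \<le> C * r powr alpha_of gam" using C by simp
        ultimately show ?thesis unfolding m_def by linarith
      next
        case False
        then have Rr: "R \<le> 16 * r" using y by simp
        show ?thesis
        \<comment> \<open>Either Harnack's inequality centred at \<open>y\<close> with radius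
          \<open>8 * r\<close> is available and compares \<open>u y\<close> with \<open>m\<close>,
          or the failure of its size condition itself bounds \<open>u y\<close>.\<close>
        proof (cases "(8 * r)\<^sup>2 \<le> \<kappa> * u y powr (2 - gam)")
          case True
          have uy: "u y \<le> m / c" by (rule up[OF _ _ True]) (use r y Dr in auto)
          have "k * m powr (2 - gam) \<le> (16 * r)\<^sup>2" unfolding R2[symmetric] using R Rr by (intro power_mono) auto
          then have "m \<le> (256 / k) powr (1 / (2 - gam)) * r powr alpha_of gam"
            using m k r gam by (intro le_powr_root) (auto simp: power_mult_distrib)
          then have "m / c \<le> (256 / k) powr (1 / (2 - gam)) * r powr alpha_of gam / c"
            using c by (intro divide_right_mono) auto
          then have "u y \<le> C2 * r powr alpha_of gam" using uy by (simp add: C2_def \<beta>_def)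
          then show ?thesis by (rule Cr) (rule C)
        next
          case False
          then have "\<kappa> * u y powr (2 - gam) \<le> 64 * r\<^sup>2" by (simp add: power_mult_distrib)
          then have "u y \<le> C3 * r powr alpha_of gam"
            unfolding C3_def \<beta>_def using uy0 \<kappa> r gam by (intro le_powr_root) auto
          then show ?thesis by (rule Cr) (rule C)
        qed
      qed
    qed
  qed
qed

section \<open>Minimal solutions\<close>

context
  fixes rho :: "real \<Rightarrow> real" and sig0 gam :: real
  assumes rho_smooth: "smooth_fun rho" and rho_nonneg: "\<forall>t. rho t \<ge> 0"
    and rho_supp: "\<forall>t. t \<notin> {0..1} \<longrightarrow> rho t = 0" and rho_int: "integral {0..1} rho = 1"
    and sig0: "0 < sig0" and gam: "0 < gam" "gam < 1"
begin

lemma rho_continuous: "continuous_on UNIV rho"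
proof -
  have "rho differentiable (at x)" for x
    using rho_smooth unfolding smooth_fun_def by (metis funpow_0)
  then show ?thesis by (meson continuous_at_imp_continuous_on differentiable_imp_continuous_within)
qed

lemma rho_integrable: "rho integrable_on {a..b}"
  by (rule integrable_continuous_real[OF continuous_on_subset[OF rho_continuous]]) auto

text \<open>A negative upper limit gives an empty interval with integral 0, and \<open>rho\<close>
  vanishes beyond 1. Clipping reduces continuity and bounds on the whole line to the unit
  interval.\<close>

lemma rho_integral_clip: "integral {0..T} rho = integral {0..min (max 0 T) 1} rho"
proof (cases "T \<le> 0")
  case True
  then have "T < 0 \<or> T = 0" by auto
  then show ?thesis by auto
next
  case False
  show ?thesis
  proof (cases "T \<le> 1")
    case False
    have "(rho has_integral 1) {0..1}"
      using rho_integrable[of 0 1] rho_int by (simp add: has_integral_integrable_integral)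
    then have "(rho has_integral 1) {0..T}"
      by (rule has_integral_on_superset) (use False rho_supp in auto)
    then show ?thesis using False rho_int by (simp add: integral_unique)
  qed (use False in simp)
qed

lemma rho_integral_bounds: "0 \<le> integral {0..T} rho" "integral {0..T} rho \<le> 1"
proof -
  show "0 \<le> integral {0..T} rho"
    using rho_nonneg by (intro integral_nonneg rho_integrable) auto
  have "integral {0..min (max 0 T) 1} rho \<le> integral {0..1} rho"
    using rho_nonneg by (intro integral_subset_le rho_integrable) auto
  then show "integral {0..T} rho \<le> 1" using rho_integral_clip[of T] rho_int by simp
qed

lemma rho_integral_continuous: "continuous_on UNIV (\<lambda>T. integral {0..T} rho)"
proof -
  have "continuous_on {0..1} (\<lambda>x. integral {0..x} rho)"
    by (rule indefinite_integral_continuous_1[OF rho_integrable])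
  then have "continuous_on UNIV (\<lambda>T. integral {0..min (max 0 T) 1} rho)"
    by (rule continuous_on_compose2) (auto intro!: continuous_intros)
  then show ?thesis using rho_integral_clip by simp
qed

context
  fixes eps :: real
  assumes eps: "0 < eps"
begin

lemma beta_eps_zero:
  assumes "t \<le> sig0 * eps powr alpha_of gam"
  shows "beta_eps rho sig0 gam eps t = 0"
proof -
  let ?T = "(t - sig0 * eps powr alpha_of gam) / eps powr alpha_of gam"
  have "?T \<le> 0" using assms eps by (simp add: divide_le_0_iff)
  then have "integral {0..?T} rho = integral {0..0} rho"
    using rho_integral_clip[of ?T] by (simp add: max_absorb1)
  then show ?thesis by (simp add: beta_eps_def B_eps_def)
qed

lemma beta_eps_nonpos: "t \<le> 0 \<Longrightarrow> beta_eps rho sig0 gam eps t = 0"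
  by (simp add: beta_eps_def)

lemma beta_eps_nonneg: "0 \<le> beta_eps rho sig0 gam eps t"
  using rho_integral_bounds gam by (simp add: beta_eps_def B_eps_def)

lemma beta_eps_le: "0 < t \<Longrightarrow> beta_eps rho sig0 gam eps t \<le> gam * t powr (gam - 1)"
  using rho_integral_bounds gam by (simp add: beta_eps_def B_eps_def mult_left_le)

lemma beta_eps_large:
  assumes "(1 + sig0) * eps powr alpha_of gam \<le> t"
  shows "beta_eps rho sig0 gam eps t = gam * t powr (gam - 1)"
proof -
  let ?T = "(t - sig0 * eps powr alpha_of gam) / eps powr alpha_of gam"
  have "1 \<le> ?T" using assms eps by (simp add: pos_le_divide_eq algebra_simps)
  then have "integral {0..?T} rho = 1" using rho_integral_clip[of ?T] rho_int by simp
  moreover have "0 < (1 + sig0) * eps powr alpha_of gam" using sig0 eps by simp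
  ultimately show ?thesis using assms by (simp add: beta_eps_def B_eps_def)
qed

lemma beta_eps_bdd: "bdd_above (range (beta_eps rho sig0 gam eps))"
proof (rule bdd_aboveI2)
  fix t
  define s where "s = sig0 * eps powr alpha_of gam"
  have s: "0 < s" using sig0 eps by (simp add: s_def)
  show "beta_eps rho sig0 gam eps t \<le> gam * s powr (gam - 1)"
  proof (cases "t \<le> s")
    case True
    then show ?thesis using beta_eps_zero[of t] gam by (simp add: s_def)
  next
    case False
    then have "beta_eps rho sig0 gam eps t \<le> gam * t powr (gam - 1)" using s by (intro beta_eps_le) simp
    also have "\<dots> \<le> gam * s powr (gam - 1)" using False s gam by (intro mult_left_mono powr_mono2') auto
    finally show ?thesis .
  qed
qed

text \<open>The singularity of \<open>t powr (gam - 1)\<close> at 0 is invisible, since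
  \<open>beta_eps\<close> vanishes up to a positive threshold: two overlapping open half-lines cover
  the line.\<close>

lemma beta_eps_isCont: "isCont (beta_eps rho sig0 gam eps) t"
proof -
  define s where "s = sig0 * eps powr alpha_of gam"
  have s: "0 < s" using sig0 eps by (simp add: s_def)
  have "continuous_on {0<..} (\<lambda>t. gam * t powr (gam - 1) *
      integral {0 .. (t - sig0 * eps powr alpha_of gam) / eps powr alpha_of gam} rho)"
    by (intro continuous_intros continuous_on_compose2[OF rho_integral_continuous]) (use eps in auto)
  then have "continuous_on {0<..} (beta_eps rho sig0 gam eps)"
    by (rule continuous_on_eq) (auto simp: beta_eps_def B_eps_def)
  moreover have "continuous_on {..<s} (beta_eps rho sig0 gam eps)"
    by (rule continuous_on_eq[OF continuous_on_const[of _ 0]]) (use beta_eps_zero in \<open>auto simp: s_def\<close>)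
  ultimately have "continuous_on ({0<..} \<union> {..<s}) (beta_eps rho sig0 gam eps)"
    by (intro continuous_on_open_Un) auto
  moreover have "{0<..} \<union> {..<s} = UNIV" using s by auto
  ultimately show ?thesis by (simp add: continuous_on_eq_continuous_at)
qed

end
end

section \<open>From the infimum to a least supersolution\<close>

definition admissible :: "(real^'n^'n \<Rightarrow> real) \<Rightarrow> (real \<Rightarrow> real) \<Rightarrow> (real^'n) set
     \<Rightarrow> (real^'n \<Rightarrow> real) \<Rightarrow> (real^'n \<Rightarrow> real) \<Rightarrow> (real^'n \<Rightarrow> real) \<Rightarrow> bool" where
  "admissible F beta U ulo uhi w \<longleftrightarrow> continuous_on (closure U) w \<and>
     (\<forall>y\<in>closure U. ulo y \<le> w y \<and> w y \<le> uhi y) \<and> visc_super F (\<lambda>y. beta (w y)) U w"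

text \<open>The infimum of a nonempty family, expressed by lower bounds and pointwise approximation
  instead of \<open>Inf\<close>; this is the form in which \<open>visc_sub_limit\<close> consumes
  it.\<close>

definition least_supersol :: "(real^'n^'n \<Rightarrow> real) \<Rightarrow> (real \<Rightarrow> real) \<Rightarrow> (real^'n) set
     \<Rightarrow> (real^'n \<Rightarrow> real) \<Rightarrow> (real^'n \<Rightarrow> real) \<Rightarrow> (real^'n \<Rightarrow> real) \<Rightarrow> (real^'n \<Rightarrow> real) \<Rightarrow> bool" where
  "least_supersol F beta U f ulo uhi u \<longleftrightarrow>
     dirichlet_sol F (\<lambda>_. Sup (range beta)) U f ulo \<and> dirichlet_sol F (\<lambda>_. 0) U f uhi \<and>
     (\<forall>w. admissible F beta U ulo uhi w \<longrightarrow> (\<forall>x\<in>closure U. u x \<le> w x)) \<and>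
     (\<forall>x\<in>closure U. \<forall>e>0. \<exists>w. admissible F beta U ulo uhi w \<and> w x < u x + e) \<and>
     (\<exists>w. admissible F beta U ulo uhi w)"

text \<open>If no admissible function exists, the infimum in \<open>minimal_sol\<close> is the unspecified
  value \<open>Inf {}\<close>, and \<open>u\<close> is constant.\<close>

lemma minimal_sol_cases:
  assumes "minimal_sol F beta U f u"
  shows "(\<forall>x\<in>closure U. u x = Inf {}) \<or> (\<exists>ulo uhi. least_supersol F beta U f ulo uhi u)"
proof -
  obtain ulo uhi where ds: "dirichlet_sol F (\<lambda>_. Sup (range beta)) U f ulo" "dirichlet_sol F (\<lambda>_. 0) U f uhi"
    and u: "\<And>x. x \<in> closure U \<Longrightarrow> u x = Inf {w x | w. admissible F beta U ulo uhi w}"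
    using assms unfolding minimal_sol_def admissible_def by auto
  show ?thesis
  proof (cases "\<exists>w. admissible F beta U ulo uhi w")
    case False
    then show ?thesis using u by auto
  next
    case True
    have bdd: "bdd_below {w x | w. admissible F beta U ulo uhi w}" if "x \<in> closure U" for x
      using that by (intro bdd_belowI[of _ "ulo x"]) (auto simp: admissible_def)
    have "u x \<le> w x" if "admissible F beta U ulo uhi w" "x \<in> closure U" for w x
      unfolding u[OF that(2)] using that by (intro cInf_lower bdd) auto
    moreover have "\<exists>w. admissible F beta U ulo uhi w \<and> w x < u x + e" if "x \<in> closure U" "e > 0" for x e
    proof -
      have "Inf {w x | w. admissible F beta U ulo uhi w} < u x + e" using u[OF that(1)] that(2) by simp
      then show ?thesis using cInf_lessD[of "{w x | w. admissible F beta U ulo uhi w}"] True by auto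
    qed
    ultimately show ?thesis using ds True unfolding least_supersol_def by blast
  qed
qed

section \<open>Properties of the least supersolution\<close>

context
  fixes F :: "real^'n^'n \<Rightarrow> real" and lam Lam :: real and beta :: "real \<Rightarrow> real"
    and U :: "(real^'n) set" and f ulo uhi u :: "real^'n \<Rightarrow> real"
  assumes ell: "unif_elliptic F lam Lam" and F0: "F 0 = 0"
    and U: "open U" "bounded U" and f_nonneg: "\<forall>x\<in>frontier U. f x \<ge> 0"
    and beta_nonneg: "\<And>t. 0 \<le> beta t" and beta_nonpos: "\<And>t. t \<le> 0 \<Longrightarrow> beta t = 0"
    and beta_bdd: "bdd_above (range beta)" and beta_cont: "\<And>t. isCont beta t"
    and least: "least_supersol F beta U f ulo uhi u" and cu: "continuous_on U u"
begin

lemma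
  shows ls_low: "\<And>w x. admissible F beta U ulo uhi w \<Longrightarrow> x \<in> closure U \<Longrightarrow> u x \<le> w x"
    and ls_approx: "\<And>x e. x \<in> closure U \<Longrightarrow> 0 < e \<Longrightarrow> \<exists>w. admissible F beta U ulo uhi w \<and> w x < u x + e"
    and ls_sub: "visc_sub F (\<lambda>x. Sup (range beta)) U ulo"
    and ls_bc: "\<And>x. x \<in> frontier U \<Longrightarrow> ulo x = f x" "\<And>x. x \<in> frontier U \<Longrightarrow> uhi x = f x"
    and ls_cont: "continuous_on (closure U) ulo" "continuous_on (closure U) uhi"
  using least unfolding least_supersol_def dirichlet_sol_def visc_sol_def by blast+

lemma ls_between:
  assumes "x \<in> closure U"
  shows "ulo x \<le> u x" "u x \<le> uhi x"
proof -
  show "ulo x \<le> u x"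
  proof (rule field_le_epsilon)
    fix e :: real assume "0 < e"
    then obtain w where "admissible F beta U ulo uhi w" "w x < u x + e" using ls_approx[OF assms] by blast
    then show "ulo x \<le> u x + e" using assms unfolding admissible_def by force
  qed
  obtain w where w: "admissible F beta U ulo uhi w" using least unfolding least_supersol_def by blast
  then show "u x \<le> uhi x" using ls_low[OF w assms] assms unfolding admissible_def by force
qed

lemma ls_frontier:
  assumes "x \<in> frontier U"
  shows "u x = f x"
  using ls_between[of x] ls_bc[OF assms] assms by (simp add: frontier_def)

text \<open>Interior continuity is given; at the boundary \<open>u\<close> is squeezed between
  \<open>ulo\<close> and \<open>uhi\<close>, which share the values \<open>f\<close>.\<close>

lemma ls_continuous: "continuous_on (closure U) u"
  unfolding continuous_on_def
proof
  fix x assume x: "x \<in> closure U"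
  show "(u \<longlongrightarrow> u x) (at x within closure U)"
  proof (cases "x \<in> U")
    case True
    then have "isCont u x" using cu U by (simp add: continuous_on_eq_continuous_at)
    then have "continuous (at x within closure U) u" by (rule continuous_at_imp_continuous_at_within)
    then show ?thesis by (simp add: continuous_within)
  next
    case False
    then have fr: "x \<in> frontier U" using x U by (simp add: frontier_def interior_open)
    have t: "(ulo \<longlongrightarrow> u x) (at x within closure U)" "(uhi \<longlongrightarrow> u x) (at x within closure U)"
      using ls_cont x ls_bc[OF fr] ls_frontier[OF fr] unfolding continuous_on_def by auto
    have ev: "\<forall>\<^sub>F y in at x within closure U. ulo y \<le> u y" "\<forall>\<^sub>F y in at x within closure U. u y \<le> uhi y"
      using ls_between by (auto simp: eventually_at_filter)
    show ?thesis by (rule tendsto_sandwich[OF ev t])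
  qed
qed

text \<open>For the negated functions the infimum is a supremum: an admissible function close to
  \<open>u\<close> at \<open>x\<close> lies above \<open>u\<close> everywhere, which is exactly the
  one-sided approximation allowed in \<open>visc_sub_limit\<close>.\<close>

lemma ls_super_dual: "visc_sub (\<lambda>M. - F (- M)) (\<lambda>x. - beta (- (- u x))) U (\<lambda>x. - u x)"
proof (rule visc_sub_limit[OF unif_elliptic_dual[OF ell] U(1), where G = "\<lambda>t. - beta (- t)"])
  show "continuous_on U (\<lambda>x. - u x)" by (intro continuous_intros cu)
  fix x assume x: "x \<in> U"
  then obtain \<rho> where \<rho>: "\<rho> > 0" "ball x \<rho> \<subseteq> U" using U openE by blast
  have UC: "U \<subseteq> closure U" by (rule closure_subset)
  show "\<exists>\<rho>>0. ball x \<rho> \<subseteq> U \<and> (\<forall>\<kappa>>0. \<exists>v. visc_sub (\<lambda>M. - F (- M)) (\<lambda>y. - beta (- v y)) (ball x \<rho>) v \<and>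
      (\<forall>y\<in>ball x \<rho>. v y \<le> - u y + \<kappa>) \<and> - u x - \<kappa> < v x)"
  proof (intro exI[of _ \<rho>] conjI \<rho> allI impI)
    fix \<kappa> :: real assume \<kappa>: "\<kappa> > 0"
    then obtain w where w: "admissible F beta U ulo uhi w" "w x < u x + \<kappa>"
      using ls_approx[of x \<kappa>] x UC by blast
    have "visc_super F (\<lambda>y. beta (w y)) (ball x \<rho>) w"
      by (rule visc_super_weaken[of F "\<lambda>y. beta (w y)" U]) (use w \<rho> in \<open>auto simp: admissible_def\<close>)
    then have "visc_sub (\<lambda>M. - F (- M)) (\<lambda>y. - beta (- (- w y))) (ball x \<rho>) (\<lambda>y. - w y)"
      unfolding visc_super_dual by simp
    moreover have "- w y \<le> - u y + \<kappa>" if "y \<in> ball x \<rho>" for y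
    proof -
      have "y \<in> closure U" using that \<rho>(2) UC by blast
      then show ?thesis using ls_low[OF w(1), of y] \<kappa> by simp
    qed
    ultimately show "\<exists>v. visc_sub (\<lambda>M. - F (- M)) (\<lambda>y. - beta (- v y)) (ball x \<rho>) v \<and>
      (\<forall>y\<in>ball x \<rho>. v y \<le> - u y + \<kappa>) \<and> - u x - \<kappa> < v x"
      using w(2) by (intro exI[of _ "\<lambda>y. - w y"]) auto
  qed
next
  fix x
  have "isCont (\<lambda>t. beta (- t)) (- u x)"
    by (rule isCont_o2[where g = beta and f = uminus]) (auto intro: beta_cont continuous_intros)
  then show "isCont (\<lambda>t. - beta (- t)) (- u x)" by (rule isCont_minus)
qed

lemma ls_super: "visc_super F (\<lambda>x. beta (u x)) U u"
  unfolding visc_super_dual using ls_super_dual by simp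

text \<open>Minimality in negated form, as gluing and bumps produce maxima of dual subsolutions.
  Agreement with \<open>- u\<close> off \<open>K\<close> gives continuity up to the boundary, so
  \<open>- w\<close> is admissible and cannot lie below \<open>u\<close>.\<close>

lemma ls_no_lower:
  assumes w: "visc_sub (\<lambda>M. - F (- M)) (\<lambda>x. - beta (- w x)) U w" and K: "compact K" "K \<subseteq> U"
    and off: "\<And>x. x \<notin> K \<Longrightarrow> w x = - u x" and le: "\<And>x. x \<in> U \<Longrightarrow> - u x \<le> w x"
    and lo: "\<And>x. x \<in> U \<Longrightarrow> w x \<le> - ulo x" and x: "x \<in> U"
  shows "w x = - u x"
proof -
  have UC: "U \<subseteq> closure U" by (rule closure_subset)
  have "continuous_on (closure U) w"
    by (rule continuous_on_modify[OF U(1) UC K _ continuous_on_minus[OF ls_continuous] off])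
       (use w in \<open>simp add: visc_sub_def\<close>)
  then have "continuous_on (closure U) (\<lambda>x. - w x)" by (rule continuous_on_minus)
  moreover have "ulo y \<le> - w y \<and> - w y \<le> uhi y" if y: "y \<in> closure U" for y
  proof (cases "y \<in> U")
    case True
    then show ?thesis using le[OF True] lo[OF True] ls_between[OF y] by simp
  next
    case False
    then have "w y = - u y" using K by (intro off) blast
    then show ?thesis using ls_between[OF y] by simp
  qed
  moreover have "visc_super F (\<lambda>x. beta (- w x)) U (\<lambda>x. - w x)"
    unfolding visc_super_dual using w by simp
  ultimately have "admissible F beta U ulo uhi (\<lambda>x. - w x)" by (simp add: admissible_def)
  then have "u x \<le> - w x" using x UC by (intro ls_low) auto
  then show ?thesis using le[OF x] by simp
qed

text \<open>If a test function touching \<open>u\<close> from above had \<open>F H < 0\<close>, a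
  dual bump would lower \<open>u\<close>, against minimality. The bump needs room above
  \<open>ulo\<close>; where \<open>u = ulo\<close>, the subsolution inequality of
  \<open>ulo\<close>, with right-hand side at least 0, excludes this case directly.\<close>

lemma ls_subsol: "visc_sub F (\<lambda>x. 0) U u"
proof (rule visc_subI[OF cu])
  fix x0 phi H and r :: real
  assume x0: "x0 \<in> U" and phi: "C2_near phi x0 H" and r: "0 < r"
    and t: "\<And>y. y \<in> ball x0 r \<Longrightarrow> y \<in> U \<Longrightarrow> u y - phi y \<le> u x0 - phi x0"
  have UC: "U \<subseteq> closure U" by (rule closure_subset)
  show "0 \<le> F H"
  proof (rule ccontr)
    assume neg: "\<not> 0 \<le> F H"
    have lt: "- u x0 < - ulo x0"
    proof (rule ccontr)
      assume "\<not> - u x0 < - ulo x0"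
      then have eq: "u x0 = ulo x0" using ls_between[of x0] x0 UC by force
      have "Sup (range beta) \<le> F H"
      proof (rule visc_subD[OF ls_sub x0 phi r])
        fix y assume y: "y \<in> ball x0 r" "y \<in> U"
        then have "ulo y \<le> u y" using UC by (intro ls_between) auto
        then show "ulo y - phi y \<le> ulo x0 - phi x0" using t[OF y] eq by simp
      qed
      moreover have "beta 0 \<le> Sup (range beta)" by (intro cSUP_upper beta_bdd) simp
      ultimately show False using neg beta_nonneg[of 0] by simp
    qed
    have tp: "ulo x \<le> u x" if "x \<in> U" for x using ls_between[of x] that UC by auto
    have ctp: "continuous_on U (\<lambda>x. - ulo x)"
      by (intro continuous_intros continuous_on_subset[OF ls_cont(1) UC])
    obtain w K where w: "visc_sub (\<lambda>M. - F (- M)) (\<lambda>x. (\<lambda>t. - beta (- t)) (w x)) U w" "compact K" "K \<subseteq> U"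
      "\<And>x. x \<notin> K \<Longrightarrow> w x = - u x" "\<And>x. - u x \<le> w x" "\<And>x. x \<in> U \<Longrightarrow> w x \<le> - ulo x" "- u x0 < w x0"
    proof (rule visc_sub_bump[where G = "\<lambda>t. - beta (- t)" and v = "\<lambda>x. - u x",
        OF unif_elliptic_dual[OF ell] ls_super_dual _ U(1) x0 C2_near_uminus[OF phi] _ r _ ctp _ lt])
      fix y assume "y \<in> ball x0 r" "y \<in> U"
      then show "- u x0 - - phi x0 \<le> - u y - - phi y" using t[of y] by simp
    next
      fix w K
      assume "visc_sub (\<lambda>M. - F (- M)) (\<lambda>x. - beta (- w x)) U w" "compact K" "K \<subseteq> U"
        "\<And>x. x \<notin> K \<Longrightarrow> w x = - u x" "\<And>x. - u x \<le> w x" "\<And>x. x \<in> U \<Longrightarrow> w x \<le> - ulo x" "- u x0 < w x0"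
      then show thesis by (rule that)
    qed (use neg beta_nonneg tp in auto)
    have "w x0 = - u x0" by (rule ls_no_lower[OF _ w(2,3,4) _ w(6) x0]) (use w in auto)
    then show False using w(7) by simp
  qed
qed

text \<open>\<open>beta\<close> vanishes at negative values. Subtracting a small quadratic from
  \<open>u\<close> leaves a negative minimum, interior because \<open>f\<close> is nonnegative, and
  there \<open>F\<close> of a positive multiple of the identity would be at most 0. The coefficient
  is tuned so that the quadratic stays below half of \<open>- u x\<close> on the bounded
  domain.\<close>

lemma ls_nonneg:
  assumes x: "x \<in> closure U"
  shows "0 \<le> u x"
proof (rule ccontr)
  assume neg: "\<not> 0 \<le> u x"
  obtain B where B: "\<And>y. y \<in> closure U \<Longrightarrow> norm y \<le> B" "0 < B"
    using bounded_closure[OF U(2)] by (metis bounded_pos)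
  define \<eta> where "\<eta> = - u x / (2 * B\<^sup>2)"
  have \<eta>: "0 < \<eta>" using neg B unfolding \<eta>_def by (intro divide_pos_pos) auto
  have \<eta>B: "\<eta> * B\<^sup>2 = - u x / 2" using B by (simp add: \<eta>_def)
  have q: "0 \<le> \<eta> * (y \<bullet> y)" "\<eta> * (y \<bullet> y) \<le> - u x / 2" if "y \<in> closure U" for y
  proof -
    show "0 \<le> \<eta> * (y \<bullet> y)" using \<eta> by simp
    have "y \<bullet> y \<le> B\<^sup>2" unfolding dot_square_norm using B(1)[OF that] by (intro power_mono) auto
    then have "\<eta> * (y \<bullet> y) \<le> \<eta> * B\<^sup>2" using \<eta> by (intro mult_left_mono) auto
    then show "\<eta> * (y \<bullet> y) \<le> - u x / 2" using \<eta>B by simp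
  qed
  have "continuous_on (closure U) (\<lambda>y. u y - \<eta> * (y \<bullet> y))"
    by (intro continuous_intros ls_continuous)
  moreover have "compact (closure U)" using U by (simp add: compact_closure)
  ultimately have "\<exists>y\<in>closure U. \<forall>z\<in>closure U. u y - \<eta> * (y \<bullet> y) \<le> u z - \<eta> * (z \<bullet> z)"
    using x by (intro continuous_attains_inf) auto
  then obtain y where y: "y \<in> closure U" "\<And>z. z \<in> closure U \<Longrightarrow> u y - \<eta> * (y \<bullet> y) \<le> u z - \<eta> * (z \<bullet> z)" by blast
  have uy: "u y < 0" using y(2)[OF x] q[OF x] q[OF y(1)] neg by linarith
  have yU: "y \<in> U"
  proof (rule ccontr)
    assume "y \<notin> U"
    then have "y \<in> frontier U" using y U by (simp add: frontier_def interior_open)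
    then show False using ls_frontier[of y] f_nonneg uy by force
  qed
  have "F ((2 * \<eta>) *\<^sub>R mat 1) \<le> beta (u y)"
  proof (rule visc_superD[OF ls_super yU _ zero_less_one])
    show "C2_near (\<lambda>x. \<eta> * (x \<bullet> x)) y ((2 * \<eta>) *\<^sub>R mat 1)" using C2_near_quadratic[of \<eta> 0 y] by simp
    fix z assume "z \<in> U"
    then show "u y - \<eta> * (y \<bullet> y) \<le> u z - \<eta> * (z \<bullet> z)" using closure_subset by (intro y) auto
  qed
  moreover have "F 0 + lam * (2 * \<eta>) \<le> F (0 + (2 * \<eta>) *\<^sub>R mat 1)"
    using \<eta> by (intro unif_elliptic_add_id[OF ell sym_mat_zero]) simp
  moreover have "0 < lam * (2 * \<eta>)" using ell \<eta> by (simp add: unif_elliptic_def)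
  ultimately show False using F0 uy beta_nonpos[of "u y"] by simp
qed

text \<open>The competitor is \<open>min u \<theta>\<close> with \<open>\<theta> = A (\<kappa> + |x - X|\<^sup>2)\<^sup>\<alpha>\<^sup>/\<^sup>2\<close>: for small \<open>A\<close> it is a classical
  supersolution, and \<open>\<kappa>\<close> is chosen so that \<open>\<theta> X = T\<close>, beyond which the truncation in \<open>beta\<close> is inactive.\<close>

lemma ls_nondegenerate:
  assumes gam: "0 < gam" "gam < 1" and A: "0 < A" "Lam * alpha_of gam * A powr (2 - gam) \<le> gam"
    and T: "0 < T" "\<And>t. T \<le> t \<Longrightarrow> beta t = gam * t powr (gam - 1)"
    and r: "0 < r" "cball X r \<subseteq> U"
    and small: "\<And>y. y \<in> cball X r \<Longrightarrow> u y < A * (r / 2) powr alpha_of gam"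
  shows "u X \<le> T"
proof (rule ccontr)
  assume big: "\<not> u X \<le> T"
  have l: "0 < lam" "0 < Lam" using ell by (auto simp: unif_elliptic_def)
  have UC: "U \<subseteq> closure U" by (rule closure_subset)
  \<comment> \<open>The identity \<open>a * (gam - 1) = a - 1\<close> makes the leading Hessian
    coefficient of \<theta> and \<open>\<theta> powr (gam - 1)\<close> the same power of
    \<open>\<kappa> + s\<close>; only the constants in \<open>A\<close> remain to be
    compared.\<close>
  define a where "a = alpha_of gam / 2"
  have a: "0 < a" "a < 1" "a * (gam - 1) = a - 1" using gam by (auto simp: a_def alpha_of_def field_simps)
  define \<kappa> where "\<kappa> = (T / A) powr (1 / a)"
  have \<kappa>: "0 < \<kappa>" using T A by (simp add: \<kappa>_def)
  have \<kappa>a: "A * \<kappa> powr a = T" using T A a by (simp add: \<kappa>_def powr_powr)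
  define \<theta> where "\<theta> x = A * (\<kappa> + (x - X) \<bullet> (x - X)) powr a" for x
  define s where "s x = (x - X) \<bullet> (x - X)" for x
  define H where "H x = (2 * (A * a * (\<kappa> + s x) powr (a - 1))) *\<^sub>R mat 1 +
    (4 * (A * a * (a - 1) * (\<kappa> + s x) powr (a - 2))) *\<^sub>R outer (x - X)" for x
  have s0: "0 \<le> s x" for x by (simp add: s_def)
  have \<kappa>s: "0 < \<kappa> + s x" for x using \<kappa> s0[of x] by simp
  have C2: "C2_near \<theta> x (H x)" for x
  proof -
    have "C2_near (\<lambda>x. (\<lambda>s. A * (\<kappa> + s) powr a) ((x - X) \<bullet> (x - X))) x (H x)"
      unfolding H_def s_def
    proof (rule C2_near_radial[where S = "{-\<kappa><..}" and \<Phi> = "\<lambda>s. A * (\<kappa> + s) powr a"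
        and \<Phi>' = "\<lambda>s. A * a * (\<kappa> + s) powr (a - 1)" and \<Phi>'' = "\<lambda>s. A * a * (a - 1) * (\<kappa> + s) powr (a - 2)"])
      show "(x - X) \<bullet> (x - X) \<in> {-\<kappa><..}" using \<kappa>s[of x] by (simp add: s_def)
      have dp: "((\<lambda>s. c * (\<kappa> + s) powr b) has_real_derivative c * b * (\<kappa> + s) powr (b - 1)) (at s)"
        if "s \<in> {-\<kappa><..}" for b c s
      proof -
        have "((\<lambda>s. \<kappa> + s) has_real_derivative 1) (at s)" by (auto intro!: derivative_eq_intros)
        from DERIV_cmult[OF DERIV_fun_powr[OF this, of b], of c] show ?thesis using that by (simp add: mult.assoc)
      qed
      show "((\<lambda>s. A * (\<kappa> + s) powr a) has_real_derivative A * a * (\<kappa> + s) powr (a - 1)) (at s)"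
        if "s \<in> {-\<kappa><..}" for s using dp[OF that] .
      show "((\<lambda>s. A * a * (\<kappa> + s) powr (a - 1)) has_real_derivative A * a * (a - 1) * (\<kappa> + s) powr (a - 2)) (at s)"
        if "s \<in> {-\<kappa><..}" for s using dp[OF that, of "A * a" "a - 1"] by simp
      show "continuous_on {-\<kappa><..} (\<lambda>s. A * a * (a - 1) * (\<kappa> + s) powr (a - 2))"
        by (intro continuous_intros) auto
    qed simp
    then show ?thesis by (simp add: \<theta>_def[abs_def])
  qed
  have \<theta>T: "T \<le> \<theta> x" for x
  proof -
    have "A * \<kappa> powr a \<le> A * (\<kappa> + s x) powr a" using A \<kappa> a s0 by (intro mult_left_mono powr_mono2) auto
    then show ?thesis by (simp add: \<theta>_def s_def \<kappa>a)
  qed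
  have \<theta>super: "F (H x) \<le> beta (\<theta> x)" for x
  proof -
    define P where "P = (\<kappa> + s x) powr (a - 1)"
    have P: "0 < P" using \<kappa>s[of x] by (simp add: P_def)
    have "F (0 + H x) \<le> F 0 + Lam * (2 * (A * a * P))"
    proof (rule unif_elliptic_upper[OF ell sym_mat_zero C2_near_sym[OF C2]])
      show "0 \<le> 2 * (A * a * P)" using A a P by simp
      fix v
      have "A * a * (a - 1) \<le> 0" using A a by (simp add: mult_nonneg_nonpos)
      then have "A * a * (a - 1) * (\<kappa> + s x) powr (a - 2) \<le> 0"
        by (rule mult_nonpos_nonneg) simp
      then have "4 * (A * a * (a - 1) * (\<kappa> + s x) powr (a - 2)) \<le> 0" by linarith
      then have "4 * (A * a * (a - 1) * (\<kappa> + s x) powr (a - 2)) * ((x - X) \<bullet> v)\<^sup>2 \<le> 0"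
        by (rule mult_nonpos_nonneg) simp
      moreover have "v \<bullet> (H x *v v) = 2 * (A * a * P) * (v \<bullet> v) +
          4 * (A * a * (a - 1) * (\<kappa> + s x) powr (a - 2)) * ((x - X) \<bullet> v)\<^sup>2"
        by (simp add: H_def P_def matrix_vector_mult_add_rdistrib outer_vector inner_add_right
              inner_commute power2_eq_square flip: scaleR_matrix_vector_assoc)
      ultimately show "v \<bullet> (H x *v v) \<le> 2 * (A * a * P) * (v \<bullet> v)" by simp
    qed
    then have "F (H x) \<le> (Lam * alpha_of gam * A) * P" using F0 by (simp add: a_def mult_ac)
    also have "\<dots> \<le> (gam * A powr (gam - 1)) * P"
    proof (rule mult_right_mono)
      have "A powr (gam - 1) * (Lam * alpha_of gam * A powr (2 - gam)) \<le> A powr (gam - 1) * gam"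
        using A by (intro mult_left_mono) auto
      moreover have "A powr (gam - 1) * A powr (2 - gam) = A" using A by (simp flip: powr_add)
      then have "A powr (gam - 1) * (Lam * alpha_of gam * A powr (2 - gam)) = Lam * alpha_of gam * A"
        by (metis mult.assoc mult.left_commute)
      ultimately show "Lam * alpha_of gam * A \<le> gam * A powr (gam - 1)" by (simp add: mult.commute)
    qed (use P in simp)
    also have "\<dots> = gam * \<theta> x powr (gam - 1)"
      using A \<kappa>s[of x] a(3) by (simp add: \<theta>_def s_def P_def powr_mult powr_powr)
    also have "\<dots> = beta (\<theta> x)" using T(2)[OF \<theta>T] by simp
    finally show ?thesis .
  qed
  \<comment> \<open>On the outer half of the ball \<theta> exceeds the assumed bound on
    \<open>u\<close>, so the competitor differs from \<open>u\<close> only inside the compact ball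
    of radius \<open>r / 2\<close>.\<close>
  have out: "u x < \<theta> x" if "x \<in> cball X r" "r / 2 \<le> dist X x" for x
  proof -
    have "A * (r / 2) powr alpha_of gam = A * ((r / 2)\<^sup>2) powr a" using r by (simp add: a_def powr_powr flip: powr_numeral)
    also have "\<dots> \<le> \<theta> x"
      unfolding \<theta>_def
    proof (intro mult_left_mono powr_mono2)
      have "(r / 2)\<^sup>2 \<le> (dist X x)\<^sup>2" using that r by (intro power_mono) auto
      also have "\<dots> = (x - X) \<bullet> (x - X)" by (simp add: dist_norm norm_minus_commute dot_square_norm)
      finally show "(r / 2)\<^sup>2 \<le> \<kappa> + (x - X) \<bullet> (x - X)" using \<kappa> by simp
    qed (use a A in auto)
    finally show ?thesis using small[OF that(1)] by simp
  qed
  define V where "V = ball X r"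
  define K where "K = cball X (r / 2)"
  have VU: "V \<subseteq> U" using r(2) by (auto simp: V_def)
  have KV: "K \<subseteq> V" using r(1) by (auto simp: V_def K_def)
  \<comment> \<open>The competitor must not drop below \<open>ulo\<close>. Comparison is available
    here since \<open>ulo\<close> has a constant right-hand side dominating
    \<open>beta (\<theta> x)\<close>. The quadratic with coefficient \<eta> gives strictness, and
    \<eta> is calibrated to keep the maximum off the sphere, where
    \<open>ulo < \<theta>\<close>.\<close>
  have lo\<theta>: "ulo x \<le> \<theta> x" if x: "x \<in> K" for x
  proof (rule ccontr)
    assume neg: "\<not> ulo x \<le> \<theta> x"
    define \<eta> where "\<eta> = (ulo x - \<theta> x) / (r / 2)\<^sup>2"
    have \<eta>: "0 < \<eta>" using neg r by (simp add: \<eta>_def)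
    have KC: "K \<subseteq> closure U" using KV VU UC by blast
    have "continuous_on K \<theta>" using C2 by (meson C2_near_isCont continuous_at_imp_continuous_on)
    then have "continuous_on K (\<lambda>y. ulo y - \<theta> y + \<eta> * ((y - X) \<bullet> (y - X)))"
      by (intro continuous_intros continuous_on_subset[OF ls_cont(1) KC])
    then have "\<exists>y\<in>K. \<forall>z\<in>K. ulo z - \<theta> z + \<eta> * ((z - X) \<bullet> (z - X)) \<le> ulo y - \<theta> y + \<eta> * ((y - X) \<bullet> (y - X))"
      using x r(1) by (intro continuous_attains_sup) (auto simp: K_def)
    then obtain y where y: "y \<in> K" "\<And>z. z \<in> K \<Longrightarrow>
        ulo z - \<theta> z + \<eta> * ((z - X) \<bullet> (z - X)) \<le> ulo y - \<theta> y + \<eta> * ((y - X) \<bullet> (y - X))" by blast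
    have "dist X y < r / 2"
    proof (rule ccontr)
      assume "\<not> dist X y < r / 2"
      then have dy: "dist X y = r / 2" using y(1) by (simp add: K_def)
      have yC: "y \<in> closure U" using y(1) KC by blast
      have "u y < \<theta> y" using dy r by (intro out) auto
      then have "ulo y < \<theta> y" using ls_between(1)[OF yC] by simp
      moreover have "\<eta> * ((y - X) \<bullet> (y - X)) = ulo x - \<theta> x"
      proof -
        have "(y - X) \<bullet> (y - X) = (dist X y)\<^sup>2" by (simp add: dist_norm norm_minus_commute dot_square_norm)
        then have "(y - X) \<bullet> (y - X) = (r / 2)\<^sup>2" unfolding dy .
        then show ?thesis using r by (simp add: \<eta>_def)
      qed
      moreover have "0 \<le> \<eta> * ((x - X) \<bullet> (x - X))" using \<eta> by simp
      ultimately show False using y(2)[OF x] by linarith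
    qed
    then obtain q where q: "0 < q" "ball y q \<subseteq> K" unfolding K_def by (meson ball_subset_cball mem_ball openE open_ball order_trans)
    have "Sup (range beta) \<le> F (H y - (2 * \<eta>) *\<^sub>R mat 1)"
    proof (rule visc_subD[OF ls_sub _ C2_near_diff[OF C2 C2_near_quadratic] q(1)])
      show "y \<in> U" using y(1) KV VU by blast
      fix z assume "z \<in> ball y q"
      then have "z \<in> K" using q by blast
      then show "ulo z - (\<theta> z - \<eta> * ((z - X) \<bullet> (z - X))) \<le> ulo y - (\<theta> y - \<eta> * ((y - X) \<bullet> (y - X)))"
        using y(2)[of z] by simp
    qed
    also have "\<dots> \<le> F (H y) - lam * (2 * \<eta>)"
      using \<eta> by (intro unif_elliptic_diff_id[OF ell C2_near_sym[OF C2]]) simp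
    also have "\<dots> < F (H y)" using l \<eta> by simp
    also have "\<dots> \<le> beta (\<theta> y)" by (rule \<theta>super)
    also have "\<dots> \<le> Sup (range beta)" by (intro cSUP_upper beta_bdd) simp
    finally show False by simp
  qed
  have g: "visc_sub (\<lambda>M. - F (- M)) (\<lambda>x. (\<lambda>t. - beta (- t)) (- \<theta> x)) V (\<lambda>x. - \<theta> x)"
  proof (rule C2_visc_sub[OF unif_elliptic_dual[OF ell]])
    show "C2_near (\<lambda>x. - \<theta> x) x (- H x)" for x by (rule C2_near_uminus[OF C2])
  qed (use \<theta>super in \<open>auto simp: V_def\<close>)
  define w where "w = (\<lambda>x. if x \<in> V then max (- u x) (- \<theta> x) else - u x)"
  have off: "- \<theta> x \<le> - u x" if "x \<in> V" "x \<notin> K" for x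
    using out[of x] that by (auto simp: V_def K_def)
  have ws: "visc_sub (\<lambda>M. - F (- M)) (\<lambda>x. (\<lambda>t. - beta (- t)) (w x)) U w"
    unfolding w_def
    by (rule visc_sub_glue[OF ls_super_dual g _ VU _ KV off]) (auto simp: V_def K_def)
  have XU: "X \<in> U" using r by auto
  have "w X = - u X"
  proof (rule ls_no_lower[OF ws, of K])
    show "w x = - u x" if "x \<notin> K" for x using off[of x] that by (auto simp: w_def max_absorb1)
    show "w x \<le> - ulo x" if x: "x \<in> U" for x
    proof -
      have "- u x \<le> - ulo x" using ls_between[of x] x UC by auto
      moreover have "- \<theta> x \<le> - ulo x" if "x \<in> V"
        using off[of x] lo\<theta>[of x] calculation that by (cases "x \<in> K") auto
      ultimately show ?thesis by (simp add: w_def)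
    qed
  qed (use KV VU XU in \<open>auto simp: w_def K_def\<close>)
  moreover have "\<theta> X = T" using \<kappa>a by (simp add: \<theta>_def)
  ultimately show False using big r by (auto simp: w_def V_def max_def split: if_splits)
qed

end

section \<open>The limit function\<close>

text \<open>A connected set meeting \<open>S\<close> and its complement meets the frontier. With
  radius 0, in particular for an empty frontier, the ball is empty.\<close>

lemma ball_infdist_frontier_subset:
  fixes X :: "'a::euclidean_space"
  assumes "X \<in> S"
  shows "ball X (infdist X (frontier S)) \<subseteq> S"
proof (rule ccontr)
  assume "\<not> ?thesis"
  then obtain w where w: "w \<in> ball X (infdist X (frontier S))" "w \<notin> S" by blast
  then have "0 < infdist X (frontier S)" by (metis mem_ball dist_not_less_zero less_trans linorder_neqE_linordered_idom)
  then have "X \<in> ball X (infdist X (frontier S)) \<inter> S" using assms by simp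
  then have "ball X (infdist X (frontier S)) \<inter> S \<noteq> {}" by blast
  then have "ball X (infdist X (frontier S)) \<inter> frontier S \<noteq> {}"
    using w by (intro connected_Int_frontier) auto
  then obtain v where v: "v \<in> ball X (infdist X (frontier S))" "v \<in> frontier S" by blast
  then show False using infdist_le[OF v(2), of X] by simp
qed

text \<open>A point outside \<open>cball X D\<close> is moved radially to the sphere of radius
  \<open>D\<close>, which lies in \<open>V\<close>; the displacement is smaller than
  \<open>s \<le> e\<close>.\<close>

lemma ball_thickening_subset:
  fixes X :: "'a::euclidean_space"
  assumes V: "\<And>x. x \<in> V \<Longrightarrow> ball x e \<subseteq> U" and e: "0 < e" and B: "cball X D \<subseteq> V" and D: "0 \<le> D" and s: "s \<le> e"
  shows "ball X (D + s) \<subseteq> U"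
proof
  fix w assume w: "w \<in> ball X (D + s)"
  show "w \<in> U"
  proof (cases "dist X w \<le> D")
    case True
    then have "w \<in> V" using B by auto
    then show ?thesis using V[of w] e by auto
  next
    case False
    then have n: "0 < norm (w - X)" using D by (auto simp: dist_norm norm_minus_commute)
    define w' where "w' = X + (D / norm (w - X)) *\<^sub>R (w - X)"
    have "dist X w' = D" using n D by (simp add: w'_def dist_norm)
    then have "w' \<in> V" using B by auto
    moreover have "w - w' = (1 - D / norm (w - X)) *\<^sub>R (w - X)" by (simp add: w'_def algebra_simps)
    then have dw: "dist w' w = \<bar>1 - D / norm (w - X)\<bar> * norm (w - X)"
      by (metis dist_norm norm_minus_commute norm_scaleR)
    have "D < norm (w - X)" using False by (simp add: dist_norm norm_minus_commute)
    then have "\<bar>1 - D / norm (w - X)\<bar> * norm (w - X) = norm (w - X) - D"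
      using n by (simp add: abs_of_pos left_diff_distrib)
    then have "dist w' w = norm (w - X) - D" using dw by simp
    then have "w \<in> ball w' e" using w s by (simp add: dist_norm norm_minus_commute)
    ultimately show ?thesis using V by blast
  qed
qed

section \<open>Passage to the limit of the minimal solutions\<close>

context
  fixes F :: "real^'n^'n \<Rightarrow> real" and Omega :: "(real^'n) set" and f :: "real^'n \<Rightarrow> real"
    and gam sig0 lam Lam :: real and rho :: "real \<Rightarrow> real"
    and eps :: "nat \<Rightarrow> real" and u :: "nat \<Rightarrow> real^'n \<Rightarrow> real" and Du :: "nat \<Rightarrow> real^'n \<Rightarrow> real^'n"
    and u0 :: "real^'n \<Rightarrow> real" and Du0 :: "real^'n \<Rightarrow> real^'n" and Y0 :: "real^'n"
  assumes Om: "open Omega" "bounded Omega"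
    and f_nonneg: "\<forall>x\<in>frontier Omega. f x \<ge> 0"
    and gam: "0 < gam" "gam < 1" and F0: "F 0 = 0" and ell: "unif_elliptic F lam Lam"
    and rho_smooth: "smooth_fun rho" and rho_nonneg: "\<forall>t. rho t \<ge> 0"
    and rho_supp: "\<forall>t. t \<notin> {0..1} \<longrightarrow> rho t = 0" and rho_int: "integral {0..1} rho = 1"
    and sig0: "0 < sig0"
    and eps_pos: "\<And>k. eps k > 0" and eps_lim: "eps \<longlonglongrightarrow> 0"
    and min: "\<And>k. minimal_sol F (beta_eps rho sig0 gam (eps k)) Omega f (u k)"
    and der: "\<And>k x. x \<in> Omega \<Longrightarrow> (u k has_derivative (\<lambda>h. Du k x \<bullet> h)) (at x)"
    and der0: "\<And>x. x \<in> Omega \<Longrightarrow> (u0 has_derivative (\<lambda>h. Du0 x \<bullet> h)) (at x)"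
    and conv: "\<And>K e. compact K \<Longrightarrow> K \<subseteq> Omega \<Longrightarrow> 0 < e \<Longrightarrow>
       \<forall>\<^sub>F k in sequentially. \<forall>x\<in>K. \<bar>u k x - u0 x\<bar> < e"
    and Y0: "Y0 \<in> frontier {x \<in> Omega. u0 x > 0}" "Y0 \<in> Omega"
begin

lemmas beta_facts = beta_eps_nonneg[OF rho_smooth rho_nonneg rho_supp rho_int sig0 gam eps_pos]
  beta_eps_nonpos[OF rho_smooth rho_nonneg rho_supp rho_int sig0 gam eps_pos]
  beta_eps_bdd[OF rho_smooth rho_nonneg rho_supp rho_int sig0 gam eps_pos]
  beta_eps_isCont[OF rho_smooth rho_nonneg rho_supp rho_int sig0 gam eps_pos]

lemma u_continuous: "continuous_on Omega (u k)" "continuous_on Omega u0"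
  using der der0 by (meson continuous_at_imp_continuous_on has_derivative_continuous)+

text \<open>If admissible functions were missing infinitely often, the corresponding
  \<open>u k\<close> would all equal the same constant, and so would \<open>u0\<close>. Its
  positivity set would be empty or all of \<open>Omega\<close>, and neither has a frontier point in
  \<open>Omega\<close>.\<close>

lemma eventually_least:
  "\<forall>\<^sub>F k in sequentially. \<exists>ulo uhi. least_supersol F (beta_eps rho sig0 gam (eps k)) Omega f ulo uhi (u k)"
proof (rule ccontr)
  assume "\<not> ?thesis"
  then have fr: "\<exists>\<^sub>F k in sequentially. \<forall>x\<in>closure Omega. u k x = Inf {}"
    using minimal_sol_cases[OF min] unfolding not_eventually by (auto elim!: frequently_elim1)
  have const: "u0 x = Inf {}" if x: "x \<in> Omega" for x
  proof (rule ccontr)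
    assume ne: "u0 x \<noteq> Inf {}"
    have "\<forall>\<^sub>F k in sequentially. \<forall>y\<in>{x}. \<bar>u k y - u0 y\<bar> < \<bar>Inf {} - u0 x\<bar>"
      using x ne by (intro conv) auto
    then obtain k where "\<forall>x\<in>closure Omega. u k x = Inf {}" "\<bar>u k x - u0 x\<bar> < \<bar>Inf {} - u0 x\<bar>"
      using frequently_ex[OF frequently_eventually_conj[OF fr]] by auto
    moreover have "x \<in> closure Omega" using x closure_subset by blast
    ultimately show False by auto
  qed
  have "{x \<in> Omega. u0 x > 0} = Omega \<or> {x \<in> Omega. u0 x > 0} = {}" using const by auto
  then show False
  proof
    assume "{x \<in> Omega. u0 x > 0} = Omega"
    then show False using Y0 Om(1) by (simp add: frontier_def interior_open)
  next
    assume empty: "{x \<in> Omega. u0 x > 0} = {}"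
    show False using Y0(1) unfolding empty by simp
  qed
qed

lemma approximant:
  assumes "compact K" "K \<subseteq> Omega" "0 < e"
  obtains k ulo uhi where "least_supersol F (beta_eps rho sig0 gam (eps k)) Omega f ulo uhi (u k)"
    "\<And>x. x \<in> K \<Longrightarrow> \<bar>u k x - u0 x\<bar> < e"
  using eventually_happens'[OF _ eventually_conj[OF eventually_least conv[OF assms]]] by auto

lemma u0_nonneg:
  assumes x: "x \<in> Omega"
  shows "0 \<le> u0 x"
proof (rule field_le_epsilon)
  fix e :: real assume e: "0 < e"
  obtain k ulo uhi where k: "least_supersol F (beta_eps rho sig0 gam (eps k)) Omega f ulo uhi (u k)"
    and "\<And>y. y \<in> {x} \<Longrightarrow> \<bar>u k y - u0 y\<bar> < e"
    using approximant[of "{x}" e] x e by auto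
  moreover have "0 \<le> u k x"
    using x closure_subset by (intro ls_nonneg[OF ell F0 Om f_nonneg beta_facts k u_continuous(1)]) auto
  ultimately show "0 \<le> u0 x + e" by force
qed

lemma positivity_open: "open {x \<in> Omega. 0 < u0 x}"
  using continuous_open_preimage[OF u_continuous(2) Om(1), of "{0<..}"]
  by (simp add: vimage_def Int_def)

lemma u0_Y0: "u0 Y0 = 0"
proof -
  have "Y0 \<notin> {x \<in> Omega. 0 < u0 x}" using Y0(1) positivity_open by (simp add: frontier_def interior_open)
  then show ?thesis using Y0(2) u0_nonneg[OF Y0(2)] by simp
qed

text \<open>Once \<open>u k\<close> is closer to \<open>u0\<close> than the minimum of
  \<open>u0\<close> on a small closed ball, it is positive there and \<open>beta_eps\<close> is
  bounded by the singular right-hand side. Both inequalities then pass to the limit, the second in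
  dual form.\<close>

lemma u0_singular_sol: "singular_sol F gam {x \<in> Omega. 0 < u0 x} u0"
proof -
  let ?P = "{x \<in> Omega. 0 < u0 x}"
  have cP: "continuous_on ?P u0" by (rule continuous_on_subset[OF u_continuous(2)]) auto
  have ex: "\<exists>\<rho>>0. ball x \<rho> \<subseteq> ?P \<and> (\<forall>\<kappa>>0. \<exists>k. visc_sub F (\<lambda>y. 0) (ball x \<rho>) (u k) \<and>
      visc_super F (\<lambda>y. gam * u k y powr (gam - 1)) (ball x \<rho>) (u k) \<and>
      (\<forall>y\<in>ball x \<rho>. \<bar>u k y - u0 y\<bar> < \<kappa>))" if x: "x \<in> ?P" for x
  proof -
    obtain \<rho> where \<rho>: "0 < \<rho>" "cball x \<rho> \<subseteq> ?P" using positivity_open x open_contains_cball_eq by blast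
    have "\<exists>z\<in>cball x \<rho>. \<forall>y\<in>cball x \<rho>. u0 z \<le> u0 y"
      using \<rho> by (intro continuous_attains_inf continuous_on_subset[OF cP]) auto
    then obtain z where z: "z \<in> cball x \<rho>" "\<And>y. y \<in> cball x \<rho> \<Longrightarrow> u0 z \<le> u0 y" by blast
    have uz: "0 < u0 z" using z(1) \<rho> by blast
    have bP: "ball x \<rho> \<subseteq> ?P" using \<rho>(2) ball_subset_cball by blast
    show ?thesis
    proof (intro exI[of _ \<rho>] conjI \<rho>(1) bP allI impI)
      fix \<kappa> :: real assume \<kappa>: "0 < \<kappa>"
      have cO: "cball x \<rho> \<subseteq> Omega" using \<rho>(2) by blast
      obtain k ulo uhi where k: "least_supersol F (beta_eps rho sig0 gam (eps k)) Omega f ulo uhi (u k)"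
        and close: "\<And>y. y \<in> cball x \<rho> \<Longrightarrow> \<bar>u k y - u0 y\<bar> < min \<kappa> (u0 z)"
        using approximant[OF compact_cball cO, of "min \<kappa> (u0 z)"] \<kappa> uz by (metis min_less_iff_conj)
      have upos: "0 < u k y" if "y \<in> ball x \<rho>" for y
        using close[of y] z(2)[of y] that by (auto simp: abs_less_iff)
      have bO: "ball x \<rho> \<subseteq> Omega" using bP by blast
      have "visc_sub F (\<lambda>y. 0) (ball x \<rho>) (u k)"
        by (rule visc_sub_weaken[OF ls_subsol[OF ell F0 Om f_nonneg beta_facts k u_continuous(1)] _ bO]) auto
      moreover have "visc_super F (\<lambda>y. gam * u k y powr (gam - 1)) (ball x \<rho>) (u k)"
        by (rule visc_super_weaken[OF ls_super[OF ell F0 Om f_nonneg beta_facts k u_continuous(1)] _ bO])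
           (use upos in \<open>auto intro!: beta_eps_le[OF rho_smooth rho_nonneg rho_supp rho_int sig0 gam eps_pos]\<close>)
      ultimately show "\<exists>k. visc_sub F (\<lambda>y. 0) (ball x \<rho>) (u k) \<and>
          visc_super F (\<lambda>y. gam * u k y powr (gam - 1)) (ball x \<rho>) (u k) \<and>
          (\<forall>y\<in>ball x \<rho>. \<bar>u k y - u0 y\<bar> < \<kappa>)"
        using close by (intro exI[of _ k]) force
    qed
  qed
  have "visc_sub F (\<lambda>x. (\<lambda>t. 0) (u0 x)) ?P u0"
  proof (rule visc_sub_limit[OF ell positivity_open cP])
    fix x assume x: "x \<in> ?P"
    obtain \<rho> where \<rho>: "0 < \<rho>" "ball x \<rho> \<subseteq> ?P" and
      k: "\<And>\<kappa>. 0 < \<kappa> \<Longrightarrow> \<exists>k. visc_sub F (\<lambda>y. 0) (ball x \<rho>) (u k) \<and> (\<forall>y\<in>ball x \<rho>. \<bar>u k y - u0 y\<bar> < \<kappa>)"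
      using ex[OF x] by blast
    show "\<exists>\<rho>>0. ball x \<rho> \<subseteq> ?P \<and> (\<forall>\<kappa>>0. \<exists>v. visc_sub F (\<lambda>y. 0) (ball x \<rho>) v \<and>
      (\<forall>y\<in>ball x \<rho>. v y \<le> u0 y + \<kappa>) \<and> u0 x - \<kappa> < v x)"
    proof (intro exI[of _ \<rho>] conjI \<rho> allI impI)
      fix \<kappa> :: real assume "0 < \<kappa>"
      from k[OF this] obtain k where "visc_sub F (\<lambda>y. 0) (ball x \<rho>) (u k)"
        and c: "\<And>y. y \<in> ball x \<rho> \<Longrightarrow> \<bar>u k y - u0 y\<bar> < \<kappa>" by blast
      moreover have "u k y \<le> u0 y + \<kappa>" if "y \<in> ball x \<rho>" for y using c[OF that] by linarith
      moreover have "u0 x - \<kappa> < u k x" using c[of x] \<rho>(1) by simp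
      ultimately show "\<exists>v. visc_sub F (\<lambda>y. 0) (ball x \<rho>) v \<and>
        (\<forall>y\<in>ball x \<rho>. v y \<le> u0 y + \<kappa>) \<and> u0 x - \<kappa> < v x" by blast
    qed
  qed auto
  moreover have "visc_sub (\<lambda>M. - F (- M)) (\<lambda>x. (\<lambda>t. - (gam * (- t) powr (gam - 1))) (- u0 x)) ?P (\<lambda>x. - u0 x)"
  proof (rule visc_sub_limit[OF unif_elliptic_dual[OF ell] positivity_open, where G = "\<lambda>t. - (gam * (- t) powr (gam - 1))"])
    show "continuous_on ?P (\<lambda>x. - u0 x)" by (intro continuous_intros cP)
    fix x assume x: "x \<in> ?P"
    then show "isCont (\<lambda>t. - (gam * (- t) powr (gam - 1))) (- u0 x)"
      by (intro continuous_intros) auto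
    obtain \<rho> where \<rho>: "0 < \<rho>" "ball x \<rho> \<subseteq> ?P" and
      k: "\<And>\<kappa>. 0 < \<kappa> \<Longrightarrow> \<exists>k. visc_super F (\<lambda>y. gam * u k y powr (gam - 1)) (ball x \<rho>) (u k) \<and>
        (\<forall>y\<in>ball x \<rho>. \<bar>u k y - u0 y\<bar> < \<kappa>)"
      using ex[OF x] by blast
    show "\<exists>\<rho>>0. ball x \<rho> \<subseteq> ?P \<and> (\<forall>\<kappa>>0. \<exists>v. visc_sub (\<lambda>M. - F (- M)) (\<lambda>y. - (gam * (- v y) powr (gam - 1))) (ball x \<rho>) v \<and>
      (\<forall>y\<in>ball x \<rho>. v y \<le> - u0 y + \<kappa>) \<and> - u0 x - \<kappa> < v x)"
    proof (intro exI[of _ \<rho>] conjI \<rho> allI impI)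
      fix \<kappa> :: real assume "0 < \<kappa>"
      from k[OF this] obtain k where k: "visc_super F (\<lambda>y. gam * u k y powr (gam - 1)) (ball x \<rho>) (u k)"
        and c: "\<And>y. y \<in> ball x \<rho> \<Longrightarrow> \<bar>u k y - u0 y\<bar> < \<kappa>" by blast
      have "visc_sub (\<lambda>M. - F (- M)) (\<lambda>y. - (gam * (- (- u k y)) powr (gam - 1))) (ball x \<rho>) (\<lambda>y. - u k y)"
        using k unfolding visc_super_dual by simp
      moreover have "- u k y \<le> - u0 y + \<kappa>" if "y \<in> ball x \<rho>" for y using c[OF that] by linarith
      moreover have "- u0 x - \<kappa> < - u k x" using c[of x] \<rho>(1) by simp
      ultimately show "\<exists>v. visc_sub (\<lambda>M. - F (- M)) (\<lambda>y. - (gam * (- v y) powr (gam - 1))) (ball x \<rho>) v \<and>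
        (\<forall>y\<in>ball x \<rho>. v y \<le> - u0 y + \<kappa>) \<and> - u0 x - \<kappa> < v x"
        by (intro exI[of _ "\<lambda>y. - u k y"]) blast
    qed
  qed
  then have "visc_super F (\<lambda>x. gam * u0 x powr (gam - 1)) ?P u0"
    unfolding visc_super_dual by simp
  ultimately show ?thesis by (auto simp: singular_sol_def)
qed

text \<open>\<open>X\<close> is only in the closure, so a point \<open>X'\<close> of positivity
  within \<open>r / 4\<close> takes its place. A too small supremum would force
  \<open>u k X'\<close> below \<open>(1 + sig0) * eps k powr alpha_of gam\<close>, which tends to 0,
  while \<open>u k X'\<close> approaches the positive value \<open>u0 X'\<close>.\<close>

lemma u0_nondegenerate:
  assumes A: "0 < A" "Lam * alpha_of gam * A powr (2 - gam) \<le> gam"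
    and r: "0 < r" "cball X r \<subseteq> Omega" and X: "X \<in> closure {x \<in> Omega. 0 < u0 x}"
  shows "A * (r / 4) powr alpha_of gam / 2 \<le> Sup (u0 ` ball X r)"
proof (rule ccontr)
  define Q where "Q = A * (r / 4) powr alpha_of gam / 2"
  assume "\<not> A * (r / 4) powr alpha_of gam / 2 \<le> Sup (u0 ` ball X r)"
  then have less: "Sup (u0 ` ball X r) < Q" by (simp add: Q_def)
  have Q: "0 < Q" using A r by (simp add: Q_def)
  have "compact (u0 ` cball X r)"
    by (intro compact_continuous_image continuous_on_subset[OF u_continuous(2) r(2)]) auto
  then have bdd: "bdd_above (u0 ` ball X r)"
    by (rule bdd_above_mono[OF bounded_imp_bdd_above[OF compact_imp_bounded]]) (use ball_subset_cball in auto)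
  have u0Q: "u0 y < Q" if "y \<in> ball X r" for y
    using cSUP_upper[OF that bdd] less by simp
  obtain X' where X': "X' \<in> Omega" "0 < u0 X'" "dist X' X < r / 4"
    using X r(1) unfolding closure_approachable by (metis (mono_tags, lifting) mem_Collect_eq zero_less_divide_iff zero_less_numeral)
  have sub: "cball X' (r / 2) \<subseteq> ball X r"
  proof
    fix y assume "y \<in> cball X' (r / 2)"
    then show "y \<in> ball X r" using dist_triangle[of X y X'] X'(3) r(1) by (simp add: dist_commute)
  qed
  then have subO: "cball X' (r / 2) \<subseteq> Omega" using r(2) ball_subset_cball by blast
  have al: "0 < alpha_of gam" using gam by (simp add: alpha_of_def add_pos_pos)
  have "(\<lambda>k. (1 + sig0) * eps k powr alpha_of gam) \<longlonglongrightarrow> (1 + sig0) * 0"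
    using eps_pos al by (intro tendsto_mult_left tendsto_zero_powrI[OF eps_lim tendsto_const]) (auto simp: less_imp_le)
  then have ev1: "\<forall>\<^sub>F k in sequentially. (1 + sig0) * eps k powr alpha_of gam < u0 X' / 2"
    using X'(2) by (intro order_tendstoD) auto
  have ev2: "\<forall>\<^sub>F k in sequentially. \<forall>y\<in>cball X' (r / 2). \<bar>u k y - u0 y\<bar> < min Q (u0 X' / 2)"
    using Q X'(2) by (intro conv subO) auto
  obtain k ulo uhi where k: "least_supersol F (beta_eps rho sig0 gam (eps k)) Omega f ulo uhi (u k)"
    and k1: "(1 + sig0) * eps k powr alpha_of gam < u0 X' / 2"
    and k2: "\<And>y. y \<in> cball X' (r / 2) \<Longrightarrow> \<bar>u k y - u0 y\<bar> < min Q (u0 X' / 2)"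
    using eventually_happens'[OF _ eventually_conj[OF eventually_least eventually_conj[OF ev1 ev2]]] by auto
  have "u k X' \<le> (1 + sig0) * eps k powr alpha_of gam"
  proof (rule ls_nondegenerate[OF ell F0 Om f_nonneg beta_facts k u_continuous(1) gam A _ _ _ subO])
    show "0 < (1 + sig0) * eps k powr alpha_of gam" using sig0 eps_pos[of k] by simp
    show "beta_eps rho sig0 gam (eps k) t = gam * t powr (gam - 1)" if "(1 + sig0) * eps k powr alpha_of gam \<le> t" for t
      by (rule beta_eps_large[OF rho_smooth rho_nonneg rho_supp rho_int sig0 gam eps_pos that])
    show "0 < r / 2" using r by simp
    fix y assume y: "y \<in> cball X' (r / 2)"
    then have "u0 y < Q" using sub by (intro u0Q) auto
    then have "u k y < 2 * Q" using k2[OF y] by linarith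
    then show "u k y < A * (r / 2 / 2) powr alpha_of gam" by (simp add: Q_def)
  qed
  moreover have "\<bar>u k X' - u0 X'\<bar> < u0 X' / 2" using k2[of X'] r(1) by simp
  ultimately show False using k1 by linarith
qed

end

theorem theorem8p2:
  fixes F :: "real^'n^'n \<Rightarrow> real"
    and Omega :: "(real^'n) set"
    and f :: "real^'n \<Rightarrow> real"
    and gam sig0 tau :: real
    and rho :: "real \<Rightarrow> real"
  assumes N2: "CARD('n) \<ge> 2"
    and dom: "lipschitz_domain Omega"
    and f_cont: "continuous_on (frontier Omega) f"
    and f_nonneg: "\<forall>x\<in>frontier Omega. f x \<ge> 0"
    and gam: "0 < gam" "gam < 1"
    and F_C1: "C1_sym_off0 F"
    and F0: "F 0 = 0"
    and F_ell: "\<exists>lam Lam. unif_elliptic F lam Lam"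
    and F_est: "0 < tau" "tau < 1" "interior_C2tau_estimates F tau"
    and rho_smooth: "smooth_fun rho"
    and rho_nonneg: "\<forall>t. rho t \<ge> 0"
    and rho_supp: "\<forall>t. t \<notin> {0..1} \<longrightarrow> rho t = 0"
    and rho_int: "integral {0..1} rho = 1"
    and sig0: "0 < sig0" "sig0 < 1/2"
  shows "\<forall>Omega'. compactly_contained Omega' Omega \<longrightarrow>
    (\<exists>C>0. \<exists>rho0>0.
      \<forall>(eps :: nat \<Rightarrow> real) (u :: nat \<Rightarrow> real^'n \<Rightarrow> real) Du (u0 :: real^'n \<Rightarrow> real) Du0.
        (\<forall>k. eps k > 0) \<and> eps \<longlonglongrightarrow> 0 \<and>
        (\<forall>k. minimal_sol F (beta_eps rho sig0 gam (eps k)) Omega f (u k)) \<and>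
        (\<forall>k. \<forall>x\<in>Omega. (u k has_derivative (\<lambda>h. Du k x \<bullet> h)) (at x)) \<and>
        (\<forall>k. continuous_on Omega (Du k)) \<and>
        (\<forall>x\<in>Omega. (u0 has_derivative (\<lambda>h. Du0 x \<bullet> h)) (at x)) \<and>
        (\<forall>K. compact K \<and> K \<subseteq> Omega \<longrightarrow>
           (\<forall>e>0. \<forall>\<^sub>F k in sequentially. \<forall>x\<in>K.
              \<bar>u k x - u0 x\<bar> < e \<and> norm (Du k x - Du0 x) < e))
      \<longrightarrow>
        (\<forall>X r. X \<in> Omega' \<and> X \<in> closure {x\<in>Omega. u0 x > 0} \<and>
           (\<exists>Y\<in>frontier {x\<in>Omega. u0 x > 0} \<inter> Omega.
               dist X Y < infdist X (frontier Omega') / 2) \<and>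
           0 < r \<and> r \<le> rho0 \<longrightarrow>
             r powr alpha_of gam / C \<le> Sup (u0 ` ball X r) \<and>
             Sup (u0 ` ball X r) \<le> u0 X + C * u0 X powr (gam / 2) * r + C * r powr alpha_of gam))"
proof (intro allI impI)
  fix Omega' assume cc: "compactly_contained Omega' Omega"
  obtain lam Lam where ell: "unif_elliptic F lam Lam" using F_ell by blast
  have l: "0 < lam" "0 < Lam" using ell by (auto simp: unif_elliptic_def)
  have Om: "open Omega" "bounded Omega" using dom by (auto simp: lipschitz_domain_def)
  have al: "0 < alpha_of gam" using gam by (simp add: alpha_of_def add_pos_pos)
  obtain e where e: "0 < e" and thick: "\<And>x. x \<in> Omega' \<Longrightarrow> ball x e \<subseteq> Omega"
  proof -
    obtain e where "e > 0" "(\<Union>x\<in>closure Omega'. ball x e) \<subseteq> Omega"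
      using compact_subset_open_imp_ball_epsilon_subset[of "closure Omega'" Omega] cc Om
      unfolding compactly_contained_def by blast
    moreover have "Omega' \<subseteq> closure Omega'" by (rule closure_subset)
    ultimately show thesis using that[of e] by blast
  qed
  \<comment> \<open>The largest constant allowed by the supersolution condition, with equality in
    \<open>Lam * alpha_of gam * A powr (2 - gam) \<le> gam\<close>; then \<open>C'\<close> makes
    \<open>r powr alpha_of gam / C'\<close> equal to the nondegeneracy bound.\<close>
  define A where "A = (gam / (Lam * alpha_of gam)) powr (1 / (2 - gam))"
  have A: "0 < A" "Lam * alpha_of gam * A powr (2 - gam) \<le> gam"
    using gam l al by (auto simp: A_def powr_powr)
  define C' where "C' = 2 * 4 powr alpha_of gam / A"
  have C': "0 < C'" using A by (simp add: C'_def)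
  show "\<exists>C>0. \<exists>rho0>0.
      \<forall>(eps :: nat \<Rightarrow> real) (u :: nat \<Rightarrow> real^'n \<Rightarrow> real) Du (u0 :: real^'n \<Rightarrow> real) Du0.
        (\<forall>k. eps k > 0) \<and> eps \<longlonglongrightarrow> 0 \<and>
        (\<forall>k. minimal_sol F (beta_eps rho sig0 gam (eps k)) Omega f (u k)) \<and>
        (\<forall>k. \<forall>x\<in>Omega. (u k has_derivative (\<lambda>h. Du k x \<bullet> h)) (at x)) \<and>
        (\<forall>k. continuous_on Omega (Du k)) \<and>
        (\<forall>x\<in>Omega. (u0 has_derivative (\<lambda>h. Du0 x \<bullet> h)) (at x)) \<and>
        (\<forall>K. compact K \<and> K \<subseteq> Omega \<longrightarrow>
           (\<forall>e>0. \<forall>\<^sub>F k in sequentially. \<forall>x\<in>K.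
              \<bar>u k x - u0 x\<bar> < e \<and> norm (Du k x - Du0 x) < e))
      \<longrightarrow>
        (\<forall>X r. X \<in> Omega' \<and> X \<in> closure {x\<in>Omega. u0 x > 0} \<and>
           (\<exists>Y\<in>frontier {x\<in>Omega. u0 x > 0} \<inter> Omega.
               dist X Y < infdist X (frontier Omega') / 2) \<and>
           0 < r \<and> r \<le> rho0 \<longrightarrow>
             r powr alpha_of gam / C \<le> Sup (u0 ` ball X r) \<and>
             Sup (u0 ` ball X r) \<le> u0 X + C * u0 X powr (gam / 2) * r + C * r powr alpha_of gam)"
  \<comment> \<open>The upper constant is obtained before any sequence is introduced; its bound is
    quantified over domains and functions, so it is uniform in the limit function.\<close>
  proof (rule growth_upper_estimate[OF ell F0 gam F_est(3)])
    fix C :: real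
    assume C: "0 < C" and upper:
      "\<And>Omega u Du X r Y y. open Omega \<Longrightarrow> (\<And>x. x \<in> Omega \<Longrightarrow> 0 \<le> u x) \<Longrightarrow>
      (\<And>x. x \<in> Omega \<Longrightarrow> (u has_derivative (\<lambda>h. Du x \<bullet> h)) (at x)) \<Longrightarrow>
      singular_sol F gam {x \<in> Omega. 0 < u x} u \<Longrightarrow> 0 < r \<Longrightarrow> ball X (dist X Y + 2 * r) \<subseteq> Omega \<Longrightarrow>
      u Y = 0 \<Longrightarrow> y \<in> ball X r \<Longrightarrow>
      u y \<le> u X + C * u X powr (gam / 2) * r + C * r powr alpha_of gam"
    have max0: "0 < max C C'" and e4: "0 < e / 4" using C e by auto
    show ?thesis
    \<comment> \<open>Radii up to \<open>e / 4\<close> suffice: the enlargement by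
      \<open>2 * r\<close> then stays within the distance \<open>e\<close> by which
      \<open>Omega'\<close> can be thickened inside \<open>Omega\<close>.\<close>
    proof (rule exI[of _ "max C C'"], rule conjI[OF max0], rule exI[of _ "e / 4"], rule conjI[OF e4],
        intro conjI allI impI; elim conjE bexE IntE)
      fix eps :: "nat \<Rightarrow> real" and u :: "nat \<Rightarrow> real^'n \<Rightarrow> real" and Du and u0 :: "real^'n \<Rightarrow> real" and Du0
        and X r Y
      assume eps: "\<forall>k. eps k > 0" "eps \<longlonglongrightarrow> 0"
        and min: "\<forall>k. minimal_sol F (beta_eps rho sig0 gam (eps k)) Omega f (u k)"
        and der: "\<forall>k. \<forall>x\<in>Omega. (u k has_derivative (\<lambda>h. Du k x \<bullet> h)) (at x)"
        and der0: "\<forall>x\<in>Omega. (u0 has_derivative (\<lambda>h. Du0 x \<bullet> h)) (at x)"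
        and conv: "\<forall>K. compact K \<and> K \<subseteq> Omega \<longrightarrow>
           (\<forall>e>0. \<forall>\<^sub>F k in sequentially. \<forall>x\<in>K.
              \<bar>u k x - u0 x\<bar> < e \<and> norm (Du k x - Du0 x) < e)"
        and X: "X \<in> Omega'" "X \<in> closure {x\<in>Omega. u0 x > 0}"
        and Y: "dist X Y < infdist X (frontier Omega') / 2" "Y \<in> frontier {x\<in>Omega. u0 x > 0}" "Y \<in> Omega"
        and r: "0 < r" "r \<le> e / 4"
      have conv': "\<forall>\<^sub>F k in sequentially. \<forall>x\<in>K. \<bar>u k x - u0 x\<bar> < e"
        if "compact K" "K \<subseteq> Omega" "0 < e" for K e
      proof -
        have "\<forall>\<^sub>F k in sequentially. \<forall>x\<in>K. \<bar>u k x - u0 x\<bar> < e \<and> norm (Du k x - Du0 x) < e"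
          using conv that by blast
        then show ?thesis by (rule eventually_mono) blast
      qed
      note facts = Om f_nonneg gam F0 ell rho_smooth rho_nonneg rho_supp rho_int sig0(1)
        eps(1)[rule_format] eps(2) min[rule_format] der[rule_format] der0[rule_format] conv' Y(2,3)
      have rO: "cball X r \<subseteq> Omega" using thick[OF X(1)] r e by (force simp: subset_iff)
      show "r powr alpha_of gam / max C C' \<le> Sup (u0 ` ball X r)"
      proof -
        have "r powr alpha_of gam / max C C' \<le> r powr alpha_of gam / C'"
          using C' by (intro divide_left_mono) auto
        also have "\<dots> = A * (r / 4) powr alpha_of gam / 2"
          using A r by (simp add: C'_def powr_divide mult_ac)
        also have "\<dots> \<le> Sup (u0 ` ball X r)"
          by (rule u0_nondegenerate[OF facts A r(1) rO X(2)])
        finally show ?thesis .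
      qed
      show "Sup (u0 ` ball X r) \<le> u0 X + max C C' * u0 X powr (gam / 2) * r + max C C' * r powr alpha_of gam"
      proof (rule cSUP_least)
        show "ball X r \<noteq> {}" using r by simp
        fix y assume y: "y \<in> ball X r"
        \<comment> \<open>This is where the closeness of \<open>X\<close> to the free boundary
          enters: the whole ball reaching to \<open>Y\<close> lies in \<open>Omega'\<close>, so its
          thickening is contained in \<open>Omega\<close>.\<close>
        have "cball X (dist X Y) \<subseteq> ball X (infdist X (frontier Omega'))"
          using Y(1) zero_le_dist[of X Y] by (auto simp del: zero_le_dist)
        also have "\<dots> \<subseteq> Omega'" by (rule ball_infdist_frontier_subset[OF X(1)])
        finally have sub: "ball X (dist X Y + 2 * r) \<subseteq> Omega"
          using r by (intro ball_thickening_subset[OF thick e]) auto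
        have "u0 y \<le> u0 X + C * u0 X powr (gam / 2) * r + C * r powr alpha_of gam"
          by (rule upper[OF Om(1) u0_nonneg[OF facts] der0[rule_format] u0_singular_sol[OF facts] r(1) sub u0_Y0[OF facts] y])
        also have "\<dots> \<le> u0 X + max C C' * u0 X powr (gam / 2) * r + max C C' * r powr alpha_of gam"
          using r by (intro add_mono mult_right_mono) auto
        finally show "u0 y \<le> u0 X + max C C' * u0 X powr (gam / 2) * r + max C C' * r powr alpha_of gam" .
      qed
    qed
  qed
qed

end
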